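(* For every $r>0$ and every $\xi\in(1,2)$ there exists a constant $C>0$ such that for all $f\in E(S^1)$ with $\operatorname{dist}(f,S^1)\ge r$ one has \[ \bigl|\,\|\tilde\omega_f\|_{\rm ir}-1\,\bigr|\le C\,\operatorname{dist}(f,S^2_+)^{\xi}. \]
   Context: $E(S^1)$ is the set of functions $f:\mathbb{R}\to\mathbb{R}$ (write $f_\alpha=f(\alpha)$) that are $1$-Lipschitz and satisfy $f_{\alpha+\pi}+f_\alpha=\pi$ for all $\alpha\in\mathbb{R}$. Such functions are $2\pi$-periodic with values in $[0,\pi]$. $E(S^1)$ carries the sup norm $\|\cdot\|_\infty$, and $\operatorname{dist}$ denotes distance with respect to this norm. $S^1\subset E(S^1)$ is the set of functions $\alpha\mapsto\arccos(\cos(\alpha-\tau))$ with $\tau\in\mathbb{R}$. $S^2_+\subset E(S^1)$ is the set of functions $\alpha\mapsto\arccos(\cos(d)\cos(\alpha-\tau))$ with $\tau\in\mathbb{R}$ and $d\in[0,\pi/2]$. A function $f\in E(S^1)\setminus S^1$ takes values in $(0,\pi)$. For such $f$ and for $\alpha,\beta$ with $\beta-\alpha\notin\pi\mathbb{Z}$, define \[ p_{\alpha,\beta}(f)=\frac{1-\cos(\beta-\alpha)^2-\cos(f_\alpha)^2-\cos(f_\beta)^2+2\cos(\beta-\alpha)\cos(f_\alpha)\cos(f_\beta)}{\sin(\beta-\alpha)^2\sin(f_\alpha)^2\sin(f_\beta)^2}. \] For $v,w\in L^\infty([0,\pi))$ set \[ \tilde\omega_f(v\wedge w)=\frac1\pi\int_0^\pi\int_\alpha^\pi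 p_{\alpha,\beta}(f)\,(v_\alpha w_\beta-v_\beta w_\alpha)\,d\beta\,d\alpha. \] The inscribed Riemannian area $\mu^{\rm ir}(v\wedge w)$ is defined as follows. If $v,w$ are linearly dependent, it is $0$. Otherwise, let $V=\mathrm{span}(v,w)$ with the norm $\|\cdot\|_\infty$. Then $\mu^{\rm ir}(v\wedge w)$ is the measure of the parallelogram spanned by $v,w$ under the Haar measure on $V$ normalized so that the ellipse of maximal area contained in the unit ball of $V$ (the Löwner–John ellipse) has measure $\pi$. The comass $\|\tilde\omega_f\|_{\rm ir}$ is the infimum of all $M\ge0$ such that $|\tilde\omega_f(v\wedge w)|\le M\mu^{\rm ir}(v\wedge w)$ for all $v,w\in L^\infty([0,\pi))$. *)

theory Defs
  imports "HOL-Analysis.Analysis"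
begin

definition ES1 :: "(real \<Rightarrow> real) set" where
  "ES1 = {f. (\<forall>x y. \<bar>f x - f y\<bar> \<le> \<bar>x - y\<bar>) \<and> (\<forall>a. f (a + pi) + f a = pi)}"

definition S1 :: "(real \<Rightarrow> real) set" where
  "S1 = {(\<lambda>a. arccos (cos (a - \<tau>))) | \<tau>. True}"

definition S2plus :: "(real \<Rightarrow> real) set" where
  "S2plus = {(\<lambda>a. arccos (cos d * cos (a - \<tau>))) | \<tau> d. 0 \<le> d \<and> d \<le> pi / 2}"

definition sup_dist :: "(real \<Rightarrow> real) \<Rightarrow> (real \<Rightarrow> real) \<Rightarrow> real" where
  "sup_dist f g = (SUP a. \<bar>f a - g a\<bar>)"

definition set_sup_dist :: "(real \<Rightarrow> real) \<Rightarrow> (real \<Rightarrow> real) set \<Rightarrow> real" where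
  "set_sup_dist f S = (INF g\<in>S. sup_dist f g)"

definition Linf :: "(real \<Rightarrow> real) set" where
  "Linf = {v. set_borel_measurable lborel {0..<pi} v \<and>
               (\<exists>C. AE x in lborel. x \<in> {0..<pi} \<longrightarrow> \<bar>v x\<bar> \<le> C)}"

definition Linf_norm :: "(real \<Rightarrow> real) \<Rightarrow> real" where
  "Linf_norm v = Inf {C. 0 \<le> C \<and> (AE x in lborel. x \<in> {0..<pi} \<longrightarrow> \<bar>v x\<bar> \<le> C)}"

definition Linf_lin_dep :: "(real \<Rightarrow> real) \<Rightarrow> (real \<Rightarrow> real) \<Rightarrow> bool" where
  "Linf_lin_dep v w \<longleftrightarrow> (\<exists>a b. (a \<noteq> 0 \<or> b \<noteq> 0) \<and>
       (AE x in lborel. x \<in> {0..<pi} \<longrightarrow> a * v x + b * w x = 0))"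

text \<open>Inscribed Riemannian area. In coordinates (a,b) \<mapsto> a v + b w of V = span(v,w),
  an ellipse is the image of the closed unit disk under (s,t) \<mapsto> c + M (s,t); its
  coordinate (Lebesgue) area is pi |det M|. Normalizing Haar measure so that the maximal
  inscribed ellipse gets measure pi, the parallelogram spanned by v,w (coordinate area 1)
  gets measure 1 / sup |det M| over ellipses contained in the unit ball of V.\<close>
definition mu_ir :: "(real \<Rightarrow> real) \<Rightarrow> (real \<Rightarrow> real) \<Rightarrow> real" where
  "mu_ir v w = (if Linf_lin_dep v w then 0 else
     1 / Sup {\<bar>m11 * m22 - m12 * m21\<bar> | m11 m12 m21 m22 c1 c2.
        \<forall>s t. s\<^sup>2 + t\<^sup>2 \<le> 1 \<longrightarrow>
          Linf_norm (\<lambda>x. (c1 + m11 * s + m12 * t) * v x + (c2 + m21 * s + m22 * t) * w x) \<le> 1})"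

definition p_ab :: "(real \<Rightarrow> real) \<Rightarrow> real \<Rightarrow> real \<Rightarrow> real" where
  "p_ab f a b =
    (1 - (cos (b - a))\<^sup>2 - (cos (f a))\<^sup>2 - (cos (f b))\<^sup>2 + 2 * cos (b - a) * cos (f a) * cos (f b)) /
    ((sin (b - a))\<^sup>2 * (sin (f a))\<^sup>2 * (sin (f b))\<^sup>2)"

definition omega_t :: "(real \<Rightarrow> real) \<Rightarrow> (real \<Rightarrow> real) \<Rightarrow> (real \<Rightarrow> real) \<Rightarrow> real" where
  "omega_t f v w = (1 / pi) *
     (LINT a:{0..pi}|lborel. (LINT b:{a..pi}|lborel. p_ab f a b * (v a * w b - v b * w a)))"

definition comass_ir :: "(real \<Rightarrow> real) \<Rightarrow> real" where
  "comass_ir f = Inf {M. 0 \<le> M \<and> (\<forall>v\<in>Linf. \<forall>w\<in>Linf. \<bar>omega_t f v w\<bar> \<le> M * mu_ir v w)}"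

end

theory Submission
  imports Defs
begin

text \<open>By normalizing the inscribed ellipse, the comass is the supremum of \<open>\<omega>\<^sub>f(v, w)\<close> over pairs
  with \<open>v\<^sup>2 + w\<^sup>2 \<le> 1\<close>. If \<open>f\<close> belongs to a point \<open>p\<close> of the open hemisphere and \<open>\<phi>\<close> is the
  direction at \<open>p\<close> of the boundary point \<open>a\<close>, then the kernel times \<open>da db\<close> is \<open>d\<phi> d\<phi>'\<close>, the form is
  the area enclosed by a centrally symmetric closed curve of speed at most \<open>1\<close>, and the isoperimetric
  inequality gives comass \<open>1\<close>, attained by \<open>(cos \<phi>, sin \<phi>)\<close>. Wirtinger's inequality moreover bounds
  from below the deficit of a pair by its squared distance from the rotations of the extremal one.

  Let now \<open>f\<close> be at distance \<open>\<delta>\<close> from such a point. The kernel changes by \<open>O(min 1 (\<delta> / s))\<close>, where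
  \<open>s = sin (b - a)\<close>. On the extremal pair the part linear in \<open>\<delta>\<close> integrates to zero and the remainder is
  \<open>O(\<delta> min 1 (\<delta> / s))\<close>, since the bracket of the pair is \<open>O(s)\<close>; both bounds follow up to logarithms. On the
  difference from the extremal pair, Schur's test gives a gain linear in that difference with a factor
  \<open>\<delta>\<close> (up to logarithms), which the quadratic deficit absorbs at the cost of its square.\<close>

section \<open>Integrals over the triangle\<close>

text \<open>The range of \<open>\<xi>\<close> reflects the singularity of the perturbed kernel. Its
  expansion in the error of \<open>cos f\<close> has a linear term of size \<delta>/s and a
  quadratic one of size (\<delta>/s)^2, useful only where s > \<delta>; elsewhere only boundedness
  of the kernel is left. To avoid the logarithm, min 1 (\<delta>/s) is weakened to a power q < 1,
  whose integral is of order \<delta>^q with a constant that grows without bound as q approaches 1.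
  The contribution of the extremal pair is then of order \<delta>^(1+q), used with q = \<xi> - 1,
  and the squared gain of order \<delta>^(2q), used with q = \<xi>/2; both choices of q lie strictly
  between 0 and 1 because 1 < \<xi> < 2. The distance from \<open>S1\<close> enters through r \<le>
  f \<le> pi - r. This bounds sin f, and with it the height of the nearby hemisphere point, from
  below, which makes all constants uniform in f. If \<delta> is at least r/2, mere boundedness of
  the comass suffices.\<close>

definition tri_fun :: "(real \<Rightarrow> real \<Rightarrow> real) \<Rightarrow> real \<times> real \<Rightarrow> real" where
  "tri_fun \<Psi> z = (if 0 \<le> fst z \<and> fst z \<le> snd z \<and> snd z \<le> pi then \<Psi> (fst z) (snd z) else 0)"

definition tri :: "(real \<Rightarrow> real \<Rightarrow> real) \<Rightarrow> real" where
  "tri \<Psi> = integral\<^sup>L lborel (tri_fun \<Psi>)"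

text \<open>Boundedness is asked on the triangle only, where \<open>p_ab f\<close> is estimated;
  measurability on the whole plane makes the class closed under sums and products and gives Fubini
  in both orders.\<close>

definition tri_adm :: "(real \<Rightarrow> real \<Rightarrow> real) \<Rightarrow> bool" where
  "tri_adm \<Psi> \<longleftrightarrow> (\<lambda>z. \<Psi> (fst z) (snd z)) \<in> borel_measurable borel \<and>
     (\<exists>C. \<forall>a b. 0 \<le> a \<longrightarrow> a \<le> b \<longrightarrow> b \<le> pi \<longrightarrow> \<bar>\<Psi> a b\<bar> \<le> C)"

lemma tri_admI:
  assumes "(\<lambda>z. \<Psi> (fst z) (snd z)) \<in> borel_measurable borel"
    and "\<And>a b. 0 \<le> a \<Longrightarrow> a \<le> b \<Longrightarrow> b \<le> pi \<Longrightarrow> \<bar>\<Psi> a b\<bar> \<le> C"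
  shows "tri_adm \<Psi>"
  using assms unfolding tri_adm_def by blast

lemma tri_adm_measurable: "tri_adm \<Psi> \<Longrightarrow> (\<lambda>z. \<Psi> (fst z) (snd z)) \<in> borel_measurable borel"
  by (simp add: tri_adm_def)

lemma tri_fun_measurable:
  assumes "(\<lambda>z. \<Psi> (fst z) (snd z)) \<in> borel_measurable borel"
  shows "tri_fun \<Psi> \<in> borel_measurable borel"
proof -
  define T where "T = {z::real \<times> real. 0 \<le> fst z \<and> fst z \<le> snd z \<and> snd z \<le> pi}"
  have "closed T"
    unfolding T_def by (intro closed_Collect_conj closed_Collect_le continuous_intros)
  then have "(\<lambda>z. indicat_real T z * \<Psi> (fst z) (snd z)) \<in> borel_measurable borel"
    by (intro borel_measurable_times assms borel_measurable_indicator borel_closed)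
  moreover have "tri_fun \<Psi> = (\<lambda>z. indicat_real T z * \<Psi> (fst z) (snd z))"
    by (auto simp: tri_fun_def T_def)
  ultimately show ?thesis by simp
qed

lemma tri_square_integrable:
  "integrable lborel (\<lambda>z::real\<times>real. indicator ({0..pi} \<times> {0..pi}) z * (C::real))"
proof -
  have "{0..pi} \<times> {0..pi} = cbox (0,0) (pi,pi)" by auto
  then have "emeasure lborel ({0..pi} \<times> {0..pi}) < \<infinity>"
    using emeasure_lborel_cbox_finite[of "(0,0)" "(pi,pi)"] by (simp add: less_top)
  then show ?thesis
    by (intro integrable_mult_left integrable_real_indicator) (auto intro!: borel_closed closed_Times)
qed

lemma tri_integrable:
  assumes "tri_adm \<Psi>"
  shows "integrable lborel (tri_fun \<Psi>)"
proof -
  obtain C where C: "\<And>a b. 0 \<le> a \<Longrightarrow> a \<le> b \<Longrightarrow> b \<le> pi \<Longrightarrow> \<bar>\<Psi> a b\<bar> \<le> C"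
    using assms unfolding tri_adm_def by blast
  have C0: "0 \<le> C" using C[of 0 0] pi_ge_zero by linarith
  show ?thesis
  proof (rule Bochner_Integration.integrable_bound[OF tri_square_integrable[of C]])
    show "tri_fun \<Psi> \<in> borel_measurable lborel"
      using tri_fun_measurable[OF tri_adm_measurable[OF assms]] by simp
    show "AE x in lborel. norm (tri_fun \<Psi> x) \<le> norm (indicator ({0..pi} \<times> {0..pi}) x * C)"
      using C C0 by (intro AE_I2) (auto simp: tri_fun_def indicator_def mem_Times_iff split: if_splits)
  qed
qed

lemma iterated_tri_fun:
  "(LINT a:{0..pi}|lborel. (LINT b:{a..pi}|lborel. \<Psi> a b)) = (LINT a|lborel. LINT b|lborel. tri_fun \<Psi> (a, b))"
  unfolding set_lebesgue_integral_def
proof (intro Bochner_Integration.integral_cong refl)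
  fix a :: real
  show "indicat_real {0..pi} a *\<^sub>R (LINT b|lborel. indicat_real {a..pi} b *\<^sub>R \<Psi> a b)
      = (LINT b|lborel. tri_fun \<Psi> (a, b))"
  proof (cases "a \<in> {0..pi}")
    case True
    then show ?thesis
      by (auto intro!: Bochner_Integration.integral_cong simp: tri_fun_def indicator_def)
  next
    case False
    then have "(\<lambda>b. tri_fun \<Psi> (a, b)) = (\<lambda>b. 0)" by (auto simp: tri_fun_def)
    then show ?thesis using False by (simp add: indicator_def)
  qed
qed

lemma tri_iterated:
  assumes "tri_adm \<Psi>"
  shows "tri \<Psi> = (LINT a:{0..pi}|lborel. (LINT b:{a..pi}|lborel. \<Psi> a b))"
proof -
  have i: "integrable (lborel \<Otimes>\<^sub>M lborel) (tri_fun \<Psi>)"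
    using tri_integrable[OF assms] by (simp add: lborel_prod)
  show ?thesis
    using lborel_pair.integral_fst'[OF i] by (simp add: tri_def lborel_prod iterated_tri_fun)
qed

lemma tri_swapped:
  assumes "tri_adm \<Psi>"
  shows "tri \<Psi> = (LINT b:{0..pi}|lborel. (LINT a:{0..b}|lborel. \<Psi> a b))"
proof -
  have i: "integrable (lborel \<Otimes>\<^sub>M lborel) (case_prod (\<lambda>a b. tri_fun \<Psi> (a, b)))"
    using tri_integrable[OF assms] by (simp add: lborel_prod case_prod_beta')
  have "tri \<Psi> = integral\<^sup>L (lborel \<Otimes>\<^sub>M lborel) (case_prod (\<lambda>a b. tri_fun \<Psi> (a, b)))"
    by (simp add: tri_def lborel_prod case_prod_beta')
  also have "\<dots> = (LINT b|lborel. LINT a|lborel. tri_fun \<Psi> (a, b))"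
    using lborel_pair.integral_snd[OF i] by simp
  also have "\<dots> = (LINT b:{0..pi}|lborel. (LINT a:{0..b}|lborel. \<Psi> a b))"
    unfolding set_lebesgue_integral_def
  proof (intro Bochner_Integration.integral_cong refl)
    fix b :: real
    show "(LINT a|lborel. tri_fun \<Psi> (a, b)) =
       indicat_real {0..pi} b *\<^sub>R (LINT a|lborel. indicat_real {0..b} a *\<^sub>R \<Psi> a b)"
    proof (cases "b \<in> {0..pi}")
      case True
      then show ?thesis
        by (auto intro!: Bochner_Integration.integral_cong simp: tri_fun_def indicator_def)
    next
      case False
      then have "(\<lambda>a. tri_fun \<Psi> (a, b)) = (\<lambda>a. 0)" by (auto simp: tri_fun_def)
      then show ?thesis using False by (simp add: indicator_def)
    qed
  qed
  finally show ?thesis .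
qed

lemma tri_adm_add:
  assumes "tri_adm \<Phi>" "tri_adm \<Psi>"
  shows "tri_adm (\<lambda>a b. \<Phi> a b + \<Psi> a b)"
proof -
  obtain C C' where C: "\<And>a b. 0 \<le> a \<Longrightarrow> a \<le> b \<Longrightarrow> b \<le> pi \<Longrightarrow> \<bar>\<Phi> a b\<bar> \<le> C"
    "\<And>a b. 0 \<le> a \<Longrightarrow> a \<le> b \<Longrightarrow> b \<le> pi \<Longrightarrow> \<bar>\<Psi> a b\<bar> \<le> C'"
    using assms unfolding tri_adm_def by blast
  show ?thesis
  proof (rule tri_admI[where C="C + C'"])
    show "(\<lambda>z. \<Phi> (fst z) (snd z) + \<Psi> (fst z) (snd z)) \<in> borel_measurable borel"
      using assms by (intro borel_measurable_add) (simp_all add: tri_adm_def)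
  next
    fix a b :: real assume ab: "0 \<le> a" "a \<le> b" "b \<le> pi"
    show "\<bar>\<Phi> a b + \<Psi> a b\<bar> \<le> C + C'"
      using C(1)[OF ab] C(2)[OF ab] by linarith
  qed
qed

lemma tri_adm_mult:
  assumes "tri_adm \<Phi>" "tri_adm \<Psi>"
  shows "tri_adm (\<lambda>a b. \<Phi> a b * \<Psi> a b)"
proof -
  obtain C C' where C: "\<And>a b. 0 \<le> a \<Longrightarrow> a \<le> b \<Longrightarrow> b \<le> pi \<Longrightarrow> \<bar>\<Phi> a b\<bar> \<le> C"
    "\<And>a b. 0 \<le> a \<Longrightarrow> a \<le> b \<Longrightarrow> b \<le> pi \<Longrightarrow> \<bar>\<Psi> a b\<bar> \<le> C'"
    using assms unfolding tri_adm_def by blast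
  show ?thesis
  proof (rule tri_admI[where C="C * C'"])
    show "(\<lambda>z. \<Phi> (fst z) (snd z) * \<Psi> (fst z) (snd z)) \<in> borel_measurable borel"
      using assms by (intro borel_measurable_times) (simp_all add: tri_adm_def)
  next
    fix a b :: real assume ab: "0 \<le> a" "a \<le> b" "b \<le> pi"
    have "0 \<le> C" using C(1)[OF ab] by linarith
    then show "\<bar>\<Phi> a b * \<Psi> a b\<bar> \<le> C * C'"
      unfolding abs_mult by (intro mult_mono C ab) auto
  qed
qed

lemma tri_adm_const: "tri_adm (\<lambda>a b. c)"
  by (rule tri_admI[where C="\<bar>c\<bar>"]) auto

lemma tri_adm_diff:
  assumes "tri_adm \<Phi>" "tri_adm \<Psi>"
  shows "tri_adm (\<lambda>a b. \<Phi> a b - \<Psi> a b)"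
proof -
  have "tri_adm (\<lambda>a b. \<Phi> a b + (-1) * \<Psi> a b)"
    by (intro tri_adm_add tri_adm_mult tri_adm_const assms)
  then show ?thesis by simp
qed

lemma tri_adm_continuous:
  assumes "continuous_on UNIV (\<lambda>z. \<Psi> (fst z) (snd z))"
  shows "tri_adm \<Psi>"
proof -
  have "compact ((\<lambda>z. \<Psi> (fst z) (snd z)) ` cbox (0,0) (pi,pi))"
    by (intro compact_continuous_image compact_cbox continuous_on_subset[OF assms]) auto
  then obtain C where C: "\<forall>y \<in> (\<lambda>z. \<Psi> (fst z) (snd z)) ` cbox (0,0) (pi,pi). norm y \<le> C"
    by (auto dest!: compact_imp_bounded simp del: cbox_Pair_eq simp: bounded_iff)
  show ?thesis
  proof (rule tri_admI[where C=C])
    show "(\<lambda>z. \<Psi> (fst z) (snd z)) \<in> borel_measurable borel"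
      using assms by (rule borel_measurable_continuous_onI)
    show "\<bar>\<Psi> a b\<bar> \<le> C" if "0 \<le> a" "a \<le> b" "b \<le> pi" for a b
    proof -
      have "(a, b) \<in> cbox (0,0) (pi,pi)" using that by auto
      from imageI[OF this, of "\<lambda>z. \<Psi> (fst z) (snd z)"] C show ?thesis
        by (metis fst_conv snd_conv real_norm_def)
    qed
  qed
qed

lemma tri_add:
  assumes "tri_adm \<Phi>" "tri_adm \<Psi>"
  shows "tri (\<lambda>a b. \<Phi> a b + \<Psi> a b) = tri \<Phi> + tri \<Psi>"
proof -
  have "tri_fun (\<lambda>a b. \<Phi> a b + \<Psi> a b) = (\<lambda>z. tri_fun \<Phi> z + tri_fun \<Psi> z)"
    by (auto simp: tri_fun_def)
  then show ?thesis
    by (simp add: tri_def Bochner_Integration.integral_add tri_integrable assms)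
qed

lemma tri_cmult: "tri (\<lambda>a b. c * \<Phi> a b) = c * tri \<Phi>"
proof -
  have "tri_fun (\<lambda>a b. c * \<Phi> a b) = (\<lambda>z. c * tri_fun \<Phi> z)"
    by (auto simp: tri_fun_def)
  then show ?thesis by (simp add: tri_def)
qed

lemma tri_diff:
  assumes "tri_adm \<Phi>" "tri_adm \<Psi>"
  shows "tri (\<lambda>a b. \<Phi> a b - \<Psi> a b) = tri \<Phi> - tri \<Psi>"
proof -
  have "tri_fun (\<lambda>a b. \<Phi> a b - \<Psi> a b) = (\<lambda>z. tri_fun \<Phi> z - tri_fun \<Psi> z)"
    by (auto simp: tri_fun_def)
  then show ?thesis
    by (simp add: tri_def Bochner_Integration.integral_diff tri_integrable assms)
qed

lemma tri_mono:
  assumes "tri_adm \<Phi>" "tri_adm \<Psi>"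
    and "\<And>a b. 0 \<le> a \<Longrightarrow> a \<le> b \<Longrightarrow> b \<le> pi \<Longrightarrow> \<Phi> a b \<le> \<Psi> a b"
  shows "tri \<Phi> \<le> tri \<Psi>"
  unfolding tri_def
  by (intro Bochner_Integration.integral_mono tri_integrable assms) (auto simp: tri_fun_def assms(3))

lemma tri_abs_le:
  assumes "tri_adm \<Phi>" "tri_adm \<Psi>"
    and "\<And>a b. 0 \<le> a \<Longrightarrow> a \<le> b \<Longrightarrow> b \<le> pi \<Longrightarrow> \<bar>\<Phi> a b\<bar> \<le> \<Psi> a b"
  shows "\<bar>tri \<Phi>\<bar> \<le> tri \<Psi>"
proof -
  have *: "\<Phi> a b \<le> \<Psi> a b \<and> (-1) * \<Phi> a b \<le> \<Psi> a b"
    if "0 \<le> a" "a \<le> b" "b \<le> pi" for a b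
    using assms(3)[OF that] by linarith
  have "tri \<Phi> \<le> tri \<Psi>"
    by (rule tri_mono[OF assms(1,2)]) (use * in blast)
  moreover have "tri (\<lambda>a b. (-1) * \<Phi> a b) \<le> tri \<Psi>"
    by (rule tri_mono[OF tri_adm_mult[OF tri_adm_const assms(1)] assms(2)]) (use * in blast)
  ultimately show ?thesis unfolding tri_cmult by linarith
qed

lemma tri_cong:
  assumes "\<And>a b. 0 \<le> a \<Longrightarrow> a \<le> b \<Longrightarrow> b \<le> pi \<Longrightarrow> \<Phi> a b = \<Psi> a b"
  shows "tri \<Phi> = tri \<Psi>"
proof -
  have "tri_fun \<Phi> = tri_fun \<Psi>" using assms by (auto simp: tri_fun_def)
  then show ?thesis by (simp add: tri_def)
qed

lemma tri_const_le: "\<bar>tri (\<lambda>a b. c)\<bar> \<le> pi\<^sup>2 * \<bar>c\<bar>"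
proof -
  have e: "{0..pi} \<times> {0..pi} = cbox (0,0) (pi,pi)" by auto
  have m: "measure lborel ({0..pi} \<times> {0..pi}) = pi\<^sup>2"
    unfolding e using pi_ge_zero
    by (subst measure_lborel_cbox_eq) (auto simp: Basis_prod_def prod.union_disjoint power2_eq_square)
  have "tri (\<lambda>a b. \<bar>c\<bar>) \<le> (LINT z|lborel. indicator ({0..pi} \<times> {0..pi}) z * \<bar>c\<bar>)"
    unfolding tri_def
    by (intro Bochner_Integration.integral_mono tri_integrable tri_adm_const tri_square_integrable)
      (auto simp: tri_fun_def indicator_def mem_Times_iff)
  also have "\<dots> = pi\<^sup>2 * \<bar>c\<bar>" by (simp add: m)
  finally have "tri (\<lambda>a b. \<bar>c\<bar>) \<le> pi\<^sup>2 * \<bar>c\<bar>" .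
  moreover have "\<bar>tri (\<lambda>a b. c)\<bar> \<le> tri (\<lambda>a b. \<bar>c\<bar>)"
    by (intro tri_abs_le tri_adm_const) auto
  ultimately show ?thesis by simp
qed

section \<open>Comass and pairs with values in the unit disc\<close>

text \<open>The infimum defining the essential supremum is attained: the countably many bounds
  \<open>Inf A + inverse (real (Suc n))\<close> hold off a common null set.\<close>

lemma Linf_norm_AE:
  assumes "AE x in lborel. x \<in> {0..<pi} \<longrightarrow> \<bar>u x\<bar> \<le> C"
  shows "AE x in lborel. x \<in> {0..<pi} \<longrightarrow> \<bar>u x\<bar> \<le> Linf_norm u"
proof -
  define A where "A = {C. 0 \<le> C \<and> (AE x in lborel. x \<in> {0..<pi} \<longrightarrow> \<bar>u x\<bar> \<le> C)}"
  have "\<bar>C\<bar> \<in> A" unfolding A_def using assms by (auto elim!: eventually_mono)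
  then have ne: "A \<noteq> {}" by blast
  have "AE x in lborel. x \<in> {0..<pi} \<longrightarrow> \<bar>u x\<bar> \<le> Inf A + inverse (real (Suc n))" for n
  proof -
    have "Inf A < Inf A + inverse (real (Suc n))" by simp
    from cInf_lessD[OF ne this] obtain c where c: "c \<in> A" "c < Inf A + inverse (real (Suc n))"
      by blast
    have "AE x in lborel. x \<in> {0..<pi} \<longrightarrow> \<bar>u x\<bar> \<le> c" using c(1) by (simp add: A_def)
    then show ?thesis by eventually_elim (use c(2) in auto)
  qed
  then have "AE x in lborel. \<forall>n. x \<in> {0..<pi} \<longrightarrow> \<bar>u x\<bar> \<le> Inf A + inverse (real (Suc n))"
    by (simp only: AE_all_countable) blast
  then have "AE x in lborel. x \<in> {0..<pi} \<longrightarrow> \<bar>u x\<bar> \<le> Inf A"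
  proof eventually_elim
    case (elim x)
    show ?case
    proof (rule impI, rule ccontr)
      assume "x \<in> {0..<pi}" and "\<not> \<bar>u x\<bar> \<le> Inf A"
      then obtain n where "inverse (real (Suc n)) < \<bar>u x\<bar> - Inf A"
        using reals_Archimedean[of "\<bar>u x\<bar> - Inf A"] by auto
      then show False using elim[rule_format, of n] \<open>x \<in> {0..<pi}\<close> by linarith
    qed
  qed
  then show ?thesis by (simp add: Linf_norm_def A_def)
qed

lemma Linf_norm_le:
  assumes "0 \<le> C" "AE x in lborel. x \<in> {0..<pi} \<longrightarrow> \<bar>u x\<bar> \<le> C"
  shows "Linf_norm u \<le> C"
  unfolding Linf_norm_def by (rule cInf_lower) (use assms in \<open>auto intro!: bdd_belowI[where m=0]\<close>)

lemma Linf_combination_bounded: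
  assumes "v \<in> Linf" "w \<in> Linf"
  shows "\<exists>C. AE x in lborel. x \<in> {0..<pi} \<longrightarrow> \<bar>a * v x + b * w x\<bar> \<le> C"
proof -
  obtain C1 C2 where "AE x in lborel. x \<in> {0..<pi} \<longrightarrow> \<bar>v x\<bar> \<le> C1"
    "AE x in lborel. x \<in> {0..<pi} \<longrightarrow> \<bar>w x\<bar> \<le> C2"
    using assms unfolding Linf_def by blast
  then have "AE x in lborel. x \<in> {0..<pi} \<longrightarrow> \<bar>a * v x + b * w x\<bar> \<le> \<bar>a\<bar> * C1 + \<bar>b\<bar> * C2"
  proof eventually_elim
    case (elim x)
    show ?case
      by (intro impI order_trans[OF abs_triangle_ineq] add_mono) (use elim in \<open>auto simp: abs_mult intro!: mult_left_mono\<close>)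
  qed
  then show ?thesis by blast
qed

text \<open>A disc is the intersection of its tangent half-planes. Continuity in the angle extends
  the condition from the dense set \<open>\<rat>\<close> to all angles, in particular to the angle
  of the point itself.\<close>

lemma disc_if_rational_directions:
  fixes a b :: real
  assumes "\<forall>q\<in>\<rat>. a * cos q + b * sin q \<le> 1"
  shows "a\<^sup>2 + b\<^sup>2 \<le> 1"
proof -
  have "closed {t. a * cos t + b * sin t \<le> 1}"
    by (intro closed_Collect_le continuous_intros)
  then have "closure \<rat> \<subseteq> {t. a * cos t + b * sin t \<le> 1}"
    using assms by (intro closure_minimal) auto
  then have all: "a * cos t + b * sin t \<le> 1" for t
    by (auto simp: Rats_closure_real)
  obtain \<rho> \<theta> where p: "a = \<rho> * cos \<theta>" "b = \<rho> * sin \<theta>"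
    using polar_Ex by blast
  have e: "\<rho> * cos \<theta> * cos \<theta> + \<rho> * sin \<theta> * sin \<theta> = \<rho>"
    using sin_cos_squared_add[of \<theta>] by algebra
  have "\<rho> \<le> 1" using all[of \<theta>] e unfolding p by linarith
  \<comment> \<open>\<open>polar_Ex\<close> fixes no sign for \<open>\<rho>\<close>, so the opposite
    angle supplies the lower bound.\<close>
  moreover have "- \<rho> \<le> 1" using all[of "\<theta> + pi"] e unfolding p by simp
  ultimately have "\<rho>\<^sup>2 \<le> 1" by (simp add: abs_square_le_1 abs_le_iff)
  moreover have "a\<^sup>2 + b\<^sup>2 = \<rho>\<^sup>2"
    unfolding p using sin_cos_squared_add[of \<theta>] by algebra
  ultimately show ?thesis by simp
qed

definition inscribed ::
  "(real \<Rightarrow> real) \<Rightarrow> (real \<Rightarrow> real) \<Rightarrow> real \<Rightarrow> real \<Rightarrow> real \<Rightarrow> real \<Rightarrow> real \<Rightarrow> real \<Rightarrow> bool" where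
  "inscribed v w m11 m12 m21 m22 c1 c2 \<longleftrightarrow> (\<forall>s t. s\<^sup>2 + t\<^sup>2 \<le> 1 \<longrightarrow>
     Linf_norm (\<lambda>x. (c1 + m11 * s + m12 * t) * v x + (c2 + m21 * s + m22 * t) * w x) \<le> 1)"

definition inscribed_dets :: "(real \<Rightarrow> real) \<Rightarrow> (real \<Rightarrow> real) \<Rightarrow> real set" where
  "inscribed_dets v w = {\<bar>m11 * m22 - m12 * m21\<bar> | m11 m12 m21 m22 c1 c2. inscribed v w m11 m12 m21 m22 c1 c2}"

lemma mu_ir_inscribed_dets:
  "mu_ir v w = (if Linf_lin_dep v w then 0 else 1 / Sup (inscribed_dets v w))"
  by (simp add: mu_ir_def inscribed_dets_def inscribed_def)

text \<open>Averaging the points \<open>c + M (s,t)\<close> and \<open>-(c - M (s,t))\<close> shows that the centre of an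
  inscribed ellipse may be dropped; a countable dense set of directions makes the null set uniform.\<close>

lemma inscribed_AE:
  assumes vw: "v \<in> Linf" "w \<in> Linf" and ins: "inscribed v w m11 m12 m21 m22 c1 c2"
  shows "AE x in lborel. x \<in> {0..<pi} \<longrightarrow> (m11 * v x + m21 * w x)\<^sup>2 + (m12 * v x + m22 * w x)\<^sup>2 \<le> 1"
proof -
  have ae: "AE x in lborel. x \<in> {0..<pi} \<longrightarrow>
     \<bar>(c1 + m11 * s + m12 * t) * v x + (c2 + m21 * s + m22 * t) * w x\<bar> \<le> 1"
    if "s\<^sup>2 + t\<^sup>2 \<le> 1" for s t
  proof -
    obtain C where "AE x in lborel. x \<in> {0..<pi} \<longrightarrow>
     \<bar>(c1 + m11 * s + m12 * t) * v x + (c2 + m21 * s + m22 * t) * w x\<bar> \<le> C"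
      using Linf_combination_bounded[OF vw] by blast
    from Linf_norm_AE[OF this] show ?thesis
      by eventually_elim (use ins that in \<open>force simp: inscribed_def\<close>)
  qed
  have "AE x in lborel. x \<in> {0..<pi} \<longrightarrow>
     (m11 * v x + m21 * w x) * cos q + (m12 * v x + m22 * w x) * sin q \<le> 1" for q
  proof -
    have u: "(cos q)\<^sup>2 + (sin q)\<^sup>2 \<le> 1" "(- cos q)\<^sup>2 + (- sin q)\<^sup>2 \<le> 1" by simp_all
    from ae[OF u(1)] ae[OF u(2)] show ?thesis
      by eventually_elim (auto simp: abs_le_iff algebra_simps)
  qed
  then have "AE x in lborel. \<forall>q\<in>\<rat>. x \<in> {0..<pi} \<longrightarrow>
     (m11 * v x + m21 * w x) * cos q + (m12 * v x + m22 * w x) * sin q \<le> 1"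
    by (subst AE_ball_countable) (auto simp: countable_rat)
  then show ?thesis
    by eventually_elim (auto intro!: disc_if_rational_directions)
qed

lemma inscribed_disc:
  assumes "\<And>x. x \<in> {0..<pi} \<Longrightarrow> (c * v x)\<^sup>2 + (c * w x)\<^sup>2 \<le> 1"
  shows "inscribed v w c 0 0 c 0 0"
  unfolding inscribed_def
proof (intro allI impI Linf_norm_le)
  fix s t :: real assume st: "s\<^sup>2 + t\<^sup>2 \<le> 1"
  have "\<bar>(c * s) * v x + (c * t) * w x\<bar> \<le> 1" if "x \<in> {0..<pi}" for x
  proof -
    have "((c * s) * v x + (c * t) * w x)\<^sup>2 + (s * (c * w x) - t * (c * v x))\<^sup>2
        = (s\<^sup>2 + t\<^sup>2) * ((c * v x)\<^sup>2 + (c * w x)\<^sup>2)"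
      by (simp add: power2_eq_square algebra_simps)
    also have "\<dots> \<le> 1 * 1" by (intro mult_mono assms that st) auto
    finally have "((c * s) * v x + (c * t) * w x)\<^sup>2 \<le> 1"
      using zero_le_power2[of "s * (c * w x) - t * (c * v x)"] by linarith
    then show ?thesis by (simp add: abs_square_le_1)
  qed
  then show "AE x in lborel. x \<in> {0..<pi} \<longrightarrow>
    \<bar>(0 + c * s + 0 * t) * v x + (0 + 0 * s + c * t) * w x\<bar> \<le> 1" by simp
qed simp

lemma Linf_lin_dep_bracket:
  assumes "Linf_lin_dep v w"
  shows "AE a in lborel. AE b in lborel. a \<in> {0..<pi} \<longrightarrow> b \<in> {0..<pi} \<longrightarrow> v a * w b - v b * w a = 0"
proof -
  obtain k l where kl: "k \<noteq> 0 \<or> l \<noteq> 0"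
    and ae: "AE x in lborel. x \<in> {0..<pi} \<longrightarrow> k * v x + l * w x = 0"
    using assms unfolding Linf_lin_dep_def by blast
  have z: "v a * w b - v b * w a = 0" if "k * v a + l * w a = 0" "k * v b + l * w b = 0" for a b
  proof -
    have "k * (v a * w b - v b * w a) = 0" "l * (v a * w b - v b * w a) = 0"
      using that by algebra+
    then show ?thesis using kl by auto
  qed
  show ?thesis
    using ae
  proof eventually_elim
    case (elim a)
    from ae show ?case by eventually_elim (use elim z in blast)
  qed
qed

text \<open>One point suffices: if \<open>(v a, w a)\<close> is not zero and its bracket with almost
  every \<open>b\<close> vanishes, then \<open>- w a\<close> and \<open>v a\<close> are the
  coefficients of a linear relation.\<close>

lemma Linf_lin_depI:
  assumes ae: "AE a in lborel. AE b in lborel. a \<in> {0..<pi} \<longrightarrow> b \<in> {0..<pi} \<longrightarrow> v a * w b - v b * w a = 0"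
  shows "Linf_lin_dep v w"
proof (cases "AE x in lborel. x \<in> {0..<pi} \<longrightarrow> v x = 0 \<and> w x = 0")
  case True
  then have "AE x in lborel. x \<in> {0..<pi} \<longrightarrow> 1 * v x + 0 * w x = 0"
    by eventually_elim auto
  then show ?thesis unfolding Linf_lin_dep_def by (metis zero_neq_one)
next
  case False
  have "\<exists>a. a \<in> {0..<pi} \<and> (v a \<noteq> 0 \<or> w a \<noteq> 0) \<and>
     (AE b in lborel. a \<in> {0..<pi} \<longrightarrow> b \<in> {0..<pi} \<longrightarrow> v a * w b - v b * w a = 0)"
  proof (rule ccontr)
    assume n: "\<not> ?thesis"
    from ae have "AE x in lborel. x \<in> {0..<pi} \<longrightarrow> v x = 0 \<and> w x = 0"
      by eventually_elim (use n in blast)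
    then show False using False by blast
  qed
  then obtain a where a: "a \<in> {0..<pi}" "v a \<noteq> 0 \<or> w a \<noteq> 0"
    "AE b in lborel. a \<in> {0..<pi} \<longrightarrow> b \<in> {0..<pi} \<longrightarrow> v a * w b - v b * w a = 0" by blast
  from a(3) have "AE b in lborel. b \<in> {0..<pi} \<longrightarrow> (- w a) * v b + v a * w b = 0"
    by eventually_elim (use a(1) in \<open>auto simp: algebra_simps\<close>)
  then show ?thesis unfolding Linf_lin_dep_def using a(2) by (metis neg_equal_0_iff_equal)
qed

lemma disc_abs_le:
  fixes x y :: real
  assumes "x\<^sup>2 + y\<^sup>2 \<le> 1"
  shows "\<bar>x\<bar> \<le> 1" "\<bar>y\<bar> \<le> 1"
proof -
  have "x\<^sup>2 \<le> 1" "y\<^sup>2 \<le> 1"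
    using assms zero_le_power2[of x] zero_le_power2[of y] by linarith+
  then show "\<bar>x\<bar> \<le> 1" "\<bar>y\<bar> \<le> 1" by (simp_all add: abs_square_le_1)
qed

text \<open>Lagrange's identity: the squares of the bracket and of the inner product add up to the
  product of the squared lengths.\<close>

lemma bracket_le_1:
  fixes p q p' q' :: real
  assumes "p\<^sup>2 + q\<^sup>2 \<le> 1" "p'\<^sup>2 + q'\<^sup>2 \<le> 1"
  shows "\<bar>p * q' - p' * q\<bar> \<le> 1"
proof -
  have "(p * q' - p' * q)\<^sup>2 + (p * p' + q * q')\<^sup>2 = (p\<^sup>2 + q\<^sup>2) * (p'\<^sup>2 + q'\<^sup>2)"
    by (simp add: power2_eq_square algebra_simps)
  also have "\<dots> \<le> 1 * 1" by (intro mult_mono assms) auto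
  finally have "(p * q' - p' * q)\<^sup>2 \<le> 1" using zero_le_power2[of "p * p' + q * q'"] by linarith
  then show ?thesis by (simp add: abs_square_le_1)
qed

text \<open>Independence keeps the bracket from being almost everywhere below some
  \<open>inverse (real (Suc n))\<close>. An inscribed map multiplies the bracket by its determinant
  and lands in the unit disc, where brackets are at most 1, so its determinant is at most
  \<open>real (Suc n)\<close>. This is what gives the \<open>Sup\<close> in \<open>mu_ir\<close> its
  meaning.\<close>

lemma inscribed_dets_bdd:
  assumes vw: "v \<in> Linf" "w \<in> Linf" and ind: "\<not> Linf_lin_dep v w"
  shows "bdd_above (inscribed_dets v w)"
proof -
  have "\<exists>n. \<not> (AE a in lborel. AE b in lborel. a \<in> {0..<pi} \<longrightarrow> b \<in> {0..<pi} \<longrightarrow>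
     \<bar>v a * w b - v b * w a\<bar> \<le> inverse (real (Suc n)))"
  proof (rule ccontr)
    assume "\<not> ?thesis"
    then have "AE a in lborel. \<forall>n. AE b in lborel. a \<in> {0..<pi} \<longrightarrow> b \<in> {0..<pi} \<longrightarrow>
       \<bar>v a * w b - v b * w a\<bar> \<le> inverse (real (Suc n))"
      by (simp only: AE_all_countable) blast
    then have "AE a in lborel. AE b in lborel. a \<in> {0..<pi} \<longrightarrow> b \<in> {0..<pi} \<longrightarrow> v a * w b - v b * w a = 0"
    proof eventually_elim
      case (elim a)
      then have "AE b in lborel. \<forall>n. a \<in> {0..<pi} \<longrightarrow> b \<in> {0..<pi} \<longrightarrow>
         \<bar>v a * w b - v b * w a\<bar> \<le> inverse (real (Suc n))"
        by (subst AE_all_countable)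
      then show ?case
      proof eventually_elim
        case (elim b)
        show ?case
        proof (intro impI, rule ccontr)
          assume ab: "a \<in> {0..<pi}" "b \<in> {0..<pi}" and "v a * w b - v b * w a \<noteq> 0"
          then obtain n where "inverse (real (Suc n)) < \<bar>v a * w b - v b * w a\<bar>"
            using reals_Archimedean[of "\<bar>v a * w b - v b * w a\<bar>"] by auto
          then show False using elim[rule_format, of n] ab by linarith
        qed
      qed
    qed
    then show False using Linf_lin_depI ind by blast
  qed
  then obtain n where n: "\<not> (AE a in lborel. AE b in lborel. a \<in> {0..<pi} \<longrightarrow> b \<in> {0..<pi} \<longrightarrow>
     \<bar>v a * w b - v b * w a\<bar> \<le> inverse (real (Suc n)))" by blast
  show ?thesis
  proof (rule bdd_aboveI[where M="real (Suc n)"])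
    fix x assume "x \<in> inscribed_dets v w"
    then obtain m11 m12 m21 m22 c1 c2 where x: "x = \<bar>m11 * m22 - m12 * m21\<bar>"
      and ins: "inscribed v w m11 m12 m21 m22 c1 c2" unfolding inscribed_dets_def by blast
    note ae = inscribed_AE[OF vw ins]
    show "x \<le> real (Suc n)"
    proof (rule ccontr)
      assume big: "\<not> x \<le> real (Suc n)"
      have key: "\<bar>v a * w b - v b * w a\<bar> \<le> inverse (real (Suc n))"
        if "(m11 * v a + m21 * w a)\<^sup>2 + (m12 * v a + m22 * w a)\<^sup>2 \<le> 1"
          "(m11 * v b + m21 * w b)\<^sup>2 + (m12 * v b + m22 * w b)\<^sup>2 \<le> 1" for a b
      proof -
        have "(m11 * v a + m21 * w a) * (m12 * v b + m22 * w b) - (m11 * v b + m21 * w b) * (m12 * v a + m22 * w a)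
          = (m11 * m22 - m12 * m21) * (v a * w b - v b * w a)" by (simp add: algebra_simps)
        then have "x * \<bar>v a * w b - v b * w a\<bar> \<le> 1"
          using bracket_le_1[OF that] by (simp add: x abs_mult)
        moreover have "real (Suc n) * \<bar>v a * w b - v b * w a\<bar> \<le> x * \<bar>v a * w b - v b * w a\<bar>"
          using big by (intro mult_right_mono) auto
        ultimately have "real (Suc n) * \<bar>v a * w b - v b * w a\<bar> \<le> 1" by linarith
        then show ?thesis by (simp add: field_simps)
      qed
      have "AE a in lborel. AE b in lborel. a \<in> {0..<pi} \<longrightarrow> b \<in> {0..<pi} \<longrightarrow>
         \<bar>v a * w b - v b * w a\<bar> \<le> inverse (real (Suc n))"
        using ae
      proof eventually_elim
        case (elim a)
        from ae show ?case by eventually_elim (use elim key in blast)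
      qed
      then show False using n by blast
    qed
  qed
qed

lemma inscribed_dets_pos:
  assumes vw: "v \<in> Linf" "w \<in> Linf"
  shows "\<exists>x\<in>inscribed_dets v w. 0 < x"
proof -
  obtain C1 C2 where "AE x in lborel. x \<in> {0..<pi} \<longrightarrow> \<bar>v x\<bar> \<le> C1"
    "AE x in lborel. x \<in> {0..<pi} \<longrightarrow> \<bar>w x\<bar> \<le> C2"
    using assms unfolding Linf_def by blast
  then have ae: "AE x in lborel. x \<in> {0..<pi} \<longrightarrow> \<bar>v x\<bar> + \<bar>w x\<bar> \<le> \<bar>C1\<bar> + \<bar>C2\<bar> + 1"
    by eventually_elim auto
  define c where "c = inverse (\<bar>C1\<bar> + \<bar>C2\<bar> + 1)"
  have c: "c > 0" unfolding c_def by (simp add: add_nonneg_pos)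
  have "inscribed v w c 0 0 c 0 0"
    unfolding inscribed_def
  proof (intro allI impI Linf_norm_le)
    fix s t :: real assume st: "s\<^sup>2 + t\<^sup>2 \<le> 1"
    have "s\<^sup>2 \<le> 1" "t\<^sup>2 \<le> 1" using st zero_le_power2[of s] zero_le_power2[of t] by linarith+
    then have st1: "\<bar>s\<bar> \<le> 1" "\<bar>t\<bar> \<le> 1" by (simp_all add: abs_square_le_1)
    from ae show "AE x in lborel. x \<in> {0..<pi} \<longrightarrow>
      \<bar>(0 + c * s + 0 * t) * v x + (0 + 0 * s + c * t) * w x\<bar> \<le> 1"
    proof eventually_elim
      case (elim x)
      show ?case
      proof
        assume x: "x \<in> {0..<pi}"
        have "\<bar>(0 + c * s + 0 * t) * v x + (0 + 0 * s + c * t) * w x\<bar> \<le> \<bar>(c * s) * v x\<bar> + \<bar>(c * t) * w x\<bar>"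
          using abs_triangle_ineq[of "(c * s) * v x" "(c * t) * w x"] by simp
        also have "\<dots> = c * (\<bar>s\<bar> * \<bar>v x\<bar> + \<bar>t\<bar> * \<bar>w x\<bar>)" using c by (simp add: abs_mult algebra_simps)
        also have "\<dots> \<le> c * (1 * \<bar>v x\<bar> + 1 * \<bar>w x\<bar>)"
          using c st1 by (intro mult_left_mono add_mono mult_right_mono) auto
        also have "\<dots> \<le> c * (\<bar>C1\<bar> + \<bar>C2\<bar> + 1)"
          using c elim x by (intro mult_left_mono) auto
        also have "\<dots> = 1" unfolding c_def by (simp add: add_nonneg_eq_0_iff)
        finally show "\<bar>(0 + c * s + 0 * t) * v x + (0 + 0 * s + c * t) * w x\<bar> \<le> 1" .
      qed
    qed
  qed simp
  then have "\<bar>c * c - 0 * 0\<bar> \<in> inscribed_dets v w" unfolding inscribed_dets_def by blast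
  then show ?thesis using c by (intro bexI[of _ "\<bar>c * c - 0 * 0\<bar>"]) auto
qed

section \<open>The alternating form of a kernel and its behaviour under linear maps and null
  sets\<close>

definition kernel_form :: "(real \<Rightarrow> real \<Rightarrow> real) \<Rightarrow> (real \<Rightarrow> real) \<Rightarrow> (real \<Rightarrow> real) \<Rightarrow> real" where
  "kernel_form p v w = (LINT a:{0..pi}|lborel. (LINT b:{a..pi}|lborel. p a b * (v a * w b - v b * w a)))"

lemma omega_t_kernel_form: "omega_t f v w = 1 / pi * kernel_form (p_ab f) v w"
  by (simp add: omega_t_def kernel_form_def)

lemma kernel_form_swap: "kernel_form p w v = - kernel_form p v w"
proof -
  have "p a b * (w a * v b - w b * v a) = - (p a b * (v a * w b - v b * w a))" for a b
    by (simp add: algebra_simps)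
  then have "kernel_form p w v = (LINT a:{0..pi}|lborel. (LINT b:{a..pi}|lborel. - (p a b * (v a * w b - v b * w a))))"
    by (simp add: kernel_form_def)
  also have "\<dots> = - kernel_form p v w"
    unfolding kernel_form_def set_lebesgue_integral_def by simp
  finally show ?thesis .
qed

lemma kernel_form_linear_image:
  "kernel_form p (\<lambda>x. m11 * v x + m21 * w x) (\<lambda>x. m12 * v x + m22 * w x) = (m11 * m22 - m12 * m21) * kernel_form p v w"
proof -
  have *: "p a b * ((m11 * v a + m21 * w a) * (m12 * v b + m22 * w b) - (m11 * v b + m21 * w b) * (m12 * v a + m22 * w a))
     = (m11 * m22 - m12 * m21) * (p a b * (v a * w b - v b * w a))" for a b
    by (simp add: algebra_simps)
  show ?thesis
    unfolding kernel_form_def * by simp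
qed

text \<open>\<open>Linf\<close> constrains functions on \<open>{0..<pi}\<close> while the integrals
  run over closed intervals; the difference is the single point \<open>pi\<close>, which is null for
  the inner integral.\<close>

lemma kernel_form_restrict:
  "kernel_form p v w = kernel_form p (\<lambda>x. indicator {0..<pi} x * v x) (\<lambda>x. indicator {0..<pi} x * w x)"
  unfolding kernel_form_def set_lebesgue_integral_def
proof (intro Bochner_Integration.integral_cong refl)
  fix a
  show "indicat_real {0..pi} a *\<^sub>R (LINT b|lborel. indicat_real {a..pi} b *\<^sub>R (p a b * (v a * w b - v b * w a)))
    = indicat_real {0..pi} a *\<^sub>R (LINT b|lborel. indicat_real {a..pi} b *\<^sub>R
      (p a b * (indicat_real {0..<pi} a * v a * (indicat_real {0..<pi} b * w b) -
                indicat_real {0..<pi} b * v b * (indicat_real {0..<pi} a * w a))))"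
  proof (cases "a \<in> {0..pi}")
    case True
    have "(LINT b|lborel. indicat_real {a..pi} b *\<^sub>R (p a b * (v a * w b - v b * w a)))
      = (LINT b|lborel. indicat_real {a..pi} b *\<^sub>R
      (p a b * (indicat_real {0..<pi} a * v a * (indicat_real {0..<pi} b * w b) -
                indicat_real {0..<pi} b * v b * (indicat_real {0..<pi} a * w a))))"
      by (rule integral_discrete_difference[where X="{pi}"]) (use True in \<open>auto simp: indicator_def\<close>)
    then show ?thesis by simp
  qed simp
qed

text \<open>The exceptional null set for \<open>b\<close> may depend on \<open>a\<close>, so the
  integrands are compared slice by slice.\<close>

lemma iterated_cong_AE:
  assumes m: "(\<lambda>z. \<Phi> (fst z) (snd z)) \<in> borel_measurable borel" "(\<lambda>z. \<Psi> (fst z) (snd z)) \<in> borel_measurable borel"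
    and ae: "AE a in lborel. AE b in lborel. tri_fun \<Phi> (a, b) = tri_fun \<Psi> (a, b)"
  shows "(LINT a:{0..pi}|lborel. (LINT b:{a..pi}|lborel. \<Phi> a b)) =
    (LINT a:{0..pi}|lborel. (LINT b:{a..pi}|lborel. \<Psi> a b))"
proof -
  have t: "tri_fun \<Phi> \<in> borel_measurable (lborel \<Otimes>\<^sub>M lborel)" "tri_fun \<Psi> \<in> borel_measurable (lborel \<Otimes>\<^sub>M lborel)"
    using tri_fun_measurable[OF m(1)] tri_fun_measurable[OF m(2)] by (simp_all add: lborel_prod)
  then have t': "(\<lambda>(a, b). tri_fun \<Phi> (a, b)) \<in> borel_measurable (lborel \<Otimes>\<^sub>M lborel)"
    "(\<lambda>(a, b). tri_fun \<Psi> (a, b)) \<in> borel_measurable (lborel \<Otimes>\<^sub>M lborel)"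
    by (simp_all add: case_prod_beta')
  have i: "(\<lambda>a. LINT b|lborel. tri_fun \<Phi> (a, b)) \<in> borel_measurable lborel"
    "(\<lambda>a. LINT b|lborel. tri_fun \<Psi> (a, b)) \<in> borel_measurable lborel"
    using t' by (auto intro!: lborel.borel_measurable_lebesgue_integral)
  show ?thesis
    unfolding iterated_tri_fun
  proof (rule integral_cong_AE[OF i])
    from ae show "AE a in lborel. (LINT b|lborel. tri_fun \<Phi> (a, b)) = (LINT b|lborel. tri_fun \<Psi> (a, b))"
    proof eventually_elim
      case (elim a)
      show ?case
        by (rule integral_cong_AE[OF _ _ elim]) (use measurable_Pair2[OF t(1)] measurable_Pair2[OF t(2)] in auto)
    qed
  qed
qed

lemma measurable_bracket:
  fixes p :: "real \<Rightarrow> real \<Rightarrow> real" and v w :: "real \<Rightarrow> real"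
  assumes p: "(\<lambda>z. p (fst z) (snd z)) \<in> borel_measurable borel"
    and v: "v \<in> borel_measurable borel" and w: "w \<in> borel_measurable borel"
  shows "(\<lambda>z. p (fst z) (snd z) * (v (fst z) * w (snd z) - v (snd z) * w (fst z))) \<in> borel_measurable (borel :: (real \<times> real) measure)"
proof -
  have fs: "fst \<in> borel_measurable (borel :: (real \<times> real) measure)" "snd \<in> borel_measurable (borel :: (real \<times> real) measure)"
    by (intro borel_measurable_continuous_onI continuous_intros)+
  note m = measurable_compose[OF fs(1) v] measurable_compose[OF fs(2) v]
    measurable_compose[OF fs(1) w] measurable_compose[OF fs(2) w]
  show ?thesis
    by (rule borel_measurable_times[OF p borel_measurable_diff[OF borel_measurable_times[OF m(1,4)] borel_measurable_times[OF m(2,3)]]])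
qed

lemma kernel_form_cong_AE:
  assumes p: "(\<lambda>z. p (fst z) (snd z)) \<in> borel_measurable borel"
    and m: "v \<in> borel_measurable borel" "w \<in> borel_measurable borel"
       "v' \<in> borel_measurable borel" "w' \<in> borel_measurable borel"
    and ae: "AE x in lborel. v x = v' x \<and> w x = w' x"
  shows "kernel_form p v w = kernel_form p v' w'"
  unfolding kernel_form_def
proof (rule iterated_cong_AE)
  from ae show "AE a in lborel. AE b in lborel.
       tri_fun (\<lambda>a b. p a b * (v a * w b - v b * w a)) (a, b) =
       tri_fun (\<lambda>a b. p a b * (v' a * w' b - v' b * w' a)) (a, b)"
  proof eventually_elim
    case (elim a)
    from ae show ?case by eventually_elim (use elim in \<open>simp add: tri_fun_def\<close>)
  qed
qed (use measurable_bracket[OF p m(1,2)] measurable_bracket[OF p m(3,4)] in simp_all)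

lemma kernel_form_lin_dep:
  assumes "Linf_lin_dep v w"
  shows "kernel_form p v w = 0"
proof -
  let ?v = "\<lambda>x. indicat_real {0..<pi} x * v x" and ?w = "\<lambda>x. indicat_real {0..<pi} x * w x"
  have "AE a in lborel. (LINT b|lborel. tri_fun (\<lambda>a b. p a b * (?v a * ?w b - ?v b * ?w a)) (a, b)) = 0"
    using Linf_lin_dep_bracket[OF assms]
  proof eventually_elim
    case (elim a)
    then have "AE b in lborel. tri_fun (\<lambda>a b. p a b * (?v a * ?w b - ?v b * ?w a)) (a, b) = 0"
      by eventually_elim (auto simp: tri_fun_def indicator_def)
    then show ?case by (rule integral_eq_zero_AE)
  qed
  then have "kernel_form p ?v ?w = 0"
    unfolding kernel_form_def iterated_tri_fun by (rule integral_eq_zero_AE)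
  then show ?thesis using kernel_form_restrict[of p v w] by simp
qed

lemma sets_disc:
  fixes V W :: "real \<Rightarrow> real"
  assumes "V \<in> borel_measurable borel" "W \<in> borel_measurable borel"
  shows "{x. (V x)\<^sup>2 + (W x)\<^sup>2 \<le> 1} \<in> sets borel"
  using borel_measurable_le[OF borel_measurable_add[OF borel_measurable_power[OF assms(1)]
      borel_measurable_power[OF assms(2)]] borel_measurable_const[of 1]] by simp

text \<open>A pair spanning a plane with an inscribed ellipse \<open>M\<close> is mapped by \<open>M\<close> to a pair
  with values in the unit disc, so only the latter have to be tested.\<close>

lemma kernel_form_le_mu_ir:
  assumes p: "(\<lambda>z. p (fst z) (snd z)) \<in> borel_measurable borel"
    and M: "\<And>v w. v \<in> borel_measurable borel \<Longrightarrow> w \<in> borel_measurable borel \<Longrightarrow>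
       (\<And>x. (v x)\<^sup>2 + (w x)\<^sup>2 \<le> 1) \<Longrightarrow> \<bar>kernel_form p v w\<bar> \<le> M"
    and vw: "v \<in> Linf" "w \<in> Linf"
  shows "\<bar>kernel_form p v w\<bar> \<le> M * mu_ir v w"
proof (cases "Linf_lin_dep v w")
  case True
  then show ?thesis by (simp add: kernel_form_lin_dep mu_ir_inscribed_dets)
next
  case False
  let ?v = "\<lambda>x. indicat_real {0..<pi} x * v x" and ?w = "\<lambda>x. indicat_real {0..<pi} x * w x"
  have meas: "?v \<in> borel_measurable borel" "?w \<in> borel_measurable borel"
    using vw by (auto simp: Linf_def set_borel_measurable_def)
  have le: "\<bar>kernel_form p v w\<bar> * x \<le> M" if x: "x \<in> inscribed_dets v w" for x
  proof -
    obtain m11 m12 m21 m22 c1 c2 where xd: "x = \<bar>m11 * m22 - m12 * m21\<bar>"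
      and ins: "inscribed v w m11 m12 m21 m22 c1 c2" using x unfolding inscribed_dets_def by blast
    let ?V = "\<lambda>x. m11 * ?v x + m21 * ?w x" and ?W = "\<lambda>x. m12 * ?v x + m22 * ?w x"
    \<comment> \<open>The image pair lies in the disc only almost everywhere, whereas
      \<open>M\<close> asks for it at every point; cutting off outside the Borel set
      \<open>E\<close> changes the pair on a null set.\<close>
    define E where "E = {x. (?V x)\<^sup>2 + (?W x)\<^sup>2 \<le> 1}"
    have VW: "?V \<in> borel_measurable borel" "?W \<in> borel_measurable borel"
      by (rule borel_measurable_add[OF borel_measurable_times[OF borel_measurable_const meas(1)]
        borel_measurable_times[OF borel_measurable_const meas(2)]])+
    have E: "E \<in> sets borel" unfolding E_def by (rule sets_disc[OF VW])
    let ?V' = "\<lambda>x. indicat_real E x * ?V x" and ?W' = "\<lambda>x. indicat_real E x * ?W x"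
    have VW': "?V' \<in> borel_measurable borel" "?W' \<in> borel_measurable borel"
      by (rule borel_measurable_times[OF borel_measurable_indicator[OF E] VW(1)]
        borel_measurable_times[OF borel_measurable_indicator[OF E] VW(2)])+
    have "AE x in lborel. x \<in> E"
      using inscribed_AE[OF vw ins] by eventually_elim (auto simp: E_def indicator_def)
    then have "AE x in lborel. ?V x = ?V' x \<and> ?W x = ?W' x"
      by eventually_elim simp
    from kernel_form_cong_AE[OF p VW VW' this] have "kernel_form p ?V ?W = kernel_form p ?V' ?W'" .
    moreover have "\<bar>kernel_form p ?V' ?W'\<bar> \<le> M"
    proof (rule M[OF VW'])
      fix x show "(?V' x)\<^sup>2 + (?W' x)\<^sup>2 \<le> 1"
        by (cases "x \<in> E") (auto simp: E_def)
    qed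
    moreover have "kernel_form p ?V ?W = (m11 * m22 - m12 * m21) * kernel_form p v w"
      by (simp only: kernel_form_linear_image kernel_form_restrict[of p v w, symmetric])
    ultimately show ?thesis by (simp add: xd abs_mult mult.commute)
  qed
  obtain x0 where x0: "x0 \<in> inscribed_dets v w" "0 < x0" using inscribed_dets_pos[OF vw] by blast
  have "x0 \<le> Sup (inscribed_dets v w)"
    by (rule cSup_upper[OF x0(1) inscribed_dets_bdd[OF vw False]])
  then have S: "0 < Sup (inscribed_dets v w)" using x0(2) by linarith
  have "\<bar>kernel_form p v w\<bar> * Sup (inscribed_dets v w) \<le> M"
  proof (cases "kernel_form p v w = 0")
    case True
    then show ?thesis using le[OF x0(1)] by simp
  next
    case om0: False
    have "Sup (inscribed_dets v w) \<le> M / \<bar>kernel_form p v w\<bar>"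
      by (rule cSup_least) (use x0 le om0 in \<open>auto simp: field_simps\<close>)
    then show ?thesis using om0 by (simp add: field_simps)
  qed
  then show ?thesis using S False by (simp add: mu_ir_inscribed_dets field_simps)
qed

text \<open>The unit disc in the coordinates of the pair is itself inscribed, so the maximal
  determinant is at least 1.\<close>

lemma mu_ir_le_1:
  assumes vw: "v \<in> Linf" "w \<in> Linf" and d: "\<And>x. (v x)\<^sup>2 + (w x)\<^sup>2 \<le> 1"
  shows "mu_ir v w \<le> 1"
proof (cases "Linf_lin_dep v w")
  case False
  have "inscribed v w 1 0 0 1 0 0" by (rule inscribed_disc) (simp add: d)
  then have "\<bar>1 * 1 - 0 * 0\<bar> \<in> inscribed_dets v w" unfolding inscribed_dets_def by blast
  from cSup_upper[OF this inscribed_dets_bdd[OF vw False]]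
  show ?thesis using False by (simp add: mu_ir_inscribed_dets)
qed (simp add: mu_ir_inscribed_dets)

lemma disc_Linf:
  assumes "v \<in> borel_measurable borel" "w \<in> borel_measurable borel" "\<And>x. (v x)\<^sup>2 + (w x)\<^sup>2 \<le> 1"
  shows "v \<in> Linf" "w \<in> Linf"
proof -
  have "\<bar>v x\<bar> \<le> 1" "\<bar>w x\<bar> \<le> 1" for x
    by (rule disc_abs_le[OF assms(3)])+
  then have "AE x in lborel. x \<in> {0..<pi} \<longrightarrow> \<bar>v x\<bar> \<le> 1" "AE x in lborel. x \<in> {0..<pi} \<longrightarrow> \<bar>w x\<bar> \<le> 1"
    by simp_all
  moreover have "set_borel_measurable lborel {0..<pi} v" "set_borel_measurable lborel {0..<pi} w"
    using assms(1,2) unfolding set_borel_measurable_def by simp_all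
  ultimately show "v \<in> Linf" "w \<in> Linf"
    unfolding Linf_def by blast+
qed

text \<open>Above, a one-sided bound is enough because exchanging \<open>v\<close> and
  \<open>w\<close> changes the sign of the form. Below, a single test pair is enough because its
  \<open>mu_ir\<close> is at most 1.\<close>

lemma comass_ir_bounds:
  assumes p: "(\<lambda>z. p_ab f (fst z) (snd z)) \<in> borel_measurable borel"
    and M: "\<And>v w. v \<in> borel_measurable borel \<Longrightarrow> w \<in> borel_measurable borel \<Longrightarrow>
       (\<And>x. (v x)\<^sup>2 + (w x)\<^sup>2 \<le> 1) \<Longrightarrow> kernel_form (p_ab f) v w \<le> pi * M"
    and v0: "v0 \<in> borel_measurable borel" "w0 \<in> borel_measurable borel" "\<And>x. (v0 x)\<^sup>2 + (w0 x)\<^sup>2 \<le> 1"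
    and m: "pi * m \<le> kernel_form (p_ab f) v0 w0"
  shows "m \<le> comass_ir f" "0 \<le> comass_ir f" "comass_ir f \<le> M"
proof -
  define S where "S = {M. 0 \<le> M \<and> (\<forall>v\<in>Linf. \<forall>w\<in>Linf. \<bar>omega_t f v w\<bar> \<le> M * mu_ir v w)}"
  have M': "\<bar>kernel_form (p_ab f) v w\<bar> \<le> pi * M"
    if "v \<in> borel_measurable borel" "w \<in> borel_measurable borel" "\<And>x. (v x)\<^sup>2 + (w x)\<^sup>2 \<le> 1" for v w
    using M[OF that] M[OF that(2,1)] that(3) kernel_form_swap[of "p_ab f" v w] by (simp add: abs_le_iff add.commute)
  have M0: "0 \<le> M" using M'[OF v0] pi_gt_zero
    by (meson abs_ge_zero order_trans zero_le_mult_iff not_less)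
  have "\<bar>omega_t f v w\<bar> \<le> M * mu_ir v w" if vw: "v \<in> Linf" "w \<in> Linf" for v w
  proof -
    have "\<bar>kernel_form (p_ab f) v w\<bar> \<le> pi * M * mu_ir v w"
      by (rule kernel_form_le_mu_ir[OF p _ vw]) (rule M')
    then have "1 / pi * \<bar>kernel_form (p_ab f) v w\<bar> \<le> 1 / pi * (pi * M * mu_ir v w)"
      by (intro mult_left_mono) auto
    then show ?thesis by (simp add: omega_t_kernel_form abs_mult)
  qed
  then have MS: "M \<in> S" unfolding S_def using M0 by blast
  have bdd: "bdd_below S" by (rule bdd_belowI[where m=0]) (auto simp: S_def)
  show "comass_ir f \<le> M" unfolding comass_ir_def S_def[symmetric] by (rule cInf_lower[OF MS bdd])
  show "0 \<le> comass_ir f" unfolding comass_ir_def S_def[symmetric]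
    by (rule cInf_greatest) (use MS in \<open>auto simp: S_def\<close>)
  show "m \<le> comass_ir f" unfolding comass_ir_def S_def[symmetric]
  proof (rule cInf_greatest)
    fix N assume "N \<in> S"
    then have N: "0 \<le> N" "\<bar>omega_t f v0 w0\<bar> \<le> N * mu_ir v0 w0"
      using disc_Linf[OF v0] by (auto simp: S_def)
    have "m \<le> omega_t f v0 w0" using m by (simp add: omega_t_kernel_form field_simps)
    also have "\<dots> \<le> N * mu_ir v0 w0" using N(2) by linarith
    also have "\<dots> \<le> N * 1"
      by (rule mult_left_mono[OF mu_ir_le_1[OF disc_Linf[OF v0] v0(3)] N(1)])
    finally show "m \<le> N" by simp
  qed (use MS in blast)
qed

lemma tri_adm_bracket:
  assumes p: "tri_adm p"
    and m: "v \<in> borel_measurable borel" "w \<in> borel_measurable borel"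
    and d: "\<And>x. (v x)\<^sup>2 + (w x)\<^sup>2 \<le> 1"
  shows "tri_adm (\<lambda>a b. p a b * (v a * w b - v b * w a))"
proof -
  obtain C where C: "\<And>a b. 0 \<le> a \<Longrightarrow> a \<le> b \<Longrightarrow> b \<le> pi \<Longrightarrow> \<bar>p a b\<bar> \<le> C"
    using p unfolding tri_adm_def by blast
  show ?thesis
  proof (rule tri_admI[where C=C])
    fix a b :: real assume ab: "0 \<le> a" "a \<le> b" "b \<le> pi"
    have "0 \<le> C" using C[OF ab] by linarith
    then have "\<bar>p a b\<bar> * \<bar>v a * w b - v b * w a\<bar> \<le> C * 1"
      by (intro mult_mono C ab bracket_le_1 d) auto
    then show "\<bar>p a b * (v a * w b - v b * w a)\<bar> \<le> C" by (simp add: abs_mult)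
  qed (rule measurable_bracket[OF tri_adm_measurable[OF p] m])
qed

lemma kernel_form_tri:
  assumes "tri_adm p" "v \<in> borel_measurable borel" "w \<in> borel_measurable borel"
    and "\<And>x. (v x)\<^sup>2 + (w x)\<^sup>2 \<le> 1"
  shows "kernel_form p v w = tri (\<lambda>a b. p a b * (v a * w b - v b * w a))"
  unfolding kernel_form_def by (rule tri_iterated[symmetric, OF tri_adm_bracket[OF assms]])

section \<open>Reduction from measurable to continuous pairs\<close>

lemma AE_fst_snd:
  assumes "AE x in lborel. P (x::real)"
  shows "AE z in lborel. P (fst z) \<and> P (snd z)"
proof -
  obtain N where N: "{x. \<not> P x} \<subseteq> N" "emeasure lborel N = 0" "N \<in> sets borel"
    using AE_E[OF assms] by auto
  then have ae: "AE x in lborel. x \<notin> N" by (intro AE_not_in) auto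
  have "AE z in lborel \<Otimes>\<^sub>M lborel. fst z \<notin> N \<and> snd z \<notin> N"
  proof (rule lborel_pair.AE_pair_measure)
    have "{z \<in> space (lborel \<Otimes>\<^sub>M lborel). fst z \<notin> N \<and> snd z \<notin> N} = (- N) \<times> (- N)"
      by (auto simp: space_pair_measure)
    then show "{z \<in> space (lborel \<Otimes>\<^sub>M lborel). fst z \<notin> N \<and> snd z \<notin> N} \<in> sets (lborel \<Otimes>\<^sub>M lborel)"
      using N(3) by (auto intro!: pair_measureI borel_comp)
    from ae show "AE x in lborel. AE y in lborel. fst (x, y) \<notin> N \<and> snd (x, y) \<notin> N"
    proof eventually_elim
      case (elim x)
      from ae show ?case by eventually_elim (use elim in simp)
    qed
  qed
  then have "AE z in lborel. fst z \<notin> N \<and> snd z \<notin> N" by (simp only: lborel_prod)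
  then show ?thesis by eventually_elim (use N(1) in blast)
qed

text \<open>The notion \<open>measurable_on\<close> is defined through continuous functions
  converging off a negligible set; it remains to pass from \<open>lebesgue\<close> to
  \<open>lborel\<close>.\<close>

lemma borel_limit_of_continuous:
  fixes u :: "real \<Rightarrow> real"
  assumes "u \<in> borel_measurable borel"
  shows "\<exists>g. (\<forall>n. continuous_on UNIV (g n)) \<and> (AE x in lborel. (\<lambda>n::nat. g n x) \<longlonglongrightarrow> u x)"
proof -
  have "u \<in> borel_measurable lebesgue" using assms by (auto intro: measurable_completion)
  then have "u measurable_on UNIV" by (rule lebesgue_measurable_imp_measurable_on_real) auto
  then obtain N g where N: "negligible N" and c: "\<And>n. continuous_on UNIV (g n)"
    and l: "\<And>x. x \<notin> N \<Longrightarrow> (\<lambda>n::nat. g n x) \<longlonglongrightarrow> u x"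
    unfolding measurable_on_def by auto
  have "AE x in lebesgue. x \<notin> N" using N by (intro AE_not_in) (simp add: negligible_iff_null_sets)
  then have "AE x in lborel. x \<notin> N" by (simp add: AE_completion_iff)
  then have "AE x in lborel. (\<lambda>n. g n x) \<longlonglongrightarrow> u x"
    by eventually_elim (rule l)
  then show ?thesis using c by blast
qed

text \<open>The isoperimetric argument differentiates primitives and so wants continuous pairs.
  Approximations of the two components need not respect the disc and are first pushed into it; the
  bound then passes to the limit by dominated convergence, since kernel and bracket are
  bounded.\<close>

lemma kernel_form_le_of_continuous:
  assumes p: "tri_adm p"
    and cont: "\<And>v w. continuous_on UNIV v \<Longrightarrow> continuous_on UNIV w \<Longrightarrow>
       (\<And>x. (v x)\<^sup>2 + (w x)\<^sup>2 \<le> 1) \<Longrightarrow> kernel_form p v w \<le> M"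
    and m: "v \<in> borel_measurable borel" "w \<in> borel_measurable borel"
    and d: "\<And>x. (v x)\<^sup>2 + (w x)\<^sup>2 \<le> 1"
  shows "kernel_form p v w \<le> M"
proof -
  obtain g h :: "nat \<Rightarrow> real \<Rightarrow> real" where gc: "\<And>n. continuous_on UNIV (g n)" and gl: "AE x in lborel. (\<lambda>n. g n x) \<longlonglongrightarrow> v x"
    and hc: "\<And>n. continuous_on UNIV (h n)" and hl: "AE x in lborel. (\<lambda>n. h n x) \<longlonglongrightarrow> w x"
    using borel_limit_of_continuous[OF m(1)] borel_limit_of_continuous[OF m(2)] by blast
  \<comment> \<open>Division by \<open>r\<close> is the radial retraction onto the disc. It
    preserves continuity because \<open>r\<close> is at least 1, and it does not disturb the limit,
    which already lies in the disc, so that \<open>r\<close> tends to 1.\<close>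
  define r where "r n x = max 1 (sqrt ((g n x)\<^sup>2 + (h n x)\<^sup>2))" for n x
  define V where "V n x = g n x / r n x" for n x
  define W where "W n x = h n x / r n x" for n x
  have r1: "r n x \<ge> 1" for n x by (simp add: r_def)
  have rc: "continuous_on UNIV (r n)" for n
    unfolding r_def by (intro continuous_intros gc hc)
  have Vc: "continuous_on UNIV (V n)" and Wc: "continuous_on UNIV (W n)" for n
  proof -
    have "\<forall>x\<in>UNIV. r n x \<noteq> 0" using r1[of n] by (metis not_one_le_zero)
    then show "continuous_on UNIV (V n)" "continuous_on UNIV (W n)"
      unfolding V_def W_def by (auto intro!: continuous_on_divide gc hc rc)
  qed
  have VW: "(V n x)\<^sup>2 + (W n x)\<^sup>2 \<le> 1" for n x
  proof -
    have "(g n x)\<^sup>2 + (h n x)\<^sup>2 \<le> (r n x)\<^sup>2"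
    proof -
      have "sqrt ((g n x)\<^sup>2 + (h n x)\<^sup>2) \<le> r n x" by (simp add: r_def)
      then have "(sqrt ((g n x)\<^sup>2 + (h n x)\<^sup>2))\<^sup>2 \<le> (r n x)\<^sup>2" by (intro power_mono) auto
      then show ?thesis by simp
    qed
    moreover have "0 < (r n x)\<^sup>2" using r1[of n x] by simp
    ultimately show ?thesis
      by (simp add: V_def W_def power_divide add_divide_distrib[symmetric])
  qed
  have lim: "AE x in lborel. (\<lambda>n. V n x) \<longlonglongrightarrow> v x \<and> (\<lambda>n. W n x) \<longlonglongrightarrow> w x"
    using gl hl
  proof eventually_elim
    case (elim x)
    have "max 1 (sqrt ((v x)\<^sup>2 + (w x)\<^sup>2)) = 1"
      using d[of x] by (simp add: max_def)
    moreover have "(\<lambda>n. r n x) \<longlonglongrightarrow> max 1 (sqrt ((v x)\<^sup>2 + (w x)\<^sup>2))"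
      unfolding r_def by (intro tendsto_intros elim)
    ultimately have "(\<lambda>n. r n x) \<longlonglongrightarrow> 1" by simp
    from tendsto_divide[OF elim(1) this] tendsto_divide[OF elim(2) this] show ?case
      by (simp add: V_def W_def)
  qed
  have mV: "V n \<in> borel_measurable borel" "W n \<in> borel_measurable borel" for n
    using Vc Wc by (auto intro: borel_measurable_continuous_onI)
  obtain C where C: "\<And>a b. 0 \<le> a \<Longrightarrow> a \<le> b \<Longrightarrow> b \<le> pi \<Longrightarrow> \<bar>p a b\<bar> \<le> C"
    using p unfolding tri_adm_def by blast
  have C0: "0 \<le> C" using C[of 0 0] pi_ge_zero by linarith
  let ?F = "\<lambda>n. tri_fun (\<lambda>a b. p a b * (V n a * W n b - V n b * W n a))"
  have "(\<lambda>n. integral\<^sup>L lborel (?F n)) \<longlonglongrightarrow> integral\<^sup>L lborel (tri_fun (\<lambda>a b. p a b * (v a * w b - v b * w a)))"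
  proof (rule integral_dominated_convergence[OF _ _ tri_square_integrable[of C]])
    show "tri_fun (\<lambda>a b. p a b * (v a * w b - v b * w a)) \<in> borel_measurable lborel"
      using tri_fun_measurable[OF measurable_bracket[OF tri_adm_measurable[OF p] m]] by simp
    show "?F n \<in> borel_measurable lborel" for n
      using tri_fun_measurable[OF measurable_bracket[OF tri_adm_measurable[OF p] mV]] by simp
    show "AE z in lborel. (\<lambda>n. ?F n z) \<longlonglongrightarrow> tri_fun (\<lambda>a b. p a b * (v a * w b - v b * w a)) z"
      using AE_fst_snd[OF lim]
    proof eventually_elim
      case (elim z)
      then show ?case unfolding tri_fun_def by (auto intro!: tendsto_intros)
    qed
    show "AE z in lborel. norm (?F n z) \<le> indicat_real ({0..pi} \<times> {0..pi}) z * C" for n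
    proof (rule AE_I2)
      fix z :: "real \<times> real"
      show "norm (?F n z) \<le> indicat_real ({0..pi} \<times> {0..pi}) z * C"
      proof (cases "0 \<le> fst z \<and> fst z \<le> snd z \<and> snd z \<le> pi")
        case True
        have "\<bar>p (fst z) (snd z)\<bar> * \<bar>V n (fst z) * W n (snd z) - V n (snd z) * W n (fst z)\<bar> \<le> C * 1"
          using True C0 by (intro mult_mono C bracket_le_1 VW) auto
        then show ?thesis using True by (auto simp: tri_fun_def abs_mult indicator_def mem_Times_iff)
      next
        case False
        then have "?F n z = 0" unfolding tri_fun_def by (rule if_not_P)
        then show ?thesis using C0 by simp
      qed
    qed
  qed
  then have "(\<lambda>n. kernel_form p (V n) (W n)) \<longlonglongrightarrow> kernel_form p v w"
    by (simp add: kernel_form_tri[OF p mV VW] kernel_form_tri[OF p m d] tri_def)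
  then show ?thesis
    by (rule LIMSEQ_le_const2) (use cont[OF Vc Wc VW] in blast)
qed

section \<open>The hemisphere\<close>

text \<open>A point \<open>p\<close> of the open hemisphere at height \<open>D\<close> has distance function \<open>f\<close> with
  \<open>cos f = A cos (a - \<tau>)\<close>; \<open>\<phi>\<close> is the direction at \<open>p\<close> of the boundary point \<open>a\<close>, normalized to be
  smooth across the poles of the tangent.\<close>

locale hemi =
  fixes A D \<tau> :: real
  assumes AD: "A\<^sup>2 + D\<^sup>2 = 1" and D0: "0 < D"
begin

text \<open>\<open>x0\<close> and \<open>x1\<close> are the components of the horizontal part of
  \<open>p\<close> along the unit vector at angle \<open>a\<close> and along its quarter turn;
  \<open>x1\<close> is the derivative of \<open>x0\<close>. With \<open>x0\<close> the cosine of the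
  distance, \<open>m\<close> is the square of its sine.\<close>

definition x0 :: "real \<Rightarrow> real" where "x0 a = A * cos (a - \<tau>)"
definition x1 :: "real \<Rightarrow> real" where "x1 a = - A * sin (a - \<tau>)"
definition m :: "real \<Rightarrow> real" where "m a = 1 - (x0 a)\<^sup>2"
definition k :: "real \<Rightarrow> real" where "k a = D / m a"
text \<open>With t = a - \<tau> the direction satisfies tan \<phi> = tan t / D. The subtraction
  formula for the tangent yields \<phi> - t as the arctangent of (1 - D) sin t cos t / q, and this
  denominator never vanishes.\<close>

definition q :: "real \<Rightarrow> real" where "q a = D * (cos (a - \<tau>))\<^sup>2 + (sin (a - \<tau>))\<^sup>2"
definition \<phi> :: "real \<Rightarrow> real" where
  "\<phi> a = (a - \<tau>) + arctan ((1 - D) * sin (a - \<tau>) * cos (a - \<tau>) / q a)"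

lemma D1: "D \<le> 1"
proof -
  have "D\<^sup>2 \<le> 1" using AD zero_le_power2[of A] by linarith
  then show ?thesis using D0 by (simp add: power2_le_iff_abs_le abs_square_le_1)
qed

lemma m_eq: "m a = (sin (a - \<tau>))\<^sup>2 + D\<^sup>2 * (cos (a - \<tau>))\<^sup>2"
proof -
  have "(sin (a - \<tau>))\<^sup>2 + (cos (a - \<tau>))\<^sup>2 = 1" by simp
  then show ?thesis unfolding m_def x0_def using AD by algebra
qed

lemma m_ge: "D\<^sup>2 \<le> m a"
proof -
  have "D\<^sup>2 * ((sin (a - \<tau>))\<^sup>2 + (cos (a - \<tau>))\<^sup>2) \<le> 1 * (sin (a - \<tau>))\<^sup>2 + D\<^sup>2 * (cos (a - \<tau>))\<^sup>2"
    unfolding distrib_left using D0 D1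
    by (intro add_mono mult_right_mono) (auto simp: power_le_one)
  then show ?thesis by (simp add: m_eq)
qed

lemma m_le_1: "m a \<le> 1" by (simp add: m_def)

lemma m_pos: "0 < m a"
  using m_ge[of a] D0 by (meson less_le_trans zero_less_power)

lemma k_ge: "D \<le> k a"
  unfolding k_def using m_pos[of a] m_le_1[of a] D0 by (simp add: pos_le_divide_eq mult_left_le)

lemma k_pos: "0 < k a" using k_ge[of a] D0 by linarith

lemma q_pos: "0 < q a"
proof -
  have "D * ((cos (a - \<tau>))\<^sup>2 + (sin (a - \<tau>))\<^sup>2) \<le> D * (cos (a - \<tau>))\<^sup>2 + 1 * (sin (a - \<tau>))\<^sup>2"
    unfolding distrib_left using D0 D1 by (intro add_mono mult_right_mono) auto
  then show ?thesis using D0 by (simp add: q_def)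
qed

lemma m_q: "m a = (q a)\<^sup>2 + ((1 - D) * sin (a - \<tau>) * cos (a - \<tau>))\<^sup>2"
proof -
  have "(sin (a - \<tau>))\<^sup>2 = 1 - (cos (a - \<tau>))\<^sup>2" by (simp add: sin_squared_eq)
  then show ?thesis unfolding m_eq q_def by algebra
qed

text \<open>\<open>\<phi> a\<close> is the polar angle of the plane vector with coordinates D cos (a
  - \<tau>) and sin (a - \<tau>), whose squared length is \<open>m a\<close>.\<close>

lemma cos_sin_\<phi>:
  "cos (\<phi> a) = D * cos (a - \<tau>) / sqrt (m a)" "sin (\<phi> a) = sin (a - \<tau>) / sqrt (m a)"
proof -
  let ?s = "sin (a - \<tau>)" and ?c = "cos (a - \<tau>)"
  let ?y = "(1 - D) * ?s * ?c"
  have sc: "?s\<^sup>2 + ?c\<^sup>2 = 1" by simp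
  have "1 + (?y / q a)\<^sup>2 = m a / (q a)\<^sup>2"
    using q_pos[of a] by (simp add: m_q field_simps)
  then have r: "sqrt (1 + (?y / q a)\<^sup>2) = sqrt (m a) / q a"
    using q_pos[of a] by (simp add: real_sqrt_divide)
  have c: "cos (arctan (?y / q a)) = q a / sqrt (m a)"
    unfolding cos_arctan r by simp
  have s: "sin (arctan (?y / q a)) = ?y / sqrt (m a)"
    unfolding sin_arctan r using q_pos[of a] by simp
  have "cos (\<phi> a) = (?c * q a - ?s * ?y) / sqrt (m a)"
    unfolding \<phi>_def cos_add c s by (simp add: diff_divide_distrib)
  moreover have "?c * q a - ?s * ?y = D * ?c"
    unfolding q_def using sc by algebra
  ultimately show "cos (\<phi> a) = D * ?c / sqrt (m a)" by simp
  have "sin (\<phi> a) = (?s * q a + ?c * ?y) / sqrt (m a)"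
    unfolding \<phi>_def sin_add c s by (simp add: add_divide_distrib)
  moreover have "?s * q a + ?c * ?y = ?s"
    unfolding q_def using sc by algebra
  ultimately show "sin (\<phi> a) = ?s / sqrt (m a)" by simp
qed

text \<open>This makes the bracket of the extremal pair as small as \<open>sin (b - a)\<close>, both
  at the diagonal and at the corner where \<open>a\<close> is 0 and \<open>b\<close> is
  \<open>pi\<close>.\<close>

lemma sin_\<phi>_diff: "sin (\<phi> b - \<phi> a) = D * sin (b - a) / (sqrt (m a) * sqrt (m b))"
proof -
  have "sin (b - a) = sin ((b - \<tau>) - (a - \<tau>))" by simp
  also have "\<dots> = sin (b - \<tau>) * cos (a - \<tau>) - cos (b - \<tau>) * sin (a - \<tau>)"
    by (rule sin_diff)
  finally have e: "sin (b - a) = sin (b - \<tau>) * cos (a - \<tau>) - cos (b - \<tau>) * sin (a - \<tau>)" .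
  show ?thesis
    unfolding sin_diff[of "\<phi> b"] cos_sin_\<phi> e by (simp add: algebra_simps diff_divide_distrib)
qed

lemma \<phi>_deriv: "(\<phi> has_real_derivative k a) (at a)"
proof -
  let ?s = "sin (a - \<tau>)" and ?c = "cos (a - \<tau>)"
  let ?y = "(1 - D) * ?s * ?c"
  have sc: "?s\<^sup>2 + ?c\<^sup>2 = 1" by simp
  let ?q' = "D * (2 * ?c * (- ?s)) + 2 * ?s * ?c"
  let ?y' = "(1 - D) * (?c * ?c - ?s * ?s)"
  have "((\<lambda>a. (1 - D) * sin (a - \<tau>) * cos (a - \<tau>)) has_real_derivative ?y') (at a)"
    by (auto intro!: derivative_eq_intros simp: algebra_simps)
  moreover have "(q has_real_derivative ?q') (at a)"
    unfolding q_def by (auto intro!: derivative_eq_intros simp: algebra_simps)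
  ultimately have "((\<lambda>a. (1 - D) * sin (a - \<tau>) * cos (a - \<tau>) / q a) has_real_derivative
     (?y' * q a - ?y * ?q') / (q a * q a)) (at a)"
    using q_pos[of a] by (intro DERIV_divide) auto
  from DERIV_add[OF DERIV_diff[OF DERIV_ident DERIV_const] DERIV_chain2[OF DERIV_arctan this]]
  have "(\<phi> has_real_derivative 1 - 0 + inverse (1 + (?y / q a)\<^sup>2) * ((?y' * q a - ?y * ?q') / (q a * q a))) (at a)"
    unfolding \<phi>_def by simp
  moreover have "1 - 0 + inverse (1 + (?y / q a)\<^sup>2) * ((?y' * q a - ?y * ?q') / (q a * q a)) = k a"
  proof -
    have e: "1 + (?y / q a)\<^sup>2 = m a / (q a)\<^sup>2"
      using q_pos[of a] by (simp add: m_q field_simps)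
    have "m a + (?y' * q a - ?y * ?q') = D"
      unfolding m_eq q_def using sc by algebra
    then have n: "?y' * q a - ?y * ?q' = D - m a" by linarith
    show ?thesis unfolding e n k_def
      using q_pos[of a] m_pos[of a] by (simp add: field_simps power2_eq_square)
  qed
  ultimately show ?thesis by simp
qed

lemma \<phi>_pi: "\<phi> pi = \<phi> 0 + pi"
  by (simp add: \<phi>_def q_def cos_diff sin_diff algebra_simps)

lemma continuous_\<phi>: "continuous_on S \<phi>"
  using \<phi>_deriv DERIV_isCont continuous_at_imp_continuous_on by blast

lemma continuous_m: "continuous_on S m"
  unfolding m_def x0_def by (intro continuous_intros)

lemma continuous_k: "continuous_on S k"
  unfolding k_def using m_pos by (intro continuous_intros continuous_m) (metis less_irrefl)

lemma \<phi>_mono: "a \<le> b \<Longrightarrow> \<phi> a \<le> \<phi> b"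
  by (rule DERIV_nonneg_imp_nondecreasing[where f=\<phi>]) (use \<phi>_deriv k_pos in \<open>auto intro: less_imp_le\<close>)

lemma k_total: "(k has_integral pi) {0..pi}"
proof -
  have "(k has_integral (\<phi> pi - \<phi> 0)) {0..pi}"
    by (intro fundamental_theorem_of_calculus)
      (auto intro!: has_field_derivative_at_within \<phi>_deriv simp: has_real_derivative_iff_has_vector_derivative[symmetric])
  then show ?thesis by (simp add: \<phi>_pi)
qed

end

section \<open>Wirtinger's inequality and the isoperimetric deficit\<close>

lemma set_lint_continuous:
  fixes f :: "real \<Rightarrow> real"
  assumes "continuous_on {a..b} f"
  shows "(LINT x:{a..b}|lborel. f x) = integral {a..b} f"
  by (rule set_borel_integral_eq_integral(2)[OF borel_integrable_atLeastAtMost'[OF assms]])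

context hemi
begin

text \<open>The function \<theta> = l tan (l (\<phi> - c)) solves the Riccati equation \<theta>' = k
  (l^2 + \<theta>^2). Hence k (v + \<theta> V)^2 equals k v^2 - l^2 k V^2 plus the derivative of
  \<theta> V^2, and integrating this nonnegative square gives the inequality with its boundary
  terms.\<close>

lemma wirtinger_piece:
  assumes V: "\<And>x. x \<in> {p..r} \<Longrightarrow> (V has_real_derivative k x * v x) (at x within {p..r})"
    and v: "continuous_on {p..r} v" and pr: "p \<le> r"
    and l: "\<And>x. x \<in> {p..r} \<Longrightarrow> \<bar>l * (\<phi> x - c)\<bar> < pi / 2"
  shows "l\<^sup>2 * integral {p..r} (\<lambda>x. k x * (V x)\<^sup>2) \<le> integral {p..r} (\<lambda>x. k x * (v x)\<^sup>2)
     + l * tan (l * (\<phi> r - c)) * (V r)\<^sup>2 - l * tan (l * (\<phi> p - c)) * (V p)\<^sup>2"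
proof -
  define \<theta> where "\<theta> x = l * tan (l * (\<phi> x - c))" for x
  have Vc: "continuous_on {p..r} V"
    by (rule DERIV_continuous_on[OF V])
  have cosn: "cos (l * (\<phi> x - c)) \<noteq> 0" if "x \<in> {p..r}" for x
  proof -
    have "- (pi / 2) < l * (\<phi> x - c)" "l * (\<phi> x - c) < pi / 2"
      using l[OF that] by linarith+
    from cos_gt_zero_pi[OF this] show ?thesis by simp
  qed
  have \<theta>': "(\<theta> has_real_derivative l\<^sup>2 * k x + k x * (\<theta> x)\<^sup>2) (at x within {p..r})" if "x \<in> {p..r}" for x
  proof -
    have "((\<lambda>x. l * (\<phi> x - c)) has_real_derivative l * k x) (at x)"
      by (auto intro!: derivative_eq_intros \<phi>_deriv)
    from DERIV_chain2[OF DERIV_tan[OF cosn[OF that]] this]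
    have "((\<lambda>x. tan (l * (\<phi> x - c))) has_real_derivative inverse ((cos (l * (\<phi> x - c)))\<^sup>2) * (l * k x)) (at x)" .
    from DERIV_cmult[OF this, of l]
    have "(\<theta> has_real_derivative l * (inverse ((cos (l * (\<phi> x - c)))\<^sup>2) * (l * k x))) (at x)"
      unfolding \<theta>_def .
    moreover have "l * (inverse ((cos (l * (\<phi> x - c)))\<^sup>2) * (l * k x)) = l\<^sup>2 * k x + k x * (\<theta> x)\<^sup>2"
      using tan_sec[OF cosn[OF that]] unfolding \<theta>_def power_inverse by algebra
    ultimately show ?thesis by (simp add: has_field_derivative_at_within)
  qed
  let ?g = "\<lambda>x. (l\<^sup>2 * k x + k x * (\<theta> x)\<^sup>2) * (V x)\<^sup>2 + 2 * V x * (k x * v x) * \<theta> x"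
  have "(?g has_integral (\<theta> r * (V r)\<^sup>2 - \<theta> p * (V p)\<^sup>2)) {p..r}"
  proof (rule fundamental_theorem_of_calculus[OF pr])
    fix x assume x: "x \<in> {p..r}"
    show "((\<lambda>x. \<theta> x * (V x)\<^sup>2) has_vector_derivative ?g x) (at x within {p..r})"
      unfolding has_real_derivative_iff_has_vector_derivative[symmetric]
      by (rule derivative_eq_intros \<theta>'[OF x] V[OF x] refl | simp add: algebra_simps)+
  qed
  moreover have "((\<lambda>x. k x * (v x)\<^sup>2) has_integral integral {p..r} (\<lambda>x. k x * (v x)\<^sup>2)) {p..r}"
    "((\<lambda>x. k x * (V x)\<^sup>2) has_integral integral {p..r} (\<lambda>x. k x * (V x)\<^sup>2)) {p..r}"
    by (intro integrable_integral integrable_continuous_interval continuous_intros continuous_k v Vc)+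
  ultimately have "((\<lambda>x. k x * (v x)\<^sup>2 + ?g x - l\<^sup>2 * (k x * (V x)\<^sup>2)) has_integral
     (integral {p..r} (\<lambda>x. k x * (v x)\<^sup>2) + (\<theta> r * (V r)\<^sup>2 - \<theta> p * (V p)\<^sup>2)
       - l\<^sup>2 * integral {p..r} (\<lambda>x. k x * (V x)\<^sup>2))) {p..r}"
    by (intro has_integral_diff has_integral_add has_integral_mult_right)
  then have "0 \<le> integral {p..r} (\<lambda>x. k x * (v x)\<^sup>2) + (\<theta> r * (V r)\<^sup>2 - \<theta> p * (V p)\<^sup>2)
       - l\<^sup>2 * integral {p..r} (\<lambda>x. k x * (V x)\<^sup>2)"
  proof (rule has_integral_nonneg)
    fix x assume "x \<in> {p..r}"
    have "k x * (v x)\<^sup>2 + ?g x - l\<^sup>2 * (k x * (V x)\<^sup>2) = k x * (v x + \<theta> x * V x)\<^sup>2"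
      by (simp add: power2_eq_square algebra_simps)
    then show "0 \<le> k x * (v x)\<^sup>2 + ?g x - l\<^sup>2 * (k x * (V x)\<^sup>2)" using k_pos[of x] by simp
  qed
  then show ?thesis unfolding \<theta>_def by linarith
qed

text \<open>Antiperiodicity forces a zero \<open>a\<close>. On the two sides of it the tangents are
  centred a quarter turn after and before \<open>\<phi> a\<close>, as if the left piece were moved
  behind the right one to form an arc of angle pi between two zeros. The boundary terms at
  \<open>a\<close> vanish, and those at \<open>0\<close> and \<open>pi\<close> cancel.\<close>

lemma wirtinger:
  assumes V: "\<And>x. x \<in> {0..pi} \<Longrightarrow> (V has_real_derivative k x * v x) (at x within {0..pi})"
    and v: "continuous_on {0..pi} v" and anti: "V pi = - V 0"
  shows "integral {0..pi} (\<lambda>x. k x * (V x)\<^sup>2) \<le> integral {0..pi} (\<lambda>x. k x * (v x)\<^sup>2)"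
proof (rule field_le_mult_one_interval)
  \<comment> \<open>With l^2 = z < 1 the tangents stay finite at the zero of \<open>V\<close>; the
    constant 1 results from letting z tend to 1.\<close>
  fix z :: real assume z: "0 < z" "z < 1"
  define l where "l = sqrt z"
  have l: "0 < l" "l < 1" "l\<^sup>2 = z" using z by (auto simp: l_def)
  have Vc: "continuous_on {0..pi} V"
    by (rule DERIV_continuous_on[OF V])
  obtain a where a: "0 \<le> a" "a \<le> pi" "V a = 0"
  proof (cases "V 0 \<le> 0")
    case True
    then show ?thesis using IVT'[of V 0 0 pi] anti Vc that by auto
  next
    case False
    then show ?thesis using IVT2'[of V pi 0 0] anti Vc that by auto
  qed
  have small: "\<bar>l * t\<bar> < pi / 2" if "\<bar>t\<bar> \<le> pi / 2" for t
  proof -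
    have "\<bar>l * t\<bar> = l * \<bar>t\<bar>" using l by (simp add: abs_mult)
    also have "\<dots> \<le> l * (pi / 2)" using l that by (intro mult_left_mono) auto
    also have "\<dots> < 1 * (pi / 2)" using l by (intro mult_strict_right_mono) auto
    finally show ?thesis by simp
  qed
  have r: "l\<^sup>2 * integral {a..pi} (\<lambda>x. k x * (V x)\<^sup>2) \<le> integral {a..pi} (\<lambda>x. k x * (v x)\<^sup>2)
     + l * tan (l * (\<phi> pi - (\<phi> a + pi / 2))) * (V pi)\<^sup>2 - l * tan (l * (\<phi> a - (\<phi> a + pi / 2))) * (V a)\<^sup>2"
  proof (rule wirtinger_piece)
    show "(V has_real_derivative k x * v x) (at x within {a..pi})" if "x \<in> {a..pi}" for x
      using has_field_derivative_subset[OF V, of x "{a..pi}"] that a by auto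
    show "continuous_on {a..pi} v" using v by (rule continuous_on_subset) (use a in auto)
    show "\<bar>l * (\<phi> x - (\<phi> a + pi / 2))\<bar> < pi / 2" if "x \<in> {a..pi}" for x
    proof (rule small)
      have "\<phi> a \<le> \<phi> x" "\<phi> x \<le> \<phi> pi" "\<phi> 0 \<le> \<phi> a" using that a by (auto intro!: \<phi>_mono)
      then show "\<bar>\<phi> x - (\<phi> a + pi / 2)\<bar> \<le> pi / 2" using \<phi>_pi by linarith
    qed
  qed (use a in auto)
  have s: "l\<^sup>2 * integral {0..a} (\<lambda>x. k x * (V x)\<^sup>2) \<le> integral {0..a} (\<lambda>x. k x * (v x)\<^sup>2)
     + l * tan (l * (\<phi> a - (\<phi> a - pi / 2))) * (V a)\<^sup>2 - l * tan (l * (\<phi> 0 - (\<phi> a - pi / 2))) * (V 0)\<^sup>2"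
  proof (rule wirtinger_piece)
    show "(V has_real_derivative k x * v x) (at x within {0..a})" if "x \<in> {0..a}" for x
      using has_field_derivative_subset[OF V, of x "{0..a}"] that a by auto
    show "continuous_on {0..a} v" using v by (rule continuous_on_subset) (use a in auto)
    show "\<bar>l * (\<phi> x - (\<phi> a - pi / 2))\<bar> < pi / 2" if "x \<in> {0..a}" for x
    proof (rule small)
      have "\<phi> x \<le> \<phi> a" "\<phi> 0 \<le> \<phi> x" "\<phi> a \<le> \<phi> pi" using that a by (auto intro!: \<phi>_mono)
      then show "\<bar>\<phi> x - (\<phi> a - pi / 2)\<bar> \<le> pi / 2" using \<phi>_pi by linarith
    qed
  qed (use a in auto)
  have e: "\<phi> pi - (\<phi> a + pi / 2) = \<phi> 0 - (\<phi> a - pi / 2)" using \<phi>_pi by (simp add: field_simps)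
  have c: "integral {0..a} f + integral {a..pi} f = integral {0..pi} f" if "continuous_on {0..pi} f" for f :: "real \<Rightarrow> real"
    by (intro Henstock_Kurzweil_Integration.integral_combine a integrable_continuous_interval that)
  have "l\<^sup>2 * (integral {0..a} (\<lambda>x. k x * (V x)\<^sup>2) + integral {a..pi} (\<lambda>x. k x * (V x)\<^sup>2)) \<le>
     integral {0..a} (\<lambda>x. k x * (v x)\<^sup>2) + integral {a..pi} (\<lambda>x. k x * (v x)\<^sup>2)"
    using r s unfolding e by (simp add: a(3) anti distrib_left)
  then show "z * integral {0..pi} (\<lambda>x. k x * (V x)\<^sup>2) \<le> integral {0..pi} (\<lambda>x. k x * (v x)\<^sup>2)"
    unfolding l(3)[symmetric]
    by (subst (asm) (1 2) c) (auto intro!: continuous_intros continuous_k v Vc)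
qed

text \<open>The constant of integration makes the primitive antiperiodic: the curve traced over
  \<open>{0..pi}\<close> and its reflection in the origin close up, and Wirtinger's inequality
  applies.\<close>

definition prim :: "(real \<Rightarrow> real) \<Rightarrow> real \<Rightarrow> real" where
  "prim v t = integral {0..t} (\<lambda>x. k x * v x) - integral {0..pi} (\<lambda>x. k x * v x) / 2"

lemma prim_deriv:
  assumes "continuous_on {0..pi} v" "x \<in> {0..pi}"
  shows "(prim v has_real_derivative k x * v x) (at x within {0..pi})"
proof -
  have "((\<lambda>t. integral {0..t} (\<lambda>x. k x * v x)) has_real_derivative k x * v x) (at x within {0..pi})"
    by (intro integral_has_real_derivative continuous_intros continuous_k assms)
  from DERIV_diff[OF this DERIV_const] show ?thesis unfolding prim_def by simp
qed

lemma prim_anti: "prim v pi = - prim v 0"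
  by (simp add: prim_def)

lemma prim_total: "integral {0..pi} (\<lambda>x. k x * v x) = 2 * prim v pi"
  by (simp add: prim_def)

lemma continuous_prim: "continuous_on {0..pi} v \<Longrightarrow> continuous_on {0..pi} (prim v)"
  by (rule DERIV_continuous_on[OF prim_deriv])

lemma prim_bound:
  assumes v: "continuous_on {0..pi} v" and b: "\<And>x. \<bar>v x\<bar> \<le> 1"
  shows "\<bar>prim v 0\<bar> \<le> pi / 2"
proof -
  have "norm (integral {0..pi} (\<lambda>x. k x * v x)) \<le> integral {0..pi} k"
  proof (rule integral_norm_bound_integral)
    show "norm (k x * v x) \<le> k x" for x
      using b[of x] k_pos[of x] by (simp add: abs_mult mult_left_le)
  qed (intro integrable_continuous_interval continuous_intros continuous_k v)+
  then show ?thesis using integral_unique[OF k_total] by (simp add: prim_def)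
qed

lemma prim_increment:
  assumes v: "continuous_on {0..pi} v" and a: "a \<in> {0..pi}"
  shows "integral {a..pi} (\<lambda>x. k x * v x) = prim v pi - prim v a"
proof -
  have "integral {0..a} (\<lambda>x. k x * v x) + integral {a..pi} (\<lambda>x. k x * v x) = integral {0..pi} (\<lambda>x. k x * v x)"
    using a by (intro Henstock_Kurzweil_Integration.integral_combine integrable_continuous_interval continuous_intros continuous_k v) auto
  then show ?thesis by (simp add: prim_def)
qed

text \<open>The right-hand side is the integral of V dW - W dV along half of a centrally symmetric
  closed curve, which is the area enclosed by it.\<close>

lemma tri_kk:
  assumes v: "continuous_on UNIV v" and w: "continuous_on UNIV w"
  shows "tri (\<lambda>a b. k a * k b * (v a * w b - v b * w a)) =
    integral {0..pi} (\<lambda>a. k a * (w a * prim v a - v a * prim w a))"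
proof -
  have v': "continuous_on S v" and w': "continuous_on S w" for S
    using v w continuous_on_subset by blast+
  have "continuous_on UNIV (\<lambda>z. k (fst z) * k (snd z) * (v (fst z) * w (snd z) - v (snd z) * w (fst z)))"
    by (intro continuous_intros continuous_on_compose2[OF v] continuous_on_compose2[OF w]
      continuous_on_compose2[OF continuous_k[of UNIV]]) auto
  from tri_iterated[OF tri_adm_continuous[OF this]]
  have "tri (\<lambda>a b. k a * k b * (v a * w b - v b * w a)) =
     (LINT a:{0..pi}|lborel. LINT b:{a..pi}|lborel. k a * k b * (v a * w b - v b * w a))" .
  also have "\<dots> = (LINT a:{0..pi}|lborel. k a * (v a * (prim w pi - prim w a) - w a * (prim v pi - prim v a)))"
  proof (rule set_lebesgue_integral_cong, simp, intro allI impI)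
    fix a assume a: "a \<in> {0..pi}"
    have "(LINT b:{a..pi}|lborel. k a * k b * (v a * w b - v b * w a)) =
      integral {a..pi} (\<lambda>b. k a * k b * (v a * w b - v b * w a))"
      by (intro set_lint_continuous continuous_intros continuous_k v' w')
    also have "\<dots> = integral {a..pi} (\<lambda>b. k a * v a * (k b * w b) - k a * w a * (k b * v b))"
      by (rule arg_cong[where f="integral _"]) (auto simp: algebra_simps)
    also have "\<dots> = k a * v a * integral {a..pi} (\<lambda>b. k b * w b) - k a * w a * integral {a..pi} (\<lambda>b. k b * v b)"
      by (subst Henstock_Kurzweil_Integration.integral_diff)
        (auto intro!: integrable_continuous_interval continuous_intros continuous_k v' w')
    also have "\<dots> = k a * (v a * (prim w pi - prim w a) - w a * (prim v pi - prim v a))"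
      unfolding prim_increment[OF v' a] prim_increment[OF w' a] by (simp add: algebra_simps)
    finally show "(LINT b:{a..pi}|lborel. k a * k b * (v a * w b - v b * w a)) =
      k a * (v a * (prim w pi - prim w a) - w a * (prim v pi - prim v a))" .
  qed
  also have "\<dots> = integral {0..pi} (\<lambda>a. k a * (v a * (prim w pi - prim w a) - w a * (prim v pi - prim v a)))"
    by (intro set_lint_continuous continuous_intros continuous_k v' w' continuous_prim)
  also have "\<dots> = integral {0..pi} (\<lambda>a. (k a * (w a * prim v a - v a * prim w a))
       + (prim w pi * (k a * v a) - prim v pi * (k a * w a)))"
    by (rule arg_cong[where f="integral _"]) (auto simp: algebra_simps)
  also have "\<dots> = integral {0..pi} (\<lambda>a. k a * (w a * prim v a - v a * prim w a))
     + (prim w pi * integral {0..pi} (\<lambda>a. k a * v a) - prim v pi * integral {0..pi} (\<lambda>a. k a * w a))"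
  proof -
    have i: "(\<lambda>a. k a * (w a * prim v a - v a * prim w a)) integrable_on {0..pi}"
      "(\<lambda>a. prim w pi * (k a * v a)) integrable_on {0..pi}" "(\<lambda>a. prim v pi * (k a * w a)) integrable_on {0..pi}"
      by (intro integrable_continuous_interval continuous_intros continuous_k v' w' continuous_prim)+
    show ?thesis
      by (simp add: Henstock_Kurzweil_Integration.integral_add[OF i(1) integrable_diff[OF i(2,3)]] Henstock_Kurzweil_Integration.integral_diff[OF i(2,3)])
  qed
  \<comment> \<open>The boundary contributions cancel, because the total integrals are twice the end
    values \<open>prim v pi\<close> and \<open>prim w pi\<close>.\<close>
  also have "\<dots> = integral {0..pi} (\<lambda>a. k a * (w a * prim v a - v a * prim w a))"
    unfolding prim_total by simp
  finally show ?thesis .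
qed

text \<open>By Wirtinger's inequality, the deficit in the isoperimetric inequality controls how far the
  primitive \<open>(V, W)\<close> is from solving the equation \<open>V' = - k W\<close>, \<open>W' = k V\<close> of uniform rotation.\<close>

lemma deficit:
  assumes v: "continuous_on UNIV v" and w: "continuous_on UNIV w" and d: "\<And>x. (v x)\<^sup>2 + (w x)\<^sup>2 \<le> 1"
  shows "tri (\<lambda>a b. k a * k b * (v a * w b - v b * w a)) \<le>
    pi - integral {0..pi} (\<lambda>x. k x * ((v x + prim w x)\<^sup>2 + (w x - prim v x)\<^sup>2)) / 2"
proof -
  have v': "continuous_on S v" and w': "continuous_on S w" for S
    using v w continuous_on_subset by blast+
  note ci = integrable_continuous_interval continuous_intros continuous_k v' w' continuous_prim
  let ?I = "integral {0..pi}"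
  let ?J = "?I (\<lambda>a. k a * (w a * prim v a - v a * prim w a))"
  have "?I (\<lambda>x. k x * ((v x + prim w x)\<^sup>2 + (w x - prim v x)\<^sup>2)) =
     ?I (\<lambda>x. (k x * (v x)\<^sup>2 + k x * (w x)\<^sup>2) + (k x * (prim v x)\<^sup>2 + k x * (prim w x)\<^sup>2)
       - 2 * (k x * (w x * prim v x - v x * prim w x)))"
    by (rule arg_cong[where f="integral _"]) (auto simp: algebra_simps power2_eq_square)
  also have "\<dots> = (?I (\<lambda>x. k x * (v x)\<^sup>2) + ?I (\<lambda>x. k x * (w x)\<^sup>2))
      + (?I (\<lambda>x. k x * (prim v x)\<^sup>2) + ?I (\<lambda>x. k x * (prim w x)\<^sup>2)) - 2 * ?J"
  proof -
    have "((\<lambda>x. k x * (v x)\<^sup>2) has_integral ?I (\<lambda>x. k x * (v x)\<^sup>2)) {0..pi}"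
      "((\<lambda>x. k x * (w x)\<^sup>2) has_integral ?I (\<lambda>x. k x * (w x)\<^sup>2)) {0..pi}"
      "((\<lambda>x. k x * (prim v x)\<^sup>2) has_integral ?I (\<lambda>x. k x * (prim v x)\<^sup>2)) {0..pi}"
      "((\<lambda>x. k x * (prim w x)\<^sup>2) has_integral ?I (\<lambda>x. k x * (prim w x)\<^sup>2)) {0..pi}"
      "((\<lambda>x. k x * (w x * prim v x - v x * prim w x)) has_integral ?J) {0..pi}"
      by (intro integrable_integral ci)+
    then show ?thesis
      by (intro integral_unique has_integral_diff has_integral_add has_integral_mult_right)
  qed
  \<comment> \<open>Wirtinger's inequality replaces the squared primitives by the squared
    velocities, which the disc condition and the total angle pi bound further down.\<close>
  also have "\<dots> \<le> 2 * (?I (\<lambda>x. k x * (v x)\<^sup>2) + ?I (\<lambda>x. k x * (w x)\<^sup>2)) - 2 * ?J"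
    using wirtinger[OF prim_deriv[OF v'] v' prim_anti] wirtinger[OF prim_deriv[OF w'] w' prim_anti] by simp
  finally have 0: "?I (\<lambda>x. k x * ((v x + prim w x)\<^sup>2 + (w x - prim v x)\<^sup>2)) \<le>
    2 * (?I (\<lambda>x. k x * (v x)\<^sup>2) + ?I (\<lambda>x. k x * (w x)\<^sup>2)) - 2 * ?J" .
  have *: "j \<le> n - e / 2" if "e \<le> 2 * n - 2 * j" for e n j :: real using that by linarith
  have 1: "?J \<le> (?I (\<lambda>x. k x * (v x)\<^sup>2) + ?I (\<lambda>x. k x * (w x)\<^sup>2))
    - ?I (\<lambda>x. k x * ((v x + prim w x)\<^sup>2 + (w x - prim v x)\<^sup>2)) / 2"
    by (rule *[OF 0])
  have "?I (\<lambda>x. k x * (v x)\<^sup>2) + ?I (\<lambda>x. k x * (w x)\<^sup>2) = ?I (\<lambda>x. k x * (v x)\<^sup>2 + k x * (w x)\<^sup>2)"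
    by (rule Henstock_Kurzweil_Integration.integral_add[symmetric]) (intro ci)+
  also have "\<dots> \<le> ?I k"
  proof (rule integral_le)
    fix x
    have "k x * ((v x)\<^sup>2 + (w x)\<^sup>2) \<le> k x * 1"
      using k_pos[of x] by (intro mult_left_mono d) auto
    then show "k x * (v x)\<^sup>2 + k x * (w x)\<^sup>2 \<le> k x" by (simp add: distrib_left)
  qed (intro ci)+
  also have "\<dots> = pi" by (rule integral_unique[OF k_total])
  finally have 2: "?I (\<lambda>x. k x * (v x)\<^sup>2) + ?I (\<lambda>x. k x * (w x)\<^sup>2) \<le> pi" .
  show ?thesis unfolding tri_kk[OF v w]
    by (rule order_trans[OF 1]) (rule diff_right_mono[OF 2])
qed

text \<open>\<open>XX\<close> and \<open>YY\<close> are the coordinates of the primitive curve in a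
  frame turning with \<open>\<phi>\<close>. They are constant for a uniform rotation, so their drift
  measures the distance from one.\<close>

definition XX :: "(real \<Rightarrow> real) \<Rightarrow> (real \<Rightarrow> real) \<Rightarrow> real \<Rightarrow> real" where
  "XX v w t = prim v t * cos (\<phi> t) + prim w t * sin (\<phi> t)"

definition YY :: "(real \<Rightarrow> real) \<Rightarrow> (real \<Rightarrow> real) \<Rightarrow> real \<Rightarrow> real" where
  "YY v w t = - prim v t * sin (\<phi> t) + prim w t * cos (\<phi> t)"

text \<open>Differentiation in the turning frame leaves only the defects \<open>v + prim w\<close>
  and \<open>w - prim v\<close>, rotated and weighted by \<open>k\<close>; \<open>E\<close> is their
  weighted L1 norm.\<close>

lemma rotation_close:
  assumes v: "continuous_on UNIV v" and w: "continuous_on UNIV w" and t: "t \<in> {0..pi}"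
  defines "E \<equiv> integral {0..pi} (\<lambda>x. k x * (\<bar>v x + prim w x\<bar> + \<bar>w x - prim v x\<bar>))"
  shows "\<bar>XX v w t - XX v w 0\<bar> \<le> E" "\<bar>YY v w t - YY v w 0\<bar> \<le> E"
proof -
  have v': "continuous_on S v" and w': "continuous_on S w" for S
    using v w continuous_on_subset by blast+
  have cp: "continuous_on {0..pi} (prim v)" "continuous_on {0..pi} (prim w)"
    by (intro continuous_prim v' w')+
  have cs: "continuous_on {0..t} (prim v)" "continuous_on {0..t} (prim w)"
    using cp t by (auto elim!: continuous_on_subset)
  let ?h = "\<lambda>x. k x * (\<bar>v x + prim w x\<bar> + \<bar>w x - prim v x\<bar>)"
  have le: "\<bar>F t - F 0\<bar> \<le> E"
    if F: "\<And>x. x \<in> {0..pi} \<Longrightarrow> (F has_real_derivative G x) (at x within {0..pi})"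
      and G: "\<And>x. \<bar>G x\<bar> \<le> ?h x" for F G
  proof -
    have "(G has_integral (F t - F 0)) {0..t}"
    proof (rule fundamental_theorem_of_calculus)
      fix x assume "x \<in> {0..t}"
      then show "(F has_vector_derivative G x) (at x within {0..t})"
        unfolding has_real_derivative_iff_has_vector_derivative[symmetric]
        by (intro has_field_derivative_subset[OF F]) (use t in auto)
    qed (use t in auto)
    then have Gi: "G integrable_on {0..t}" "integral {0..t} G = F t - F 0"
      by (auto simp: has_integral_integrable_integral)
    have "norm (integral {0..t} G) \<le> integral {0..t} ?h"
    proof (rule integral_norm_bound_integral[OF Gi(1)])
      show "?h integrable_on {0..t}"
        by (intro integrable_continuous_interval continuous_intros continuous_k v' w' cs)
    qed (use G in simp)
    then have "norm (F t - F 0) \<le> integral {0..t} ?h" unfolding Gi(2) .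
    also have "\<dots> \<le> E"
      unfolding E_def
    proof (rule integral_subset_le)
      show "?h integrable_on {0..t}"
        by (intro integrable_continuous_interval continuous_intros continuous_k v' w' cs)
      show "?h integrable_on {0..pi}"
        by (intro integrable_continuous_interval continuous_intros continuous_k v' w' cp)
      show "\<forall>x\<in>{0..pi}. 0 \<le> ?h x" using k_pos by (simp add: less_imp_le)
    qed (use t in auto)
    finally show ?thesis by simp
  qed
  have b: "\<bar>k x * (p * cos s + q * sin s)\<bar> \<le> k x * (\<bar>p\<bar> + \<bar>q\<bar>)" for x p q s
  proof -
    have "\<bar>p * cos s + q * sin s\<bar> \<le> \<bar>p\<bar> * \<bar>cos s\<bar> + \<bar>q\<bar> * \<bar>sin s\<bar>"
      using abs_triangle_ineq[of "p * cos s" "q * sin s"] by (simp add: abs_mult)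
    also have "\<dots> \<le> \<bar>p\<bar> * 1 + \<bar>q\<bar> * 1" by (intro add_mono mult_left_mono) auto
    finally show ?thesis using k_pos[of x] by (simp add: abs_mult)
  qed
  have b': "\<bar>k x * (q * cos s - p * sin s)\<bar> \<le> k x * (\<bar>p\<bar> + \<bar>q\<bar>)" for x p q s
    using b[of x q s "-p"] by (simp add: add.commute)
  have X: "(XX v w has_real_derivative k x * ((v x + prim w x) * cos (\<phi> x) + (w x - prim v x) * sin (\<phi> x)))
      (at x within {0..pi})" if "x \<in> {0..pi}" for x
    unfolding XX_def
    by (rule derivative_eq_intros prim_deriv[OF v' that] prim_deriv[OF w' that]
        has_field_derivative_at_within[OF \<phi>_deriv] refl | simp add: algebra_simps)+
  have Y: "(YY v w has_real_derivative k x * ((w x - prim v x) * cos (\<phi> x) - (v x + prim w x) * sin (\<phi> x)))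
      (at x within {0..pi})" if "x \<in> {0..pi}" for x
    unfolding YY_def
    by (rule derivative_eq_intros prim_deriv[OF v' that] prim_deriv[OF w' that]
        has_field_derivative_at_within[OF \<phi>_deriv] refl | simp add: algebra_simps)+
  show "\<bar>XX v w t - XX v w 0\<bar> \<le> E" by (rule le[OF X b])
  show "\<bar>YY v w t - YY v w 0\<bar> \<le> E" by (rule le[OF Y b'])
qed

text \<open>A rotation preserves length, and each primitive starts within pi / 2 of zero.\<close>

lemma XY_0_bound:
  assumes v: "continuous_on UNIV v" and w: "continuous_on UNIV w" and d: "\<And>x. (v x)\<^sup>2 + (w x)\<^sup>2 \<le> 1"
  shows "(XX v w 0)\<^sup>2 + (YY v w 0)\<^sup>2 \<le> pi\<^sup>2"
proof -
  have v': "continuous_on S v" and w': "continuous_on S w" for S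
    using v w continuous_on_subset by blast+
  have "\<bar>v x\<bar> \<le> 1" "\<bar>w x\<bar> \<le> 1" for x
    by (rule disc_abs_le[OF d])+
  from prim_bound[OF v' this(1)] prim_bound[OF w' this(2)]
  have "(prim v 0)\<^sup>2 \<le> (pi / 2)\<^sup>2" "(prim w 0)\<^sup>2 \<le> (pi / 2)\<^sup>2"
    by (simp_all add: abs_le_square_iff[symmetric])
  moreover have "(XX v w 0)\<^sup>2 + (YY v w 0)\<^sup>2 = (prim v 0)\<^sup>2 + (prim w 0)\<^sup>2"
    unfolding XX_def YY_def using sin_cos_squared_add[of "\<phi> 0"] by algebra
  moreover have "(pi / 2)\<^sup>2 + (pi / 2)\<^sup>2 \<le> pi\<^sup>2" by (simp add: power_divide)
  ultimately show ?thesis by linarith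
qed

lemma prim_XY:
  "prim v t = XX v w t * cos (\<phi> t) - YY v w t * sin (\<phi> t)"
  "prim w t = XX v w t * sin (\<phi> t) + YY v w t * cos (\<phi> t)"
  unfolding XX_def YY_def using sin_cos_squared_add[of "\<phi> t"] by algebra+

end

section \<open>Weakly singular kernels\<close>

text \<open>The size of the singular kernels \<open>min 1 (\<delta> / s)\<close>, relaxed to an exponent \<open>q < 1\<close>
  so that no logarithm appears on integration.\<close>

definition kap :: "real \<Rightarrow> real \<Rightarrow> real \<Rightarrow> real" where
  "kap q \<delta> s = (if s \<le> \<delta> then 1 else (\<delta> / s) powr q)"

lemma kap_nonneg: "0 \<le> kap q \<delta> s"
  by (simp add: kap_def)

lemma kap_le_1:
  assumes "0 < q" "0 < \<delta>"
  shows "kap q \<delta> s \<le> 1"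
  using assms by (auto simp: kap_def intro!: powr_le1)

lemma kap_ge:
  assumes "q \<le> 1" "0 < \<delta>" "\<delta> < s"
  shows "\<delta> / s \<le> kap q \<delta> s"
proof -
  have "\<delta> / s = (\<delta> / s) powr 1" using assms by simp
  also have "\<dots> \<le> (\<delta> / s) powr q" using assms by (intro powr_mono') auto
  finally show ?thesis using assms by (simp add: kap_def)
qed

lemma kap_measurable: "kap q \<delta> \<in> borel_measurable borel"
proof -
  have "(\<lambda>s. kap q \<delta> s) \<in> borel_measurable borel"
    unfolding kap_def by measurable
  then show ?thesis by simp
qed

lemma sin_ge_chord:
  assumes "0 \<le> t" "t \<le> pi"
  shows "2 / pi * min t (pi - t) \<le> sin t"
proof -
  have chord: "2 / pi * s \<le> sin s" if s: "0 \<le> s" "s \<le> pi / 2" for s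
  proof -
    have "convex_on {0..pi/2} (\<lambda>x. - sin x)"
      by (rule convex_on_realI[where f'="\<lambda>x. - cos x"])
        (auto intro!: derivative_eq_intros cos_monotone_0_pi_le)
    from convex_onD_Icc'[OF this, of s] s
    have "- sin s \<le> - (2 / pi * s)" by (simp add: field_simps)
    then show ?thesis by simp
  qed
  show ?thesis
  proof (cases "t \<le> pi / 2")
    case True
    then show ?thesis using chord[of t] assms by (simp add: min_def)
  next
    case False
    then show ?thesis using chord[of "pi - t"] assms by (simp add: min_def)
  qed
qed

lemma powr_pair_integral:
  assumes q: "0 < q" "q < 1"
  shows "((\<lambda>t. t powr (-q) + (pi - t) powr (-q)) has_integral 2 * pi powr (1 - q) / (1 - q)) {0..pi}"
proof -
  let ?P = "\<lambda>t. (t powr (1 - q) - (pi - t) powr (1 - q)) / (1 - q)"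
  have "((\<lambda>t. t powr (-q) + (pi - t) powr (-q)) has_integral ?P pi - ?P 0) {0..pi}"
  proof (rule fundamental_theorem_of_calculus_interior)
    show "continuous_on {0..pi} ?P"
      using q by (intro continuous_intros continuous_on_powr') auto
    fix t assume t: "t \<in> {0<..<pi}"
    have "(?P has_real_derivative t powr (-q) + (pi - t) powr (-q)) (at t)"
    proof -
      have l: "((\<lambda>t. t powr (1 - q)) has_real_derivative (1 - q) * t powr (1 - q - 1)) (at t)"
        using t by (intro has_real_derivative_powr) auto
      have "((\<lambda>t. pi - t) has_real_derivative - 1) (at t)"
        by (auto intro!: derivative_eq_intros)
      from DERIV_chain2[OF has_real_derivative_powr this, of "1 - q"]
      have r: "((\<lambda>t. (pi - t) powr (1 - q)) has_real_derivative (1 - q) * (pi - t) powr (1 - q - 1) * - 1) (at t)"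
        using t by simp
      have e: "((1 - q) * t powr (1 - q - 1) - (1 - q) * (pi - t) powr (1 - q - 1) * - 1) / (1 - q)
         = t powr (-q) + (pi - t) powr (-q)"
        using q by (simp add: distrib_left[symmetric])
      from DERIV_cdivide[OF DERIV_diff[OF l r], of "1 - q"] show ?thesis
        unfolding e .
    qed
    then show "(?P has_vector_derivative t powr (-q) + (pi - t) powr (-q)) (at t)"
      by (simp add: has_real_derivative_iff_has_vector_derivative)
  qed simp
  moreover have "?P pi - ?P 0 = 2 * pi powr (1 - q) / (1 - q)"
    by (simp add: diff_divide_distrib)
  ultimately show ?thesis by simp
qed

text \<open>The chord bound on the sine turns \<delta> / sin t into a power of the distance to the
  nearer endpoint; the sum of the powers for both endpoints dominates either one.\<close>

lemma kap_le_powr: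
  assumes q: "0 < q" and \<delta>: "0 < \<delta>" and t: "0 < t" "t < pi"
  shows "kap q \<delta> (sin t) \<le> \<delta> powr q * (pi / 2) powr q * (t powr (-q) + (pi - t) powr (-q))"
proof -
  have s: "0 < sin t" using t by (rule sin_gt_zero)
  have mn: "0 < min t (pi - t)" using t by simp
  have "kap q \<delta> (sin t) \<le> (\<delta> / sin t) powr q"
    using s \<delta> q by (auto simp: kap_def intro!: ge_one_powr_ge_zero)
  also have "\<dots> \<le> (\<delta> * (pi / 2) / min t (pi - t)) powr q"
  proof (rule powr_mono2)
    show "\<delta> / sin t \<le> \<delta> * (pi / 2) / min t (pi - t)"
    proof -
      have "\<delta> / sin t \<le> \<delta> / (2 / pi * min t (pi - t))"
        using sin_ge_chord[of t] t mn \<delta> by (intro divide_left_mono mult_pos_pos s) auto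
      then show ?thesis by (simp add: field_simps)
    qed
  qed (use q \<delta> s in auto)
  also have "\<dots> = \<delta> powr q * (pi / 2) powr q * (min t (pi - t)) powr (-q)"
  proof -
    have "(\<delta> * (pi / 2) / min t (pi - t)) powr q = (\<delta> * (pi / 2)) powr q / min t (pi - t) powr q"
      by (rule powr_divide)
    moreover have "(\<delta> * (pi / 2)) powr q = \<delta> powr q * (pi / 2) powr q"
      by (rule powr_mult)
    ultimately show ?thesis unfolding powr_minus divide_inverse by metis
  qed
  also have "\<dots> \<le> \<delta> powr q * (pi / 2) powr q * (t powr (-q) + (pi - t) powr (-q))"
    by (intro mult_left_mono) (auto simp: min_def)
  finally show ?thesis .
qed

lemma kap_sin_integrable:
  assumes "0 < q" "0 < \<delta>"
  shows "set_integrable lborel {0..L} (\<lambda>t. kap q \<delta> (sin t))"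
proof -
  have "integrable lborel (\<lambda>t. indicator {0..L} t * (1::real))"
    using borel_integrable_atLeastAtMost'[of 0 L "\<lambda>_. 1::real"] by (simp add: set_integrable_def)
  then show ?thesis unfolding set_integrable_def
  proof (rule Bochner_Integration.integrable_bound)
    have "(\<lambda>t. kap q \<delta> (sin t)) \<in> borel_measurable borel"
      by (rule measurable_compose[OF _ kap_measurable]) simp
    then show "(\<lambda>t. indicat_real {0..L} t *\<^sub>R kap q \<delta> (sin t)) \<in> borel_measurable lborel" by simp
  qed (use kap_le_1[OF assms] kap_nonneg in \<open>auto simp: indicator_def\<close>)
qed

text \<open>It grows without bound as \<open>q\<close> approaches 1 from below, the trace of the
  logarithm that the exponent 1 would produce.\<close>

definition kap_const :: "real \<Rightarrow> real" where
  "kap_const q = (pi / 2) powr q * (2 * pi powr (1 - q) / (1 - q))"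

lemma kap_const_nonneg: "q < 1 \<Longrightarrow> 0 \<le> kap_const q"
  by (simp add: kap_const_def)

lemma kap_sin_integral:
  assumes q: "0 < q" "q < 1" and \<delta>: "0 < \<delta>" and L: "L \<le> pi"
  shows "(LINT t:{0..L}|lborel. kap q \<delta> (sin t)) \<le> kap_const q * \<delta> powr q"
proof -
  have "(LINT t:{0..L}|lborel. kap q \<delta> (sin t)) \<le> (LINT t:{0..pi}|lborel. kap q \<delta> (sin t))"
    unfolding set_lebesgue_integral_def
    using kap_sin_integrable[OF q(1) \<delta>] L kap_nonneg
    by (intro Bochner_Integration.integral_mono) (auto simp: set_integrable_def indicator_def)
  also have "\<dots> = integral {0..pi} (\<lambda>t. kap q \<delta> (sin t))"
    by (rule set_borel_integral_eq_integral(2)[OF kap_sin_integrable[OF q(1) \<delta>]])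
  also have "\<dots> \<le> kap_const q * \<delta> powr q"
  proof -
    let ?c = "\<delta> powr q * (pi / 2) powr q"
    let ?G = "\<lambda>t. ?c * (t powr (-q) + (pi - t) powr (-q))"
    have "(?G has_integral ?c * (2 * pi powr (1 - q) / (1 - q))) {0..pi}"
      by (intro has_integral_mult_right powr_pair_integral q)
    \<comment> \<open>Since \<open>0 powr (-q)\<close> is 0, the majorant \<open>?G\<close> may fail
      at the two endpoints; the value 1 is put there instead.\<close>
    then have G: "((\<lambda>t. if t \<in> {0, pi} then 1 else ?G t) has_integral ?c * (2 * pi powr (1 - q) / (1 - q))) {0..pi}"
      by (rule has_integral_spike_finite[where S="{0, pi}", rotated 2]) auto
    have k: "((\<lambda>t. kap q \<delta> (sin t)) has_integral integral {0..pi} (\<lambda>t. kap q \<delta> (sin t))) {0..pi}"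
      by (intro integrable_integral set_borel_integral_eq_integral(1)[OF kap_sin_integrable[OF q(1) \<delta>]])
    have "integral {0..pi} (\<lambda>t. kap q \<delta> (sin t)) \<le> ?c * (2 * pi powr (1 - q) / (1 - q))"
    proof (rule has_integral_le[OF k G])
      fix t assume "t \<in> {0..pi}"
      then show "kap q \<delta> (sin t) \<le> (if t \<in> {0, pi} then 1 else ?G t)"
        using kap_le_1[OF q(1) \<delta>] kap_le_powr[OF q(1) \<delta>, of t] by auto
    qed
    then show ?thesis by (simp add: kap_const_def mult_ac)
  qed
  finally show ?thesis .
qed

lemma kap_row_integral:
  assumes q: "0 < q" "q < 1" and \<delta>: "0 < \<delta>" and a: "a \<in> {0..pi}"
  shows "(LINT b:{a..pi}|lborel. kap q \<delta> (sin (b - a))) \<le> kap_const q * \<delta> powr q"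
proof -
  have "(LINT t:{0..pi - a}|lborel. kap q \<delta> (sin t)) =
     (LINT b|lborel. indicator {0..pi - a} (- a + 1 * b) *\<^sub>R kap q \<delta> (sin (- a + 1 * b)))"
    unfolding set_lebesgue_integral_def
    using lborel_integral_real_affine[of 1 "\<lambda>t. indicator {0..pi - a} t *\<^sub>R kap q \<delta> (sin t)" "- a"] by simp
  also have "\<dots> = (LINT b:{a..pi}|lborel. kap q \<delta> (sin (b - a)))"
    unfolding set_lebesgue_integral_def
    by (intro Bochner_Integration.integral_cong refl) (auto simp: indicator_def)
  finally show ?thesis using kap_sin_integral[OF q \<delta>, of "pi - a"] a by simp
qed

lemma kap_column_integral:
  assumes q: "0 < q" "q < 1" and \<delta>: "0 < \<delta>" and b: "b \<in> {0..pi}"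
  shows "(LINT a:{0..b}|lborel. kap q \<delta> (sin (b - a))) \<le> kap_const q * \<delta> powr q"
proof -
  have "(LINT t:{0..b}|lborel. kap q \<delta> (sin t)) =
     (LINT a|lborel. indicator {0..b} (b + (- 1) * a) *\<^sub>R kap q \<delta> (sin (b + (- 1) * a)))"
    unfolding set_lebesgue_integral_def
    using lborel_integral_real_affine[of "-1" "\<lambda>t. indicator {0..b} t *\<^sub>R kap q \<delta> (sin t)" b] by simp
  also have "\<dots> = (LINT a:{0..b}|lborel. kap q \<delta> (sin (b - a)))"
    unfolding set_lebesgue_integral_def
    by (intro Bochner_Integration.integral_cong refl) (auto simp: indicator_def)
  finally show ?thesis using kap_sin_integral[OF q \<delta>, of b] b by simp
qed

lemma kap_sin_measurable:
  "(\<lambda>z. kap q \<delta> (sin (snd z - fst z))) \<in> borel_measurable (borel :: (real \<times> real) measure)"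
  by (rule measurable_compose[OF _ kap_measurable])
    (intro borel_measurable_continuous_onI continuous_intros)

lemma tri_adm_kap:
  assumes "0 < q" "0 < \<delta>"
  shows "tri_adm (\<lambda>a b. kap q \<delta> (sin (b - a)))"
  by (rule tri_admI[where C=1, OF kap_sin_measurable]) (use kap_nonneg kap_le_1[OF assms] in simp)

text \<open>Schur's test: row and column integrals of the kernel have the common bound
  \<open>kap_const q * \<delta> powr q\<close>. In each summand the variable on which
  \<open>u\<close> does not depend is integrated first, which takes one order of integration for
  \<open>u a\<close> and the other for \<open>u b\<close>.\<close>

lemma tri_kap_schur:
  assumes q: "0 < q" "q < 1" and \<delta>: "0 < \<delta>"
    and u: "continuous_on UNIV u" and u0: "\<And>x. 0 \<le> u x"
  shows "tri (\<lambda>a b. kap q \<delta> (sin (b - a)) * (u a + u b)) \<le> 2 * kap_const q * \<delta> powr q * integral {0..pi} u"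
proof -
  let ?K = "\<lambda>a b. kap q \<delta> (sin (b - a))"
  let ?c = "kap_const q * \<delta> powr q"
  have uS: "continuous_on S u" for S using u continuous_on_subset by blast
  have "tri_adm (\<lambda>a b. u a)" "tri_adm (\<lambda>a b. u b)"
    by (intro tri_adm_continuous continuous_on_compose2[OF u] continuous_intros; simp)+
  then have adm: "tri_adm (\<lambda>a b. ?K a b * u a)" "tri_adm (\<lambda>a b. ?K a b * u b)"
    by (intro tri_adm_mult tri_adm_kap q \<delta>; simp)+
  have int: "(LINT a:{0..pi}|lborel. h a * u a) \<le> ?c * integral {0..pi} u"
    if h: "\<And>a. a \<in> {0..pi} \<Longrightarrow> 0 \<le> h a \<and> h a \<le> ?c" for h
  proof -
    have "(LINT a:{0..pi}|lborel. h a * u a) \<le> (LINT a:{0..pi}|lborel. ?c * u a)"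
      unfolding set_lebesgue_integral_def
    proof (rule integral_mono')
      show "integrable lborel (\<lambda>x. indicat_real {0..pi} x *\<^sub>R (?c * u x))"
        using borel_integrable_atLeastAtMost'[OF continuous_on_mult[OF continuous_on_const uS], of 0 pi]
        by (simp add: set_integrable_def)
    qed (use h u0 in \<open>auto simp: indicator_def intro!: mult_right_mono mult_nonneg_nonneg kap_const_nonneg[OF q(2)]\<close>)
    also have "\<dots> = ?c * integral {0..pi} u"
      by (simp add: set_lint_continuous uS)
    finally show ?thesis .
  qed
  have "tri (\<lambda>a b. ?K a b * u a) = (LINT a:{0..pi}|lborel. (LINT b:{a..pi}|lborel. ?K a b) * u a)"
    unfolding tri_iterated[OF adm(1)] by simp
  also have "\<dots> \<le> ?c * integral {0..pi} u"
    using kap_row_integral[OF q \<delta>] kap_nonneg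
    by (intro int) (auto simp: set_lebesgue_integral_def intro!: Bochner_Integration.integral_nonneg)
  finally have 1: "tri (\<lambda>a b. ?K a b * u a) \<le> ?c * integral {0..pi} u" .
  have "tri (\<lambda>a b. ?K a b * u b) = (LINT b:{0..pi}|lborel. (LINT a:{0..b}|lborel. ?K a b) * u b)"
    unfolding tri_swapped[OF adm(2)] by simp
  also have "\<dots> \<le> ?c * integral {0..pi} u"
    using kap_column_integral[OF q \<delta>] kap_nonneg
    by (intro int) (auto simp: set_lebesgue_integral_def intro!: Bochner_Integration.integral_nonneg)
  finally have 2: "tri (\<lambda>a b. ?K a b * u b) \<le> ?c * integral {0..pi} u" .
  have "tri (\<lambda>a b. ?K a b * (u a + u b)) = tri (\<lambda>a b. ?K a b * u a) + tri (\<lambda>a b. ?K a b * u b)"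
    unfolding distrib_left by (rule tri_add[OF adm])
  then show ?thesis using 1 2 by simp
qed

lemma tri_kap:
  assumes q: "0 < q" "q < 1" and \<delta>: "0 < \<delta>"
  shows "tri (\<lambda>a b. kap q \<delta> (sin (b - a))) \<le> pi * kap_const q * \<delta> powr q"
proof -
  \<comment> \<open>The constant function 1/2 makes \<open>u a + u b\<close> equal to 1.\<close>
  have "tri (\<lambda>a b. kap q \<delta> (sin (b - a)) * (1/2 + 1/2)) \<le> 2 * kap_const q * \<delta> powr q * integral {0..pi} (\<lambda>_. 1/2)"
    by (rule tri_kap_schur[OF q \<delta>]) auto
  then show ?thesis by (simp add: mult_ac)
qed

section \<open>Expansion of the kernel\<close>

lemma abs_mult_le: "\<bar>x\<bar> \<le> a \<Longrightarrow> \<bar>y\<bar> \<le> b \<Longrightarrow> \<bar>x * y\<bar> \<le> a * b" for x y a b :: real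
  unfolding abs_mult by (intro mult_mono) auto

lemma abs_add_le: "\<bar>x\<bar> \<le> a \<Longrightarrow> \<bar>y\<bar> \<le> b \<Longrightarrow> \<bar>x + y\<bar> \<le> a + b" for x y a b :: real
  by linarith

text \<open>The left-hand side is \<open>1\<close> minus the squared norm of the plane vector with components \<open>u + \<eta>\<close>,
  \<open>u' + \<eta>'\<close> along two unit vectors enclosing an angle with sine \<open>s\<close> and cosine \<open>c\<close>.\<close>

lemma gram_expansion:
  fixes s c u u' u1 u1' D \<eta> \<eta>' :: real
  assumes s: "s \<noteq> 0" and sc: "s\<^sup>2 + c\<^sup>2 = 1" and u': "u' = u * c + u1 * s" and u1': "u1' = - u * s + u1 * c"
    and D: "u\<^sup>2 + u1\<^sup>2 = 1 - D\<^sup>2"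
  shows "1 - ((u + \<eta>)\<^sup>2 + (u' + \<eta>')\<^sup>2 - 2 * c * (u + \<eta>) * (u' + \<eta>')) / s\<^sup>2
    = D\<^sup>2 - 2 * ((\<eta>' * u1 - \<eta> * u1') / s) - (\<eta>\<^sup>2 + \<eta>'\<^sup>2 - 2 * c * \<eta> * \<eta>') / s\<^sup>2"
proof -
  have "s\<^sup>2 - ((u + \<eta>)\<^sup>2 + (u' + \<eta>')\<^sup>2 - 2 * c * (u + \<eta>) * (u' + \<eta>'))
    = D\<^sup>2 * s\<^sup>2 - 2 * (\<eta>' * u1 - \<eta> * u1') * s - (\<eta>\<^sup>2 + \<eta>'\<^sup>2 - 2 * c * \<eta> * \<eta>')"
    using sc u' u1' D by algebra
  moreover have "1 - e / s\<^sup>2 = (s\<^sup>2 - e) / s\<^sup>2" for e using s by (simp add: diff_divide_distrib)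
  moreover have "D\<^sup>2 - 2 * (l / s) - e / s\<^sup>2 = (D\<^sup>2 * s\<^sup>2 - 2 * l * s - e) / s\<^sup>2" for l e
    using s by (simp add: diff_divide_distrib power2_eq_square)
  ultimately show ?thesis by metis
qed

text \<open>Taylor expansion of 1 / (1 - x^2), the factor 1 / sin^2 of the kernel when x = cos f.
  The slope is \<open>2 * u * n0\<^sup>2\<close>, and the remainder appears on inserting the formula
  for \<open>n - n0\<close> into itself.\<close>

lemma inverse_expansion:
  fixes u x B \<delta> :: real
  assumes u: "\<bar>u\<bar> \<le> 1" "1 / B \<le> 1 - u\<^sup>2" and x: "\<bar>x\<bar> \<le> 1" "1 / B \<le> 1 - x\<^sup>2"
    and B: "1 \<le> B" and \<delta>: "\<bar>x - u\<bar> \<le> \<delta>"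
  defines "n \<equiv> 1 / (1 - x\<^sup>2)" and "n0 \<equiv> 1 / (1 - u\<^sup>2)"
  shows "\<bar>n\<bar> \<le> B" "\<bar>n0\<bar> \<le> B" "\<bar>n - n0\<bar> \<le> 2 * \<delta> * B\<^sup>2"
    "\<bar>n - n0 - 2 * u * (x - u) * n0\<^sup>2\<bar> \<le> 5 * B ^ 3 * \<delta>\<^sup>2"
proof -
  have pos: "0 < 1 - x\<^sup>2" "0 < 1 - u\<^sup>2"
    using u(2) x(2) B by (smt (verit) divide_pos_pos)+
  have "1 / (1 - x\<^sup>2) \<le> B" "1 / (1 - u\<^sup>2) \<le> B"
    using pos u(2) x(2) B by (auto simp: field_simps)
  then show nB: "\<bar>n\<bar> \<le> B" "\<bar>n0\<bar> \<le> B" using pos unfolding n_def n0_def by simp_all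
  have e: "n - n0 = (x - u) * (x + u) * (n * n0)"
    using pos unfolding n_def n0_def by (simp add: field_simps power2_eq_square)
  have \<delta>0: "0 \<le> \<delta>" using \<delta> by linarith
  have "\<bar>x + u\<bar> \<le> 2" using u(1) x(1) by linarith
  then have "\<bar>(x - u) * (x + u) * (n * n0)\<bar> \<le> \<delta> * 2 * (B * B)"
    by (intro abs_mult_le \<delta> nB)
  then show d: "\<bar>n - n0\<bar> \<le> 2 * \<delta> * B\<^sup>2" unfolding e by (simp add: power2_eq_square mult_ac)
  have "n - n0 - 2 * u * (x - u) * n0\<^sup>2 = ((x - u) * (x - u)) * (n * n0) + (2 * u) * (x - u) * (n0 * (n - n0))"
    unfolding power2_eq_square using e by algebra
  moreover have "\<bar>((x - u) * (x - u)) * (n * n0) + (2 * u) * (x - u) * (n0 * (n - n0))\<bar>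
     \<le> (\<delta> * \<delta>) * (B * B) + 2 * \<delta> * (B * (2 * \<delta> * B\<^sup>2))"
    using u(1) by (intro abs_add_le abs_mult_le \<delta> nB d) simp
  moreover have "(\<delta> * \<delta>) * (B * B) + 2 * \<delta> * (B * (2 * \<delta> * B\<^sup>2)) \<le> 5 * B ^ 3 * \<delta>\<^sup>2"
  proof -
    have "(\<delta> * \<delta>) * (B * B) * 1 \<le> (\<delta> * \<delta>) * (B * B) * B" using B \<delta>0 by (intro mult_left_mono) auto
    then show ?thesis by (simp add: power2_eq_square power3_eq_cube mult_ac)
  qed
  ultimately show "\<bar>n - n0 - 2 * u * (x - u) * n0\<^sup>2\<bar> \<le> 5 * B ^ 3 * \<delta>\<^sup>2" by linarith
qed

text \<open>Here \<open>z\<close> stands for \<delta>/s, \<open>L\<close> and \<open>Q\<close> for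
  the linear and quadratic terms of the Gram expansion, and \<open>t\<close> for the linear part of
  \<open>n - n0\<close>; \<open>LL\<close> collects what is linear in the perturbation. As \<delta>
  \<le> z, every remainder is of order z^2. The constants are 34 = 14 + 16 + 4 and 8 = 4 +
  4.\<close>

lemma kernel_expansion:
  fixes D L Q n n' n0 n0' t t' B \<delta> z :: real
  assumes D: "\<bar>D\<bar> \<le> 1" and B: "1 \<le> B" and \<delta>: "0 \<le> \<delta>" "\<delta> \<le> z"
    and L: "\<bar>L\<bar> \<le> 2 * z" and Q: "\<bar>Q\<bar> \<le> 4 * z\<^sup>2"
    and n: "\<bar>n\<bar> \<le> B" "\<bar>n0\<bar> \<le> B" "\<bar>n - n0\<bar> \<le> 2 * \<delta> * B\<^sup>2" "\<bar>n - n0 - t\<bar> \<le> 5 * B ^ 3 * \<delta>\<^sup>2"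
    and n': "\<bar>n'\<bar> \<le> B" "\<bar>n0'\<bar> \<le> B" "\<bar>n' - n0'\<bar> \<le> 2 * \<delta> * B\<^sup>2" "\<bar>n' - n0' - t'\<bar> \<le> 5 * B ^ 3 * \<delta>\<^sup>2"
    and t: "\<bar>t\<bar> \<le> 2 * \<delta> * B\<^sup>2" "\<bar>t'\<bar> \<le> 2 * \<delta> * B\<^sup>2"
  defines "LL \<equiv> D\<^sup>2 * (t * n0' + n0 * t') - 2 * L * (n0 * n0')"
  shows "\<bar>(D\<^sup>2 - 2 * L - Q) * (n * n') - D\<^sup>2 * (n0 * n0') - LL\<bar> \<le> 34 * B ^ 4 * z\<^sup>2"
    and "\<bar>LL\<bar> \<le> 8 * B ^ 3 * z"
proof -
  have z: "0 \<le> z" using \<delta> by linarith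
  have D2: "\<bar>D\<^sup>2\<bar> \<le> 1" using D by (simp add: abs_square_le_1)
  have pB: "B ^ 2 \<le> B ^ 4" "B ^ 3 \<le> B ^ 4" "B ^ 2 \<le> B ^ 3" using B by (auto intro!: power_increasing)
  have \<delta>z: "\<delta>\<^sup>2 \<le> z\<^sup>2" using \<delta> by (intro power_mono) auto
  have "(D\<^sup>2 - 2 * L - Q) * (n * n') - D\<^sup>2 * (n0 * n0') - LL
     = D\<^sup>2 * ((n - n0 - t) * n0' + n0 * (n' - n0' - t') + (n - n0) * (n' - n0'))
       + (- 2 * L) * ((n - n0) * n' + n0 * (n' - n0')) + (- Q) * (n * n')"
    unfolding LL_def by (simp add: algebra_simps)
  moreover have "\<bar>D\<^sup>2 * ((n - n0 - t) * n0' + n0 * (n' - n0' - t') + (n - n0) * (n' - n0'))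
       + (- 2 * L) * ((n - n0) * n' + n0 * (n' - n0')) + (- Q) * (n * n')\<bar>
     \<le> 1 * (5 * B ^ 3 * \<delta>\<^sup>2 * B + B * (5 * B ^ 3 * \<delta>\<^sup>2) + (2 * \<delta> * B\<^sup>2) * (2 * \<delta> * B\<^sup>2))
       + (2 * (2 * z)) * (2 * \<delta> * B\<^sup>2 * B + B * (2 * \<delta> * B\<^sup>2)) + (4 * z\<^sup>2) * (B * B)"
    using L Q by (intro abs_add_le abs_mult_le n n' D2) auto
  moreover have "\<dots> = 14 * (B ^ 4 * \<delta>\<^sup>2) + 16 * (B ^ 3 * (z * \<delta>)) + 4 * (B ^ 2 * z\<^sup>2)"
    by (simp add: power2_eq_square power3_eq_cube power4_eq_xxxx algebra_simps)
  moreover have "B ^ 4 * \<delta>\<^sup>2 \<le> B ^ 4 * z\<^sup>2" using \<delta>z by (intro mult_left_mono) auto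
  moreover have "B ^ 3 * (z * \<delta>) \<le> B ^ 4 * z\<^sup>2"
    unfolding power2_eq_square[of z] using pB z \<delta> B by (intro mult_mono) auto
  moreover have "B ^ 2 * z\<^sup>2 \<le> B ^ 4 * z\<^sup>2" using pB by (intro mult_right_mono) auto
  ultimately show "\<bar>(D\<^sup>2 - 2 * L - Q) * (n * n') - D\<^sup>2 * (n0 * n0') - LL\<bar> \<le> 34 * B ^ 4 * z\<^sup>2"
    by (simp only: mult.assoc)
  have "LL = D\<^sup>2 * (t * n0' + n0 * t') + (- 2 * L) * (n0 * n0')" by (simp add: LL_def)
  moreover have "\<bar>D\<^sup>2 * (t * n0' + n0 * t') + (- 2 * L) * (n0 * n0')\<bar>
     \<le> 1 * (2 * \<delta> * B\<^sup>2 * B + B * (2 * \<delta> * B\<^sup>2)) + (2 * (2 * z)) * (B * B)"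
    using L by (intro abs_add_le abs_mult_le n n' D2 t) auto
  moreover have "\<dots> = 4 * (B ^ 3 * \<delta>) + 4 * (B ^ 2 * z)"
    by (simp add: power2_eq_square power3_eq_cube algebra_simps)
  moreover have "B ^ 3 * \<delta> \<le> B ^ 3 * z" using \<delta> B by (intro mult_left_mono) auto
  moreover have "B ^ 2 * z \<le> B ^ 3 * z" using pB z by (intro mult_right_mono) auto
  ultimately show "\<bar>LL\<bar> \<le> 8 * B ^ 3 * z"
    by (simp only: mult.assoc)
qed

text \<open>\<open>N\<close> is the Gram determinant of a spherical triangle with sides
  \<open>b - a\<close>, \<open>f a\<close>, \<open>f b\<close>. Its nonnegativity expresses the
  triangle inequalities and the bound 2 pi on the perimeter. The upper bound holds because the
  difference is a sum of squares.\<close>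

lemma ES1_gram_bounds:
  assumes f: "f \<in> ES1" and ab: "a \<le> b" "b \<le> a + pi"
  defines "N \<equiv> 1 - (cos (b - a))\<^sup>2 - (cos (f a))\<^sup>2 - (cos (f b))\<^sup>2 + 2 * cos (b - a) * cos (f a) * cos (f b)"
  shows "0 \<le> N" "N \<le> (sin (b - a))\<^sup>2"
proof -
  have lip: "\<bar>f x - f y\<bar> \<le> \<bar>x - y\<bar>" and anti: "f (x + pi) + f x = pi" for x y
    using f by (auto simp: ES1_def)
  have d: "\<bar>f a - f b\<bar> \<le> b - a" using lip[of a b] ab by linarith
  \<comment> \<open>The Lipschitz condition at the antipode \<open>a + pi\<close>, where
    \<open>f\<close> takes the value \<open>pi - f a\<close>, controls the sum of the two
    distances.\<close>
  have s: "b - a \<le> f a + f b" "f a + f b \<le> 2 * pi - (b - a)"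
    using lip[of "a + pi" b] anti[of a] ab by linarith+
  have "cos (b - a) \<le> cos \<bar>f a - f b\<bar>"
    using d ab by (intro cos_monotone_0_pi_le) auto
  then have 1: "cos (b - a) - cos (f a) * cos (f b) \<le> sin (f a) * sin (f b)"
    by (simp add: cos_diff)
  have "cos (f a + f b) \<le> cos (b - a)"
  proof (cases "f a + f b \<le> pi")
    case True
    then show ?thesis using s ab by (intro cos_monotone_0_pi_le) auto
  next
    case False
    have "cos (2 * pi - (f a + f b)) \<le> cos (b - a)"
      using False s ab by (intro cos_monotone_0_pi_le) auto
    then show ?thesis by (simp add: cos_diff)
  qed
  then have 2: "- (sin (f a) * sin (f b)) \<le> cos (b - a) - cos (f a) * cos (f b)"
    by (simp add: cos_add)
  have "\<bar>cos (b - a) - cos (f a) * cos (f b)\<bar> \<le> \<bar>sin (f a) * sin (f b)\<bar>" using 1 2 by linarith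
  then have "(cos (b - a) - cos (f a) * cos (f b))\<^sup>2 \<le> (sin (f a) * sin (f b))\<^sup>2"
    by (simp add: abs_le_square_iff)
  moreover have "N = (sin (f a) * sin (f b))\<^sup>2 - (cos (b - a) - cos (f a) * cos (f b))\<^sup>2"
    unfolding N_def using sin_cos_squared_add[of "f a"] sin_cos_squared_add[of "f b"] by algebra
  ultimately show "0 \<le> N" by linarith
  have "N = (sin (b - a))\<^sup>2 - (sin (b - a))\<^sup>2 * (cos (f a))\<^sup>2 - (cos (f b) - cos (b - a) * cos (f a))\<^sup>2"
    unfolding N_def using sin_cos_squared_add[of "b - a"] by algebra
  then show "N \<le> (sin (b - a))\<^sup>2"
    using zero_le_power2[of "sin (b - a) * cos (f a)"] zero_le_power2[of "cos (f b) - cos (b - a) * cos (f a)"]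
    unfolding power_mult_distrib by linarith
qed

lemma ES1_continuous:
  assumes "f \<in> ES1"
  shows "continuous_on S f"
proof -
  have "1-lipschitz_on UNIV f"
    using assms by (auto simp: ES1_def lipschitz_on_def dist_real_def)
  then show ?thesis by (meson continuous_on_subset lipschitz_on_continuous_on subset_UNIV)
qed

lemma p_ab_measurable:
  assumes "f \<in> ES1"
  shows "(\<lambda>z. p_ab f (fst z) (snd z)) \<in> borel_measurable borel"
proof -
  note c = continuous_on_compose2[OF ES1_continuous[OF assms, of UNIV]]
  have "(\<lambda>z::real\<times>real. 1 - (cos (snd z - fst z))\<^sup>2 - (cos (f (fst z)))\<^sup>2 - (cos (f (snd z)))\<^sup>2 +
     2 * cos (snd z - fst z) * cos (f (fst z)) * cos (f (snd z))) \<in> borel_measurable borel"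
    "(\<lambda>z::real\<times>real. (sin (snd z - fst z))\<^sup>2 * (sin (f (fst z)))\<^sup>2 * (sin (f (snd z)))\<^sup>2) \<in> borel_measurable borel"
    by (intro borel_measurable_continuous_onI continuous_intros c subset_UNIV)+
  then show ?thesis unfolding p_ab_def by (rule borel_measurable_divide)
qed

text \<open>The Gram bound absorbs the factor sin (b - a)^2 of the denominator, so the kernel stays
  bounded up to the diagonal. Where this sine vanishes, division by zero makes the kernel 0.\<close>

lemma p_ab_bound:
  assumes f: "f \<in> ES1" and B: "\<And>a. 1 / B \<le> (sin (f a))\<^sup>2" "0 < B" and ab: "0 \<le> a" "a \<le> b" "b \<le> pi"
  shows "\<bar>p_ab f a b\<bar> \<le> B\<^sup>2"
proof (cases "sin (b - a) = 0")
  case False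
  let ?N = "1 - (cos (b - a))\<^sup>2 - (cos (f a))\<^sup>2 - (cos (f b))\<^sup>2 + 2 * cos (b - a) * cos (f a) * cos (f b)"
  have N: "0 \<le> ?N" "?N \<le> (sin (b - a))\<^sup>2" using ES1_gram_bounds[OF f, of a b] ab by auto
  have s: "0 < (sin (b - a))\<^sup>2" using False by simp
  have n: "0 < (sin (f a))\<^sup>2" "1 / (sin (f a))\<^sup>2 \<le> B" for a
  proof -
    have "0 < 1 / B" using B(2) by simp
    then show "0 < (sin (f a))\<^sup>2" using B(1)[of a] by linarith
    then show "1 / (sin (f a))\<^sup>2 \<le> B" using B(1)[of a] B(2) by (simp add: field_simps)
  qed
  have "p_ab f a b = (?N / (sin (b - a))\<^sup>2) * (1 / (sin (f a))\<^sup>2 * (1 / (sin (f b))\<^sup>2))"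
    unfolding p_ab_def by simp
  moreover have "\<bar>(?N / (sin (b - a))\<^sup>2) * (1 / (sin (f a))\<^sup>2 * (1 / (sin (f b))\<^sup>2))\<bar> \<le> 1 * (B * B)"
    using N s n by (intro abs_mult_le) (auto simp: divide_le_eq)
  ultimately show ?thesis by (simp add: power2_eq_square)
qed (simp add: p_ab_def)

lemma tri_adm_p_ab:
  assumes "f \<in> ES1" "\<And>a. 1 / B \<le> (sin (f a))\<^sup>2" "0 < B"
  shows "tri_adm (p_ab f)"
  by (rule tri_admI[where C="B\<^sup>2"]) (use p_ab_measurable p_ab_bound assms in auto)

section \<open>First variation of the kernel on the extremal pair\<close>

context hemi
begin

definition N :: "real \<Rightarrow> real" where "N a = 1 / sqrt (m a)"
text \<open>The cotangent of the distance to the boundary point \<open>a\<close>.\<close>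

definition F :: "real \<Rightarrow> real" where "F a = x0 a * N a"

text \<open>The part of the kernel perturbation linear in the error \<eta> of \<open>cos f\<close>,
  already multiplied by the bracket sin (\<phi> b - \<phi> a), which cancels the singular factor
  1/s. With h = \<eta> N^3 it splits into a multiple of \<open>h a\<close> and one of
  \<open>h b\<close>, so that the other variable can be integrated out.\<close>

definition lin_term :: "(real \<Rightarrow> real) \<Rightarrow> real \<Rightarrow> real \<Rightarrow> real" where
  "lin_term h a b = h a * (2 * D * (x1 b * N b ^ 3) + 2 * D ^ 3 * sin (b - a) * (x0 a * (N a)\<^sup>2) * N b ^ 3)
     + h b * (2 * D ^ 3 * sin (b - a) * (x0 b * (N b)\<^sup>2) * N a ^ 3 - 2 * D * (x1 a * N a ^ 3))"

lemma N_pos: "0 < N a" using m_pos[of a] by (simp add: N_def)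

lemma N_sq: "(N a)\<^sup>2 = 1 / m a" using m_pos[of a] by (simp add: N_def power_divide)

lemma sin_\<phi>_N: "sin (\<phi> b - \<phi> a) = D * sin (b - a) * N a * N b"
  by (simp add: sin_\<phi>_diff N_def)

lemma k_N: "k a = D * (N a)\<^sup>2" by (simp add: k_def N_sq)

lemma x_sq: "(x0 a)\<^sup>2 + (x1 a)\<^sup>2 = 1 - D\<^sup>2"
proof -
  have "(x0 a)\<^sup>2 + (x1 a)\<^sup>2 = A\<^sup>2" unfolding x0_def x1_def using sin_cos_squared_add[of "a - \<tau>"] by algebra
  then show ?thesis using AD by simp
qed

lemma continuous_N: "continuous_on S N"
  unfolding N_def using m_pos by (intro continuous_intros continuous_m) (metis less_irrefl real_sqrt_eq_zero_cancel_iff)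

lemma continuous_x: "continuous_on S x0" "continuous_on S x1"
  unfolding x0_def x1_def by (intro continuous_intros)+

lemma N_deriv: "(N has_real_derivative x0 a * x1 a * N a ^ 3) (at a)"
proof -
  have "(m has_real_derivative - 2 * x0 a * x1 a) (at a)"
    unfolding m_def x0_def x1_def by (auto intro!: derivative_eq_intros)
  from DERIV_chain2[OF DERIV_real_sqrt[OF m_pos] this]
  have "((\<lambda>a. sqrt (m a)) has_real_derivative inverse (sqrt (m a)) / 2 * (- 2 * x0 a * x1 a)) (at a)" .
  from DERIV_inverse_fun[OF this]
  have d: "((\<lambda>a. inverse (sqrt (m a))) has_real_derivative
     - (inverse (sqrt (m a)) / 2 * (- 2 * x0 a * x1 a) * inverse ((sqrt (m a))\<^sup>2))) (at a)"
    using m_pos[of a] by (simp add: power2_eq_square mult_ac)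
  have e: "- (inverse (sqrt (m a)) / 2 * (- 2 * x0 a * x1 a) * inverse ((sqrt (m a))\<^sup>2))
      = x0 a * x1 a * inverse (sqrt (m a)) ^ 3"
    unfolding power_inverse[symmetric] by algebra
  have "N = (\<lambda>a. inverse (sqrt (m a)))" by (simp add: N_def fun_eq_iff divide_inverse)
  then show ?thesis using d unfolding e by simp
qed

lemma F_deriv: "(F has_real_derivative x1 a * N a ^ 3) (at a)"
proof -
  have "(x0 has_real_derivative x1 a) (at a)"
    unfolding x0_def x1_def by (auto intro!: derivative_eq_intros)
  from DERIV_mult[OF this N_deriv]
  have "(F has_real_derivative x1 a * N a + x0 a * x1 a * N a ^ 3 * x0 a) (at a)"
    unfolding F_def by simp
  moreover have "x1 a * N a + x0 a * x1 a * N a ^ 3 * x0 a = x1 a * N a ^ 3"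
  proof -
    have "m a * (N a)\<^sup>2 = 1" using N_sq m_pos[of a] by simp
    then have "(1 - (x0 a)\<^sup>2) * (N a)\<^sup>2 = 1" by (simp add: m_def)
    then show ?thesis by algebra
  qed
  ultimately show ?thesis by simp
qed

lemma F_pi: "F pi = - F 0"
  by (simp add: F_def N_def m_def x0_def cos_diff)

text \<open>Both summands are exact derivatives in \<open>b\<close>: the first of a multiple of
  \<open>F\<close>, the second of a multiple of cos (\<phi> b - \<phi> a), since sin (\<phi> b -
  \<phi> a) times \<open>k b\<close> has just this form.\<close>

lemma row_coefficient:
  assumes "a \<in> {0..pi}"
  shows "integral {a..pi} (\<lambda>b. 2 * D * (x1 b * N b ^ 3) + 2 * D ^ 3 * sin (b - a) * (x0 a * (N a)\<^sup>2) * N b ^ 3)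
    = 2 * D * (F pi - F a) + 2 * D * F a * (1 - cos (\<phi> pi - \<phi> a))"
proof (rule integral_unique)
  let ?g = "\<lambda>b. 2 * D * F b - 2 * D * F a * cos (\<phi> b - \<phi> a)"
  have "((\<lambda>b. 2 * D * (x1 b * N b ^ 3) + 2 * D ^ 3 * sin (b - a) * (x0 a * (N a)\<^sup>2) * N b ^ 3)
     has_integral (?g pi - ?g a)) {a..pi}"
  proof (rule fundamental_theorem_of_calculus)
    fix b
    have "(?g has_real_derivative 2 * D * (x1 b * N b ^ 3) + 2 * D * F a * (sin (\<phi> b - \<phi> a) * k b)) (at b within {a..pi})"
      by (rule derivative_eq_intros has_field_derivative_at_within[OF F_deriv]
        has_field_derivative_at_within[OF \<phi>_deriv] refl | simp)+
    also have "2 * D * F a * (sin (\<phi> b - \<phi> a) * k b) = 2 * D ^ 3 * sin (b - a) * (x0 a * (N a)\<^sup>2) * N b ^ 3"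
      unfolding sin_\<phi>_N k_N F_def by (simp add: power2_eq_square power3_eq_cube mult_ac)
    finally show "(?g has_vector_derivative 2 * D * (x1 b * N b ^ 3) + 2 * D ^ 3 * sin (b - a) * (x0 a * (N a)\<^sup>2) * N b ^ 3)
      (at b within {a..pi})" unfolding has_real_derivative_iff_has_vector_derivative .
  qed (use assms in auto)
  then show "((\<lambda>b. 2 * D * (x1 b * N b ^ 3) + 2 * D ^ 3 * sin (b - a) * (x0 a * (N a)\<^sup>2) * N b ^ 3)
     has_integral (2 * D * (F pi - F a) + 2 * D * F a * (1 - cos (\<phi> pi - \<phi> a)))) {a..pi}"
    by (simp add: algebra_simps)
qed

lemma column_coefficient:
  assumes "b \<in> {0..pi}"
  shows "integral {0..b} (\<lambda>a. 2 * D ^ 3 * sin (b - a) * (x0 b * (N b)\<^sup>2) * N a ^ 3 - 2 * D * (x1 a * N a ^ 3))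
    = 2 * D * F b * (1 - cos (\<phi> b - \<phi> 0)) - 2 * D * (F b - F 0)"
proof (rule integral_unique)
  let ?g = "\<lambda>a. 2 * D * F b * cos (\<phi> b - \<phi> a) - 2 * D * F a"
  have "((\<lambda>a. 2 * D ^ 3 * sin (b - a) * (x0 b * (N b)\<^sup>2) * N a ^ 3 - 2 * D * (x1 a * N a ^ 3))
     has_integral (?g b - ?g 0)) {0..b}"
  proof (rule fundamental_theorem_of_calculus)
    fix a
    have "(?g has_real_derivative 2 * D * F b * (sin (\<phi> b - \<phi> a) * k a) - 2 * D * (x1 a * N a ^ 3)) (at a within {0..b})"
      by (rule derivative_eq_intros has_field_derivative_at_within[OF F_deriv]
        has_field_derivative_at_within[OF \<phi>_deriv] refl | simp)+
    also have "2 * D * F b * (sin (\<phi> b - \<phi> a) * k a) = 2 * D ^ 3 * sin (b - a) * (x0 b * (N b)\<^sup>2) * N a ^ 3"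
      unfolding sin_\<phi>_N k_N F_def by (simp add: power2_eq_square power3_eq_cube mult_ac)
    finally show "(?g has_vector_derivative 2 * D ^ 3 * sin (b - a) * (x0 b * (N b)\<^sup>2) * N a ^ 3 - 2 * D * (x1 a * N a ^ 3))
      (at a within {0..b})" unfolding has_real_derivative_iff_has_vector_derivative .
  qed (use assms in auto)
  then show "((\<lambda>a. 2 * D ^ 3 * sin (b - a) * (x0 b * (N b)\<^sup>2) * N a ^ 3 - 2 * D * (x1 a * N a ^ 3))
     has_integral (2 * D * F b * (1 - cos (\<phi> b - \<phi> 0)) - 2 * D * (F b - F 0))) {0..b}"
    by (simp add: algebra_simps)
qed

lemma tri_adm_lin_term_parts:
  assumes "continuous_on UNIV h"
  shows "tri_adm (\<lambda>a b. h a * (2 * D * (x1 b * N b ^ 3) + 2 * D ^ 3 * sin (b - a) * (x0 a * (N a)\<^sup>2) * N b ^ 3))"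
    "tri_adm (\<lambda>a b. h b * (2 * D ^ 3 * sin (b - a) * (x0 b * (N b)\<^sup>2) * N a ^ 3 - 2 * D * (x1 a * N a ^ 3)))"
  by (intro tri_adm_continuous continuous_intros continuous_on_compose2[OF assms]
      continuous_on_compose2[OF continuous_N[of UNIV]] continuous_on_compose2[OF continuous_x(1)[of UNIV]]
      continuous_on_compose2[OF continuous_x(2)[of UNIV]] subset_UNIV)+

lemma tri_adm_lin_term: "continuous_on UNIV h \<Longrightarrow> tri_adm (lin_term h)"
  unfolding lin_term_def by (intro tri_adm_add tri_adm_lin_term_parts)

text \<open>The first variation of the kernel vanishes on the extremal pair: the two coefficients
  of \<open>h t\<close> cancel by antiperiodicity.\<close>

lemma tri_lin_term:
  assumes h: "continuous_on UNIV h"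
  shows "tri (lin_term h) = 0"
proof -
  have hS: "continuous_on S h" for S using h continuous_on_subset by blast
  let ?A = "\<lambda>a b. 2 * D * (x1 b * N b ^ 3) + 2 * D ^ 3 * sin (b - a) * (x0 a * (N a)\<^sup>2) * N b ^ 3"
  let ?B = "\<lambda>a b. 2 * D ^ 3 * sin (b - a) * (x0 b * (N b)\<^sup>2) * N a ^ 3 - 2 * D * (x1 a * N a ^ 3)"
  let ?a = "\<lambda>a. 2 * D * (F pi - F a) + 2 * D * F a * (1 - cos (\<phi> pi - \<phi> a))"
  let ?b = "\<lambda>b. 2 * D * F b * (1 - cos (\<phi> b - \<phi> 0)) - 2 * D * (F b - F 0)"
  have cF: "continuous_on S F" for S unfolding F_def by (intro continuous_intros continuous_x continuous_N)
  have A: "tri (\<lambda>a b. h a * ?A a b) = integral {0..pi} (\<lambda>a. h a * ?a a)"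
  proof -
    have "tri (\<lambda>a b. h a * ?A a b) = (LINT a:{0..pi}|lborel. h a * (LINT b:{a..pi}|lborel. ?A a b))"
      unfolding tri_iterated[OF tri_adm_lin_term_parts(1)[OF h]] by simp
    also have "\<dots> = (LINT a:{0..pi}|lborel. h a * ?a a)"
    proof (rule set_lebesgue_integral_cong, simp, intro allI impI)
      fix a assume a: "a \<in> {0..pi}"
      have "(LINT b:{a..pi}|lborel. ?A a b) = integral {a..pi} (?A a)"
        by (intro set_lint_continuous continuous_intros continuous_x continuous_N)
      then show "h a * (LINT b:{a..pi}|lborel. ?A a b) = h a * ?a a"
        unfolding row_coefficient[OF a] by simp
    qed
    also have "\<dots> = integral {0..pi} (\<lambda>a. h a * ?a a)"
      by (intro set_lint_continuous continuous_intros hS cF continuous_\<phi>)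
    finally show ?thesis .
  qed
  have B: "tri (\<lambda>a b. h b * ?B a b) = integral {0..pi} (\<lambda>b. h b * ?b b)"
  proof -
    have "tri (\<lambda>a b. h b * ?B a b) = (LINT b:{0..pi}|lborel. h b * (LINT a:{0..b}|lborel. ?B a b))"
      unfolding tri_swapped[OF tri_adm_lin_term_parts(2)[OF h]] by simp
    also have "\<dots> = (LINT b:{0..pi}|lborel. h b * ?b b)"
    proof (rule set_lebesgue_integral_cong, simp, intro allI impI)
      fix b assume b: "b \<in> {0..pi}"
      have "(LINT a:{0..b}|lborel. ?B a b) = integral {0..b} (\<lambda>a. ?B a b)"
        by (intro set_lint_continuous continuous_intros continuous_x continuous_N)
      then show "h b * (LINT a:{0..b}|lborel. ?B a b) = h b * ?b b"
        unfolding column_coefficient[OF b] by simp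
    qed
    also have "\<dots> = integral {0..pi} (\<lambda>b. h b * ?b b)"
      by (intro set_lint_continuous continuous_intros hS cF continuous_\<phi>)
    finally show ?thesis .
  qed
  have "tri (lin_term h) = tri (\<lambda>a b. h a * ?A a b) + tri (\<lambda>a b. h b * ?B a b)"
    unfolding lin_term_def by (intro tri_add tri_adm_lin_term_parts h)
  also have "\<dots> = integral {0..pi} (\<lambda>t. h t * ?a t + h t * ?b t)"
    unfolding A B
    by (intro Henstock_Kurzweil_Integration.integral_add[symmetric] integrable_continuous_interval
      continuous_intros hS cF continuous_\<phi>)
  also have "\<dots> = integral {0..pi} (\<lambda>t. 0)"
  proof (rule arg_cong[where f="integral _"], rule ext)
    fix t
    have "\<phi> pi - \<phi> t = - (\<phi> t - \<phi> 0) + pi" by (simp add: \<phi>_pi)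
    then have "cos (\<phi> pi - \<phi> t) = - cos (\<phi> t - \<phi> 0)" by (simp only: cos_periodic_pi cos_minus)
    then have "?a t + ?b t = 0" by (simp add: F_pi algebra_simps)
    then show "h t * ?a t + h t * ?b t = 0" by (simp only: distrib_left[symmetric])
  qed
  finally show ?thesis by simp
qed

end

text \<open>The error is measured in the cosines, as these are what the kernel contains. The one
  number \<open>\<sigma>\<close> bounds both the height \<open>D\<close> and the modulus of sin f
  from below, so that the estimates depend on the point and on \<open>f\<close> through its inverse
  \<open>\<beta>\<close> only.\<close>

locale near_hemi = hemi +
  fixes f :: "real \<Rightarrow> real" and \<delta> \<sigma> :: real
  assumes f: "f \<in> ES1" and \<delta>: "0 < \<delta>" and \<sigma>: "0 < \<sigma>" "\<sigma> \<le> D"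
    and near: "\<And>a. \<bar>cos (f a) - x0 a\<bar> \<le> \<delta>"
    and nondeg: "\<And>a. \<sigma>\<^sup>2 \<le> (sin (f a))\<^sup>2"
begin

definition \<beta> :: real where "\<beta> = 1 / \<sigma>"
definition \<eta> :: "real \<Rightarrow> real" where "\<eta> a = cos (f a) - x0 a"
definition h :: "real \<Rightarrow> real" where "h a = \<eta> a * N a ^ 3"
definition K :: "real \<Rightarrow> real \<Rightarrow> real" where "K a b = p_ab f a b - k a * k b"

lemma \<beta>: "1 \<le> \<beta>" "1 / \<beta>\<^sup>2 = \<sigma>\<^sup>2" "0 < \<beta>"
  using \<sigma> D1 by (auto simp: \<beta>_def power_divide)

lemma \<eta>_bound: "\<bar>\<eta> a\<bar> \<le> \<delta>" using near by (simp add: \<eta>_def)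

lemma continuous_f: "continuous_on S f" by (rule ES1_continuous[OF f])

lemma continuous_h: "continuous_on S h"
  unfolding h_def \<eta>_def by (intro continuous_intros continuous_f continuous_x continuous_N)

lemma N_bound: "\<bar>N a\<bar> \<le> \<beta>" "(N a)\<^sup>2 \<le> \<beta>\<^sup>2"
proof -
  have "\<sigma>\<^sup>2 \<le> m a" using m_ge[of a] \<sigma> by (meson order_trans power_mono less_imp_le)
  moreover have "0 < \<sigma>\<^sup>2" using \<sigma> by simp
  ultimately have "1 / m a \<le> 1 / \<sigma>\<^sup>2"
    using m_pos[of a] by (intro divide_left_mono mult_pos_pos) auto
  then show 2: "(N a)\<^sup>2 \<le> \<beta>\<^sup>2" by (simp add: N_sq \<beta>_def power_divide)
  then show "\<bar>N a\<bar> \<le> \<beta>" using N_pos[of a] \<beta>(3) by (simp add: power2_le_iff_abs_le)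
qed

lemma x_bound: "\<bar>x0 a\<bar> \<le> 1" "\<bar>x1 a\<bar> \<le> 1"
proof -
  have "(x0 a)\<^sup>2 \<le> 1" "(x1 a)\<^sup>2 \<le> 1"
    using x_sq[of a] zero_le_power2[of D] zero_le_power2[of "x0 a"] zero_le_power2[of "x1 a"] by linarith+
  then show "\<bar>x0 a\<bar> \<le> 1" "\<bar>x1 a\<bar> \<le> 1" by (simp_all add: abs_square_le_1)
qed

lemma lin_term_bound: "\<bar>lin_term h a b\<bar> \<le> 8 * \<beta> ^ 8 * \<delta>"
proof -
  have D: "\<bar>2 * D\<bar> \<le> 2" "\<bar>2 * D ^ 3\<bar> \<le> 2" using D0 D1 by (auto simp: power_le_one)
  have N3: "\<bar>N a ^ 3\<bar> \<le> \<beta> ^ 3" for a unfolding power_abs by (intro power_mono N_bound) simp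
  have N2: "\<bar>(N a)\<^sup>2\<bar> \<le> \<beta>\<^sup>2" for a using N_bound(2) by simp
  have hb: "\<bar>h a\<bar> \<le> \<delta> * \<beta> ^ 3" for a unfolding h_def by (intro abs_mult_le \<eta>_bound N3)
  have "\<bar>lin_term h a b\<bar> \<le> \<delta> * \<beta> ^ 3 * (2 * (1 * \<beta> ^ 3) + 2 * 1 * (1 * \<beta>\<^sup>2) * \<beta> ^ 3)
     + \<delta> * \<beta> ^ 3 * (2 * 1 * (1 * \<beta>\<^sup>2) * \<beta> ^ 3 + 2 * (1 * \<beta> ^ 3))"
    unfolding lin_term_def diff_conv_add_uminus[of _ "2 * D * _"] mult_minus_right[symmetric]
    using x_bound by (intro abs_add_le abs_mult_le hb D N3 N2 abs_sin_le_one) (auto simp: N3)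
  also have "\<dots> = 4 * (\<beta> ^ 6 * \<delta>) + 4 * (\<beta> ^ 8 * \<delta>)"
    by (simp add: algebra_simps power_add[symmetric])
  also have "\<dots> \<le> 4 * (\<beta> ^ 8 * \<delta>) + 4 * (\<beta> ^ 8 * \<delta>)"
    using \<beta>(1) \<delta> by (intro add_right_mono mult_left_mono mult_right_mono power_increasing) auto
  finally show ?thesis by (simp add: mult_ac)
qed

lemma p_bound:
  assumes "0 \<le> a" "a \<le> b" "b \<le> pi"
  shows "\<bar>p_ab f a b\<bar> \<le> \<beta> ^ 4"
  using p_ab_bound[OF f _ _ assms, of "\<beta>\<^sup>2"] nondeg \<beta> by (simp add: power_mult[symmetric])

lemma k_bound: "\<bar>k a\<bar> \<le> \<beta>\<^sup>2"
proof -
  have "\<bar>D * (N a)\<^sup>2\<bar> \<le> 1 * \<beta>\<^sup>2" by (intro abs_mult_le) (use D0 D1 N_bound in auto)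
  then show ?thesis by (simp add: k_N)
qed

lemma K_crude:
  assumes "0 \<le> a" "a \<le> b" "b \<le> pi"
  shows "\<bar>K a b\<bar> \<le> 2 * \<beta> ^ 4"
proof -
  have "\<bar>k a * k b\<bar> \<le> \<beta>\<^sup>2 * \<beta>\<^sup>2" by (intro abs_mult_le k_bound)
  then have "\<bar>k a * k b\<bar> \<le> \<beta> ^ 4" by (simp add: power_add[symmetric])
  then show ?thesis using p_bound[OF assms] unfolding K_def by linarith
qed

lemma sin_\<phi>_bound:
  assumes "0 \<le> sin (b - a)"
  shows "\<bar>sin (\<phi> b - \<phi> a)\<bar> \<le> \<beta>\<^sup>2 * sin (b - a)"
proof -
  have "\<bar>D * sin (b - a) * N a * N b\<bar> \<le> 1 * sin (b - a) * \<beta> * \<beta>"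
    by (intro abs_mult_le N_bound) (use D0 D1 assms in auto)
  then show ?thesis by (simp add: sin_\<phi>_N power2_eq_square mult_ac)
qed

text \<open>The bracket sin (\<phi> b - \<phi> a) is of order s, and z s = \<delta>; multiplication
  by it therefore turns the remainder of order z^2 into one of order \<delta> z. The powers of
  \<open>\<beta>\<close> come from using \<open>kernel_expansion\<close> with B = \<beta>^2, and 42
  = 34 + 8.\<close>

lemma kernel_far:
  assumes s: "\<delta> < sin (b - a)"
    and ab: "0 \<le> a" "a \<le> b" "b \<le> pi"
  defines "z \<equiv> \<delta> / sin (b - a)"
  shows "\<bar>K a b\<bar> \<le> 42 * \<beta> ^ 8 * z"
    "\<bar>K a b * sin (\<phi> b - \<phi> a) - lin_term h a b\<bar> \<le> 34 * \<beta> ^ 10 * \<delta> * z"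
proof -
  let ?s = "sin (b - a)" and ?c = "cos (b - a)"
  have s0: "0 < ?s" using s \<delta> by linarith
  have sc: "?s\<^sup>2 + ?c\<^sup>2 = 1" by simp
  have z: "0 < z" "z < 1" using s \<delta> s0 by (auto simp: z_def)
  have \<delta>z: "\<delta> \<le> z" unfolding z_def using s0 \<delta> sin_le_one[of "b - a"] by (simp add: pos_le_divide_eq mult_left_le)
  have tb: "b - \<tau> = (a - \<tau>) + (b - a)" by simp
  have u': "x0 b = x0 a * ?c + x1 a * ?s" and u1': "x1 b = - x0 a * ?s + x1 a * ?c"
    unfolding x0_def x1_def tb cos_add sin_add by (simp_all add: algebra_simps)
  let ?x = "\<lambda>a. cos (f a)"
  let ?n = "\<lambda>a. 1 / (1 - (?x a)\<^sup>2)" and ?nz = "\<lambda>a. 1 / (1 - (x0 a)\<^sup>2)"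
  let ?t = "\<lambda>a. 2 * x0 a * \<eta> a * (?nz a)\<^sup>2"
  let ?L = "(\<eta> b * x1 a - \<eta> a * x1 b) / ?s"
  let ?Q = "((\<eta> a)\<^sup>2 + (\<eta> b)\<^sup>2 - 2 * ?c * \<eta> a * \<eta> b) / ?s\<^sup>2"
  have n0: "?nz a = (N a)\<^sup>2" for a by (simp add: N_sq m_def)
  have sinf: "(sin (f a))\<^sup>2 = 1 - (?x a)\<^sup>2" for a by (simp add: sin_squared_eq)
  have P: "p_ab f a b = (D\<^sup>2 - 2 * ?L - ?Q) * (?n a * ?n b)"
  proof -
    have "1 - ((?x a)\<^sup>2 + (?x b)\<^sup>2 - 2 * ?c * ?x a * ?x b) / ?s\<^sup>2 = D\<^sup>2 - 2 * ?L - ?Q"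
      using gram_expansion[OF _ sc u' u1' x_sq, of "\<eta> a" "\<eta> b"] s0 by (simp add: \<eta>_def)
    moreover have "p_ab f a b = (1 - ((?x a)\<^sup>2 + (?x b)\<^sup>2 - 2 * ?c * ?x a * ?x b) / ?s\<^sup>2) * (?n a * ?n b)"
    proof -
      have "1 - e / ?s\<^sup>2 = (?s\<^sup>2 - e) / ?s\<^sup>2" for e using s0 by (simp add: diff_divide_distrib)
      then have "(1 - ((?x a)\<^sup>2 + (?x b)\<^sup>2 - 2 * ?c * ?x a * ?x b) / ?s\<^sup>2) * (?n a * ?n b)
        = (?s\<^sup>2 - ((?x a)\<^sup>2 + (?x b)\<^sup>2 - 2 * ?c * ?x a * ?x b)) / (?s\<^sup>2 * (1 - (?x a)\<^sup>2) * (1 - (?x b)\<^sup>2))"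
        by simp
      moreover have "?s\<^sup>2 - ((?x a)\<^sup>2 + (?x b)\<^sup>2 - 2 * ?c * ?x a * ?x b)
        = 1 - ?c\<^sup>2 - (?x a)\<^sup>2 - (?x b)\<^sup>2 + 2 * ?c * ?x a * ?x b"
        using sc by linarith
      ultimately show ?thesis unfolding p_ab_def sinf by simp
    qed
    ultimately show ?thesis by simp
  qed
  have B: "1 \<le> \<beta>\<^sup>2" using \<beta>(1) by simp
  have ie: "\<bar>?n a\<bar> \<le> \<beta>\<^sup>2" "\<bar>?nz a\<bar> \<le> \<beta>\<^sup>2" "\<bar>?n a - ?nz a\<bar> \<le> 2 * \<delta> * (\<beta>\<^sup>2)\<^sup>2"
    "\<bar>?n a - ?nz a - ?t a\<bar> \<le> 5 * (\<beta>\<^sup>2) ^ 3 * \<delta>\<^sup>2" for a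
  proof -
    have "\<sigma>\<^sup>2 \<le> D\<^sup>2" using \<sigma> by (intro power_mono) auto
    then have *: "1 / \<beta>\<^sup>2 \<le> 1 - (x0 a)\<^sup>2" "1 / \<beta>\<^sup>2 \<le> 1 - (?x a)\<^sup>2"
      using m_ge[of a] nondeg[of a] by (auto simp: \<beta>(2) m_def sinf)
    show "\<bar>?n a\<bar> \<le> \<beta>\<^sup>2" "\<bar>?nz a\<bar> \<le> \<beta>\<^sup>2" "\<bar>?n a - ?nz a\<bar> \<le> 2 * \<delta> * (\<beta>\<^sup>2)\<^sup>2"
      "\<bar>?n a - ?nz a - ?t a\<bar> \<le> 5 * (\<beta>\<^sup>2) ^ 3 * \<delta>\<^sup>2"
      using inverse_expansion[OF x_bound(1) *(1) _ *(2) B near] by (simp_all add: \<eta>_def)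
  qed
  have tB: "\<bar>?t a\<bar> \<le> 2 * \<delta> * (\<beta>\<^sup>2)\<^sup>2" for a
  proof -
    have "\<bar>(?nz a)\<^sup>2\<bar> \<le> (\<beta>\<^sup>2)\<^sup>2" unfolding power_abs by (intro power_mono ie) simp
    then have "\<bar>2 * x0 a * \<eta> a * (?nz a)\<^sup>2\<bar> \<le> 2 * 1 * \<delta> * (\<beta>\<^sup>2)\<^sup>2"
      by (intro abs_mult_le \<eta>_bound x_bound) simp_all
    then show ?thesis by simp
  qed
  have Lb: "\<bar>?L\<bar> \<le> 2 * z"
  proof -
    have "\<bar>\<eta> b * x1 a + (- \<eta> a) * x1 b\<bar> \<le> \<delta> * 1 + \<delta> * 1"
      using x_bound \<eta>_bound by (intro abs_add_le abs_mult_le) auto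
    then show ?thesis using s0 by (simp add: z_def divide_right_mono)
  qed
  have Qb: "\<bar>?Q\<bar> \<le> 4 * z\<^sup>2"
  proof -
    have "\<bar>\<eta> a * \<eta> a + \<eta> b * \<eta> b + (- 2 * ?c) * \<eta> a * \<eta> b\<bar> \<le> \<delta> * \<delta> + \<delta> * \<delta> + 2 * \<delta> * \<delta>"
      by (intro abs_add_le abs_mult_le \<eta>_bound) (auto simp: abs_mult)
    then have "\<bar>(\<eta> a)\<^sup>2 + (\<eta> b)\<^sup>2 - 2 * ?c * \<eta> a * \<eta> b\<bar> \<le> 4 * \<delta>\<^sup>2"
      by (simp add: power2_eq_square)
    then show ?thesis using s0 by (simp add: z_def power_divide divide_right_mono)
  qed
  have D: "\<bar>D\<bar> \<le> 1" using D0 D1 by simp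
  note ke = kernel_expansion[OF D B less_imp_le[OF \<delta>] \<delta>z Lb Qb ie ie tB tB, of a b]
  define LL where "LL = D\<^sup>2 * (?t a * ?nz b + ?nz a * ?t b) - 2 * ?L * (?nz a * ?nz b)"
  have Kd: "K a b = (D\<^sup>2 - 2 * ?L - ?Q) * (?n a * ?n b) - D\<^sup>2 * (?nz a * ?nz b)"
    unfolding K_def P k_N n0 by (simp add: power2_eq_square mult_ac)
  have pw: "(\<beta>\<^sup>2) ^ 4 = \<beta> ^ 8" "(\<beta>\<^sup>2) ^ 3 = \<beta> ^ 6" by (simp_all add: power_mult[symmetric])
  have k1: "\<bar>K a b - LL\<bar> \<le> 34 * \<beta> ^ 8 * z\<^sup>2" and k2: "\<bar>LL\<bar> \<le> 8 * \<beta> ^ 6 * z"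
    using ke unfolding Kd LL_def pw by simp_all
  show "\<bar>K a b\<bar> \<le> 42 * \<beta> ^ 8 * z"
  proof -
    have "34 * \<beta> ^ 8 * z\<^sup>2 \<le> 34 * \<beta> ^ 8 * z"
      using z \<beta> by (intro mult_left_mono) (auto simp: power2_eq_square)
    moreover have "8 * \<beta> ^ 6 * z \<le> 8 * \<beta> ^ 8 * z"
      using z \<beta> by (intro mult_right_mono mult_left_mono power_increasing) auto
    ultimately show ?thesis using k1 k2 by linarith
  qed
  \<comment> \<open>The only singular term is \<open>?L\<close>, and the bracket supplies the factor
    s that cancels its denominator.\<close>
  have lin: "LL * sin (\<phi> b - \<phi> a) = lin_term h a b"
  proof -
    have "?L * ?s = \<eta> b * x1 a - \<eta> a * x1 b" using s0 by simp
    then show ?thesis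
      unfolding LL_def lin_term_def h_def n0 sin_\<phi>_N by algebra
  qed
  have "\<bar>(K a b - LL) * sin (\<phi> b - \<phi> a)\<bar> \<le> (34 * \<beta> ^ 8 * z\<^sup>2) * (\<beta>\<^sup>2 * ?s)"
    using k1 sin_\<phi>_bound s0 by (intro abs_mult_le) auto
  also have "\<dots> = 34 * \<beta> ^ 10 * (z * ?s) * z"
    by (simp add: power2_eq_square power_add[symmetric] algebra_simps eval_nat_numeral)
  also have "z * ?s = \<delta>" using s0 by (simp add: z_def)
  finally show "\<bar>K a b * sin (\<phi> b - \<phi> a) - lin_term h a b\<bar> \<le> 34 * \<beta> ^ 10 * \<delta> * z"
    unfolding left_diff_distrib lin .
qed

text \<open>Where s \<le> \<delta> the expansion says nothing, and boundedness of both kernels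
  matches the value 1 of \<open>kap\<close>; elsewhere \<delta>/s is at most
  \<open>kap\<close>.\<close>

lemma K_bound:
  assumes \<theta>: "0 < \<theta>" "\<theta> \<le> 1" and ab: "0 \<le> a" "a \<le> b" "b \<le> pi"
  shows "\<bar>K a b\<bar> \<le> 42 * \<beta> ^ 8 * kap \<theta> \<delta> (sin (b - a))"
proof (cases "sin (b - a) \<le> \<delta>")
  case True
  have "2 * \<beta> ^ 4 \<le> 42 * \<beta> ^ 8"
    using \<beta> by (intro mult_mono power_increasing) auto
  then show ?thesis using K_crude[OF ab] True by (simp add: kap_def)
next
  case False
  then have "42 * \<beta> ^ 8 * (\<delta> / sin (b - a)) \<le> 42 * \<beta> ^ 8 * kap \<theta> \<delta> (sin (b - a))"
    using \<beta> \<delta> \<theta> by (intro mult_left_mono kap_ge) auto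
  then show ?thesis using kernel_far(1)[OF _ ab] False by linarith
qed

text \<open>Where s \<le> \<delta>, a bounded kernel times a bracket of order \<delta> is of order
  \<delta>, and so is \<open>lin_term h\<close>; no cancellation between them is needed
  there.\<close>

lemma K_sin_bound:
  assumes \<theta>: "0 < \<theta>" "\<theta> \<le> 1" and ab: "0 \<le> a" "a \<le> b" "b \<le> pi"
  shows "\<bar>K a b * sin (\<phi> b - \<phi> a) - lin_term h a b\<bar> \<le> 34 * \<beta> ^ 10 * \<delta> * kap \<theta> \<delta> (sin (b - a))"
proof (cases "sin (b - a) \<le> \<delta>")
  case True
  have s: "0 \<le> sin (b - a)" using ab by (intro sin_ge_zero) auto
  have "\<bar>K a b * sin (\<phi> b - \<phi> a)\<bar> \<le> 2 * \<beta> ^ 4 * (\<beta>\<^sup>2 * \<delta>)"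
  proof (intro abs_mult_le K_crude ab)
    show "\<bar>sin (\<phi> b - \<phi> a)\<bar> \<le> \<beta>\<^sup>2 * \<delta>"
      by (rule order_trans[OF sin_\<phi>_bound[OF s]]) (use True in \<open>simp add: mult_left_mono\<close>)
  qed
  then have "\<bar>K a b * sin (\<phi> b - \<phi> a)\<bar> \<le> 2 * (\<beta> ^ 6 * \<delta>)"
    by (simp add: mult_ac power_add[symmetric])
  moreover have "\<beta> ^ 6 * \<delta> \<le> \<beta> ^ 10 * \<delta>" "\<beta> ^ 8 * \<delta> \<le> \<beta> ^ 10 * \<delta>" "0 \<le> \<beta> ^ 10 * \<delta>"
    using \<beta> \<delta> by (auto intro!: mult_right_mono power_increasing)
  ultimately have "\<bar>K a b * sin (\<phi> b - \<phi> a) - lin_term h a b\<bar> \<le> 34 * \<beta> ^ 10 * \<delta>"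
    using lin_term_bound[of a b] by (simp only: mult.assoc)
  then show ?thesis using True by (simp add: kap_def)
next
  case False
  then have "34 * \<beta> ^ 10 * \<delta> * (\<delta> / sin (b - a)) \<le> 34 * \<beta> ^ 10 * \<delta> * kap \<theta> \<delta> (sin (b - a))"
    using \<beta> \<delta> \<theta> by (intro mult_left_mono kap_ge) auto
  then show ?thesis using kernel_far(2)[OF _ ab] False by linarith
qed

section \<open>Integrals of the perturbed kernel on the extremal pair\<close>

lemma tri_adm_p: "tri_adm (p_ab f)"
  by (rule tri_adm_p_ab[OF f, of "\<beta>\<^sup>2"]) (use nondeg \<beta> in auto)

lemma tri_adm_kk: "tri_adm (\<lambda>a b. k a * k b)"
  by (intro tri_adm_continuous continuous_intros continuous_on_compose2[OF continuous_k[of UNIV]] subset_UNIV)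

lemma tri_adm_K: "tri_adm K"
  unfolding K_def by (intro tri_adm_diff tri_adm_p tri_adm_kk)

lemma tri_adm_sin: "tri_adm (\<lambda>a b. sin (\<phi> b - \<phi> a))"
  by (intro tri_adm_continuous continuous_intros continuous_on_compose2[OF continuous_\<phi>[of UNIV]] subset_UNIV)

text \<open>Subtracting \<open>lin_term h\<close> leaves the integral unchanged, and makes the
  integrand of order \<delta> times \<open>kap\<close>.\<close>

lemma tri_K_sin:
  assumes \<theta>: "0 < \<theta>" "\<theta> < 1"
  shows "\<bar>tri (\<lambda>a b. K a b * sin (\<phi> b - \<phi> a))\<bar> \<le> 34 * \<beta> ^ 10 * pi * kap_const \<theta> * \<delta> powr (1 + \<theta>)"
proof -
  have aKs: "tri_adm (\<lambda>a b. K a b * sin (\<phi> b - \<phi> a))"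
    by (intro tri_adm_mult tri_adm_K tri_adm_sin)
  have al: "tri_adm (lin_term h)" by (rule tri_adm_lin_term[OF continuous_h])
  have "tri (\<lambda>a b. K a b * sin (\<phi> b - \<phi> a)) = tri (\<lambda>a b. K a b * sin (\<phi> b - \<phi> a) - lin_term h a b)"
    using tri_diff[OF aKs al] tri_lin_term[OF continuous_h] by simp
  moreover have "\<bar>tri (\<lambda>a b. K a b * sin (\<phi> b - \<phi> a) - lin_term h a b)\<bar>
     \<le> tri (\<lambda>a b. 34 * \<beta> ^ 10 * \<delta> * kap \<theta> \<delta> (sin (b - a)))"
  proof (rule tri_abs_le)
    show "tri_adm (\<lambda>a b. 34 * \<beta> ^ 10 * \<delta> * kap \<theta> \<delta> (sin (b - a)))"
      by (rule tri_adm_mult[OF tri_adm_const tri_adm_kap[OF \<theta>(1) \<delta>]])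
  qed (use \<theta> K_sin_bound tri_adm_diff[OF aKs al] in auto)
  moreover have "tri (\<lambda>a b. 34 * \<beta> ^ 10 * \<delta> * kap \<theta> \<delta> (sin (b - a))) \<le> 34 * \<beta> ^ 10 * \<delta> * (pi * kap_const \<theta> * \<delta> powr \<theta>)"
    unfolding tri_cmult using \<beta> \<delta> by (intro mult_left_mono tri_kap \<theta>) auto
  moreover have "34 * \<beta> ^ 10 * \<delta> * (pi * kap_const \<theta> * \<delta> powr \<theta>) = 34 * \<beta> ^ 10 * pi * kap_const \<theta> * \<delta> powr (1 + \<theta>)"
    using \<delta> by (simp add: powr_add mult_ac)
  ultimately show ?thesis by linarith
qed

text \<open>The primitives of the extremal pair with respect to \<open>\<phi>\<close> trace half of
  a unit circle, and the enclosed area is pi.\<close>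

lemma tri_kk_sin: "tri (\<lambda>a b. k a * k b * sin (\<phi> b - \<phi> a)) = pi"
proof -
  have "tri (\<lambda>a b. k a * k b * sin (\<phi> b - \<phi> a)) =
      (LINT a:{0..pi}|lborel. LINT b:{a..pi}|lborel. k a * k b * sin (\<phi> b - \<phi> a))"
    by (rule tri_iterated[OF tri_adm_mult[OF tri_adm_kk tri_adm_sin]])
  also have "\<dots> = (LINT a:{0..pi}|lborel. k a * (1 - cos (\<phi> pi - \<phi> a)))"
  proof (rule set_lebesgue_integral_cong, simp, intro allI impI)
    fix a assume a: "a \<in> {0..pi}"
    have "((\<lambda>b. k a * k b * sin (\<phi> b - \<phi> a)) has_integral
       (- k a * cos (\<phi> pi - \<phi> a) - - k a * cos (\<phi> a - \<phi> a))) {a..pi}"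
    proof (rule fundamental_theorem_of_calculus)
      fix b
      have "((\<lambda>b. - k a * cos (\<phi> b - \<phi> a)) has_real_derivative k a * k b * sin (\<phi> b - \<phi> a)) (at b within {a..pi})"
        by (rule derivative_eq_intros has_field_derivative_at_within[OF \<phi>_deriv] refl | simp)+
      then show "((\<lambda>b. - k a * cos (\<phi> b - \<phi> a)) has_vector_derivative k a * k b * sin (\<phi> b - \<phi> a)) (at b within {a..pi})"
        unfolding has_real_derivative_iff_has_vector_derivative .
    qed (use a in auto)
    then have "integral {a..pi} (\<lambda>b. k a * k b * sin (\<phi> b - \<phi> a)) = k a * (1 - cos (\<phi> pi - \<phi> a))"
      by (simp add: integral_unique algebra_simps)
    then show "(LINT b:{a..pi}|lborel. k a * k b * sin (\<phi> b - \<phi> a)) = k a * (1 - cos (\<phi> pi - \<phi> a))"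
      by (subst set_lint_continuous) (auto intro!: continuous_intros continuous_k continuous_\<phi>)
  qed
  also have "\<dots> = integral {0..pi} (\<lambda>a. k a * (1 - cos (\<phi> pi - \<phi> a)))"
    by (intro set_lint_continuous continuous_intros continuous_k continuous_\<phi>)
  also have "\<dots> = pi"
  proof (rule integral_unique)
    have "((\<lambda>a. k a * (1 - cos (\<phi> pi - \<phi> a))) has_integral
       ((\<phi> pi + sin (\<phi> pi - \<phi> pi)) - (\<phi> 0 + sin (\<phi> pi - \<phi> 0)))) {0..pi}"
    proof (rule fundamental_theorem_of_calculus)
      fix a
      have "((\<lambda>a. \<phi> a + sin (\<phi> pi - \<phi> a)) has_real_derivative k a * (1 - cos (\<phi> pi - \<phi> a))) (at a within {0..pi})"
        by (rule derivative_eq_intros has_field_derivative_at_within[OF \<phi>_deriv] refl | simp add: algebra_simps)+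
      then show "((\<lambda>a. \<phi> a + sin (\<phi> pi - \<phi> a)) has_vector_derivative k a * (1 - cos (\<phi> pi - \<phi> a))) (at a within {0..pi})"
        unfolding has_real_derivative_iff_has_vector_derivative .
    qed simp
    then show "((\<lambda>a. k a * (1 - cos (\<phi> pi - \<phi> a))) has_integral pi) {0..pi}"
      by (simp add: \<phi>_pi)
  qed
  finally show ?thesis .
qed

lemma kernel_form_rotation_ge:
  assumes \<theta>: "0 < \<theta>" "\<theta> < 1"
  shows "pi - 34 * \<beta> ^ 10 * pi * kap_const \<theta> * \<delta> powr (1 + \<theta>) \<le> kernel_form (p_ab f) (\<lambda>a. cos (\<phi> a)) (\<lambda>a. sin (\<phi> a))"
proof -
  have "kernel_form (p_ab f) (\<lambda>a. cos (\<phi> a)) (\<lambda>a. sin (\<phi> a))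
     = tri (\<lambda>a b. p_ab f a b * (cos (\<phi> a) * sin (\<phi> b) - cos (\<phi> b) * sin (\<phi> a)))"
    by (rule kernel_form_tri[OF tri_adm_p]) (auto intro!: borel_measurable_continuous_onI continuous_intros continuous_\<phi>)
  also have "\<dots> = tri (\<lambda>a b. k a * k b * sin (\<phi> b - \<phi> a) + K a b * sin (\<phi> b - \<phi> a))"
    by (rule tri_cong) (simp add: K_def sin_diff algebra_simps)
  also have "\<dots> = pi + tri (\<lambda>a b. K a b * sin (\<phi> b - \<phi> a))"
    by (subst tri_add) (auto intro!: tri_adm_mult tri_adm_K tri_adm_sin tri_adm_kk simp: tri_kk_sin)
  finally show ?thesis using tri_K_sin[OF \<theta>] by linarith
qed

end

section \<open>Estimate of the comass\<close>

lemma bracket_perturbation: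
  fixes v w v' w' p q p' q' C :: real
  assumes "\<bar>v\<bar> \<le> 1" "\<bar>v'\<bar> \<le> 1" "\<bar>q\<bar> \<le> C" "\<bar>q'\<bar> \<le> C"
  shows "\<bar>(v * w' - v' * w) - (p * q' - p' * q)\<bar> \<le>
    (1 + C) * ((\<bar>v - p\<bar> + \<bar>w - q\<bar>) + (\<bar>v' - p'\<bar> + \<bar>w' - q'\<bar>))"
proof -
  have C: "0 \<le> C" using assms by linarith
  have "(v * w' - v' * w) - (p * q' - p' * q) = v * (w' - q') + (v - p) * q' + (- v') * (w - q) + (- (v' - p')) * q"
    by (simp add: algebra_simps)
  also have "\<bar>\<dots>\<bar> \<le> 1 * \<bar>w' - q'\<bar> + \<bar>v - p\<bar> * C + 1 * \<bar>w - q\<bar> + \<bar>v' - p'\<bar> * C"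
    using assms by (intro abs_add_le abs_mult_le) auto
  also have "\<dots> \<le> (1 + C) * \<bar>w' - q'\<bar> + (1 + C) * \<bar>v - p\<bar> + (1 + C) * \<bar>w - q\<bar> + (1 + C) * \<bar>v' - p'\<bar>"
    using mult_nonneg_nonneg[OF C abs_ge_zero[of "w' - q'"]] mult_nonneg_nonneg[OF C abs_ge_zero[of "w - q"]]
    by (simp add: algebra_simps)
  finally show ?thesis by (simp add: algebra_simps)
qed

context near_hemi
begin

text \<open>The product of the constants met in estimating the remainder: 42 \<beta>^8 from
  \<open>K_bound\<close>, 1 + 2 pi from the perturbation of brackets, twice
  \<open>kap_const \<theta>\<close> from Schur's test, and \<beta> + 4 pi from comparing the L1 norm
  of the remainder with \<open>E\<close>.\<close>

definition upper_const :: "real \<Rightarrow> real" where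
  "upper_const \<theta> = 84 * \<beta> ^ 8 * (1 + 2 * pi) * kap_const \<theta> * (\<beta> + 4 * pi)"

text \<open>\<open>(p, g)\<close> is the uniform rotation obtained by freezing the turning
  coordinates at their values at 0. Each of \<open>v\<close> and \<open>w\<close> differs from it by
  its defect and the drifts of two coordinates, four drifts in all.\<close>

lemma rotation_distance:
  fixes v w :: "real \<Rightarrow> real"
  assumes v: "continuous_on UNIV v" and w: "continuous_on UNIV w" and t: "t \<in> {0..pi}"
  defines "E \<equiv> integral {0..pi} (\<lambda>x. k x * (\<bar>v x + prim w x\<bar> + \<bar>w x - prim v x\<bar>))"
    and "p \<equiv> - XX v w 0 * sin (\<phi> t) - YY v w 0 * cos (\<phi> t)"
    and "g \<equiv> XX v w 0 * cos (\<phi> t) - YY v w 0 * sin (\<phi> t)"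
  shows "\<bar>v t - p\<bar> + \<bar>w t - g\<bar> \<le> (\<bar>v t + prim w t\<bar> + \<bar>w t - prim v t\<bar>) + 4 * E"
proof -
  let ?X = "XX v w t - XX v w 0" and ?Y = "YY v w t - YY v w 0"
  note r = rotation_close[OF v w t, folded E_def]
  have "v t - p = (v t + prim w t) + (- ?X) * sin (\<phi> t) + (- ?Y) * cos (\<phi> t)"
    unfolding p_def using prim_XY(2)[where v=v and w=w and t=t] by (simp add: algebra_simps)
  also have "\<bar>\<dots>\<bar> \<le> \<bar>v t + prim w t\<bar> + E * 1 + E * 1"
    using r by (intro abs_add_le abs_mult_le) auto
  finally have 1: "\<bar>v t - p\<bar> \<le> \<bar>v t + prim w t\<bar> + 2 * E" by simp
  have "w t - g = (w t - prim v t) + ?X * cos (\<phi> t) + (- ?Y) * sin (\<phi> t)"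
    unfolding g_def using prim_XY(1)[where v=v and w=w and t=t] by (simp add: algebra_simps)
  also have "\<bar>\<dots>\<bar> \<le> \<bar>w t - prim v t\<bar> + E * 1 + E * 1"
    using r by (intro abs_add_le abs_mult_le) auto
  finally have 2: "\<bar>w t - g\<bar> \<le> \<bar>w t - prim v t\<bar> + 2 * E" by simp
  show ?thesis using 1 2 by linarith
qed

text \<open>The pair \<open>(v, w)\<close> is split into a rotating pair, on which the perturbation \<open>K\<close> of the kernel acts
  to second order, and a remainder that pays for itself through the isoperimetric deficit.\<close>

lemma kernel_form_continuous_le:
  assumes \<theta>: "0 < \<theta>" "\<theta> < 1" and \<theta>': "0 < \<theta>'" "\<theta>' < 1"
    and v: "continuous_on UNIV v" and w: "continuous_on UNIV w" and d: "\<And>x. (v x)\<^sup>2 + (w x)\<^sup>2 \<le> 1"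
  shows "kernel_form (p_ab f) v w \<le> pi + pi\<^sup>2 * (34 * \<beta> ^ 10 * pi * kap_const \<theta> * \<delta> powr (1 + \<theta>))
     + 2 * pi * (upper_const \<theta>' * \<delta> powr \<theta>')\<^sup>2"
proof -
  have v': "continuous_on S v" and w': "continuous_on S w" for S
    using v w continuous_on_subset by blast+
  let ?I = "integral {0..pi}"
  define aa where "aa x = v x + prim w x" for x
  define bb where "bb x = w x - prim v x" for x
  define E where "E = ?I (\<lambda>x. k x * (\<bar>aa x\<bar> + \<bar>bb x\<bar>))"
  define p where "p t = - XX v w 0 * sin (\<phi> t) - YY v w 0 * cos (\<phi> t)" for t
  define g where "g t = XX v w 0 * cos (\<phi> t) - YY v w 0 * sin (\<phi> t)" for t
  define y where "y t = \<bar>v t - p t\<bar> + \<bar>w t - g t\<bar>" for t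
  define R where "R = (XX v w 0)\<^sup>2 + (YY v w 0)\<^sup>2"
  have ca: "continuous_on {0..pi} aa" "continuous_on {0..pi} bb"
    unfolding aa_def bb_def by (intro continuous_intros v' w' continuous_prim)+
  have cy: "continuous_on S y" for S
    unfolding y_def p_def g_def by (intro continuous_intros v' w' continuous_\<phi>)
  have R: "0 \<le> R" "R \<le> pi\<^sup>2" using XY_0_bound[OF v w d] by (auto simp: R_def)
  have qb: "\<bar>g t\<bar> \<le> 2 * pi" for t
  proof -
    have "(XX v w 0)\<^sup>2 \<le> pi\<^sup>2" "(YY v w 0)\<^sup>2 \<le> pi\<^sup>2"
      using R(2) zero_le_power2[of "XX v w 0"] zero_le_power2[of "YY v w 0"] unfolding R_def by linarith+
    then have "\<bar>XX v w 0\<bar> \<le> pi" "\<bar>YY v w 0\<bar> \<le> pi"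
      by (auto simp: abs_le_square_iff[symmetric])
    then have "\<bar>XX v w 0 * cos (\<phi> t) + (- YY v w 0) * sin (\<phi> t)\<bar> \<le> pi * 1 + pi * 1"
      by (intro abs_add_le abs_mult_le) auto
    then show ?thesis by (simp add: g_def)
  qed
  have yE: "?I y \<le> (\<beta> + 4 * pi) * E"
  proof -
    have kE: "((\<lambda>x. k x * (\<bar>aa x\<bar> + \<bar>bb x\<bar>)) has_integral E) {0..pi}"
      unfolding E_def by (intro integrable_integral integrable_continuous_interval continuous_intros continuous_k ca)
    have "(y has_integral ?I y) {0..pi}"
      by (intro integrable_integral integrable_continuous_interval cy)
    moreover have "((\<lambda>x. \<beta> * (k x * (\<bar>aa x\<bar> + \<bar>bb x\<bar>)) + 4 * E) has_integral (\<beta> * E + 4 * E * pi)) {0..pi}"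
      using has_integral_add[OF has_integral_mult_right[OF kE, of \<beta>] has_integral_const_real[of "4 * E" 0 pi]]
      by (simp add: mult.commute)
    ultimately have "?I y \<le> \<beta> * E + 4 * E * pi"
    proof (rule has_integral_le)
      fix x assume x: "x \<in> {0..pi}"
      \<comment> \<open>As \<sigma> \<le> D \<le> k, passing from the weight \<open>k\<close> to
        Lebesgue measure costs the factor \<open>\<beta>\<close>.\<close>
      have "1 \<le> \<beta> * k x" using k_ge[of x] \<sigma> by (simp add: \<beta>_def pos_le_divide_eq)
      then have "1 * (\<bar>aa x\<bar> + \<bar>bb x\<bar>) \<le> \<beta> * k x * (\<bar>aa x\<bar> + \<bar>bb x\<bar>)"
        by (intro mult_right_mono) auto
      moreover have "y x \<le> (\<bar>aa x\<bar> + \<bar>bb x\<bar>) + 4 * E"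
        using rotation_distance[OF v w x] unfolding y_def p_def g_def aa_def bb_def E_def .
      ultimately show "y x \<le> \<beta> * (k x * (\<bar>aa x\<bar> + \<bar>bb x\<bar>)) + 4 * E" by (simp add: mult_ac)
    qed
    then show ?thesis by (simp add: algebra_simps)
  qed
  have akb: "tri_adm (\<lambda>a b. k a * k b * (v a * w b - v b * w a))"
    by (intro tri_adm_mult tri_adm_kk tri_adm_continuous continuous_intros continuous_on_compose2[OF v]
      continuous_on_compose2[OF w] subset_UNIV)
  have abr: "tri_adm (\<lambda>a b. (v a * w b - v b * w a) - R * sin (\<phi> b - \<phi> a))"
    by (intro tri_adm_continuous continuous_intros continuous_on_compose2[OF v]
      continuous_on_compose2[OF w] continuous_on_compose2[OF continuous_\<phi>[of UNIV]] subset_UNIV)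
  have aKs: "tri_adm (\<lambda>a b. R * (K a b * sin (\<phi> b - \<phi> a)))"
    by (intro tri_adm_mult tri_adm_K tri_adm_sin tri_adm_const)
  have aKr: "tri_adm (\<lambda>a b. K a b * ((v a * w b - v b * w a) - R * sin (\<phi> b - \<phi> a)))"
    by (intro tri_adm_mult tri_adm_K abr)
  have "kernel_form (p_ab f) v w = tri (\<lambda>a b. p_ab f a b * (v a * w b - v b * w a))"
    by (rule kernel_form_tri[OF tri_adm_p _ _ d]) (auto intro: borel_measurable_continuous_onI v w)
  also have "\<dots> = tri (\<lambda>a b. k a * k b * (v a * w b - v b * w a) +
      (R * (K a b * sin (\<phi> b - \<phi> a)) + K a b * ((v a * w b - v b * w a) - R * sin (\<phi> b - \<phi> a))))"
    by (rule tri_cong) (simp add: K_def algebra_simps)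
  also have "\<dots> = tri (\<lambda>a b. k a * k b * (v a * w b - v b * w a)) +
     (R * tri (\<lambda>a b. K a b * sin (\<phi> b - \<phi> a)) + tri (\<lambda>a b. K a b * ((v a * w b - v b * w a) - R * sin (\<phi> b - \<phi> a))))"
    unfolding tri_add[OF akb tri_adm_add[OF aKs aKr]] tri_add[OF aKs aKr] tri_cmult ..
  finally have split: "kernel_form (p_ab f) v w = tri (\<lambda>a b. k a * k b * (v a * w b - v b * w a)) +
     (R * tri (\<lambda>a b. K a b * sin (\<phi> b - \<phi> a)) + tri (\<lambda>a b. K a b * ((v a * w b - v b * w a) - R * sin (\<phi> b - \<phi> a))))" .
  define e2 where "e2 = ?I (\<lambda>x. k x * ((aa x)\<^sup>2 + (bb x)\<^sup>2))"
  have T1: "tri (\<lambda>a b. k a * k b * (v a * w b - v b * w a)) \<le> pi - e2 / 2"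
    using deficit[OF v w d] unfolding e2_def aa_def bb_def .
  have T2: "R * tri (\<lambda>a b. K a b * sin (\<phi> b - \<phi> a)) \<le> pi\<^sup>2 * (34 * \<beta> ^ 10 * pi * kap_const \<theta> * \<delta> powr (1 + \<theta>))"
  proof -
    have "\<bar>R * tri (\<lambda>a b. K a b * sin (\<phi> b - \<phi> a))\<bar> \<le> pi\<^sup>2 * (34 * \<beta> ^ 10 * pi * kap_const \<theta> * \<delta> powr (1 + \<theta>))"
      using R tri_K_sin[OF \<theta>] by (intro abs_mult_le) auto
    then show ?thesis by linarith
  qed
  define c where "c = upper_const \<theta>' * \<delta> powr \<theta>'"
  have T3: "tri (\<lambda>a b. K a b * ((v a * w b - v b * w a) - R * sin (\<phi> b - \<phi> a))) \<le> c * E"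
  proof -
    let ?C = "42 * \<beta> ^ 8 * (1 + 2 * pi)"
    have C0: "0 \<le> ?C" using \<beta> by simp
    have ay: "tri_adm (\<lambda>a b. y a)" "tri_adm (\<lambda>a b. y b)"
      by (intro tri_adm_continuous continuous_on_compose2[OF cy[of UNIV]] continuous_intros subset_UNIV)+
    have am: "tri_adm (\<lambda>a b. ?C * (kap \<theta>' \<delta> (sin (b - a)) * (y a + y b)))"
      by (intro tri_adm_mult tri_adm_const tri_adm_add tri_adm_kap \<theta>' \<delta> ay)
    have "\<bar>tri (\<lambda>a b. K a b * ((v a * w b - v b * w a) - R * sin (\<phi> b - \<phi> a)))\<bar>
        \<le> tri (\<lambda>a b. ?C * (kap \<theta>' \<delta> (sin (b - a)) * (y a + y b)))"
    proof (rule tri_abs_le[OF aKr am])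
      fix a b :: real assume ab: "0 \<le> a" "a \<le> b" "b \<le> pi"
      \<comment> \<open>The rotating pair has squared radius \<open>R\<close>, so its bracket is
        \<open>R\<close> times that of the extremal pair, and the cancellation of the first
        variation carries over to it.\<close>
      have "R * sin (\<phi> b - \<phi> a) = p a * g b - p b * g a"
        unfolding R_def p_def g_def sin_diff by algebra
      then have "\<bar>(v a * w b - v b * w a) - R * sin (\<phi> b - \<phi> a)\<bar> \<le> (1 + 2 * pi) * (y a + y b)"
        using bracket_perturbation[OF disc_abs_le(1)[OF d] disc_abs_le(1)[OF d] qb qb] by (simp add: y_def)
      then have "\<bar>K a b * ((v a * w b - v b * w a) - R * sin (\<phi> b - \<phi> a))\<bar>
          \<le> (42 * \<beta> ^ 8 * kap \<theta>' \<delta> (sin (b - a))) * ((1 + 2 * pi) * (y a + y b))"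
        using \<theta>' by (intro abs_mult_le K_bound ab) auto
      then show "\<bar>K a b * ((v a * w b - v b * w a) - R * sin (\<phi> b - \<phi> a))\<bar> \<le> ?C * (kap \<theta>' \<delta> (sin (b - a)) * (y a + y b))"
        by (simp only: mult_ac)
    qed
    also have "\<dots> \<le> ?C * (2 * kap_const \<theta>' * \<delta> powr \<theta>' * ?I y)"
      unfolding tri_cmult
      by (intro mult_left_mono tri_kap_schur \<theta>' \<delta> cy C0) (simp add: y_def)
    also have "\<dots> \<le> ?C * (2 * kap_const \<theta>' * \<delta> powr \<theta>' * ((\<beta> + 4 * pi) * E))"
      using C0 kap_const_nonneg[OF \<theta>'(2)] by (intro mult_left_mono yE mult_nonneg_nonneg) auto
    also have "\<dots> = c * E"
      unfolding c_def upper_const_def by (simp add: mult_ac)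
    finally show ?thesis by linarith
  qed
  have "c * E \<le> 2 * pi * c\<^sup>2 + e2 / 4"
  proof -
    \<comment> \<open>Young's inequality with the weight 1/4 uses up half of the available deficit
      \<open>e2 / 2\<close>; the cost of c^2 for each of two defects, integrated over the total
      angle pi, is 2 pi c^2.\<close>
    have young: "c * \<bar>x\<bar> \<le> c\<^sup>2 + x\<^sup>2 / 4" for x
    proof -
      have "0 \<le> (c - \<bar>x\<bar> / 2)\<^sup>2" by simp
      then show ?thesis by (simp add: power2_diff power_divide)
    qed
    have i1: "((\<lambda>x. c * (k x * (\<bar>aa x\<bar> + \<bar>bb x\<bar>))) has_integral c * E) {0..pi}"
      unfolding E_def
      by (intro has_integral_mult_right integrable_integral integrable_continuous_interval continuous_intros continuous_k ca)
    have i2: "((\<lambda>x. k x * ((aa x)\<^sup>2 + (bb x)\<^sup>2)) has_integral e2) {0..pi}"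
      unfolding e2_def by (intro integrable_integral integrable_continuous_interval continuous_intros continuous_k ca)
    have "((\<lambda>x. 2 * c\<^sup>2 * k x + 1 / 4 * (k x * ((aa x)\<^sup>2 + (bb x)\<^sup>2))) has_integral (2 * c\<^sup>2 * pi + 1 / 4 * e2)) {0..pi}"
      by (intro has_integral_add has_integral_mult_right k_total i2)
    with i1 have "c * E \<le> 2 * c\<^sup>2 * pi + 1 / 4 * e2"
    proof (rule has_integral_le)
      fix x
      have "k x * (c * \<bar>aa x\<bar> + c * \<bar>bb x\<bar>) \<le> k x * ((c\<^sup>2 + (aa x)\<^sup>2 / 4) + (c\<^sup>2 + (bb x)\<^sup>2 / 4))"
        using k_pos[of x] by (intro mult_left_mono add_mono young) auto
      then show "c * (k x * (\<bar>aa x\<bar> + \<bar>bb x\<bar>)) \<le> 2 * c\<^sup>2 * k x + 1 / 4 * (k x * ((aa x)\<^sup>2 + (bb x)\<^sup>2))"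
        by (simp add: algebra_simps)
    qed
    then show ?thesis by (simp add: mult_ac)
  qed
  moreover have "0 \<le> e2"
    unfolding e2_def
  proof (rule Henstock_Kurzweil_Integration.integral_nonneg)
    show "(\<lambda>x. k x * ((aa x)\<^sup>2 + (bb x)\<^sup>2)) integrable_on {0..pi}"
      by (intro integrable_continuous_interval continuous_intros continuous_k ca)
    show "0 \<le> k x * ((aa x)\<^sup>2 + (bb x)\<^sup>2)" for x using k_pos[of x] by simp
  qed
  ultimately show ?thesis
    unfolding split c_def[symmetric] using T1 T2 T3 by linarith
qed

lemma comass_near:
  assumes \<xi>: "1 < \<xi>" "\<xi> < 2"
  shows "\<bar>comass_ir f - 1\<bar> \<le> (pi\<^sup>2 * (34 * \<beta> ^ 10 * kap_const (\<xi> - 1)) + 34 * \<beta> ^ 10 * kap_const (\<xi> - 1)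
     + 2 * (upper_const (\<xi> / 2))\<^sup>2) * \<delta> powr \<xi>"
proof -
  let ?a = "34 * \<beta> ^ 10 * kap_const (\<xi> - 1)" and ?u = "upper_const (\<xi> / 2)"
  have ge: "0 \<le> ?a" using \<beta> kap_const_nonneg[of "\<xi> - 1"] \<xi> by simp
  have sq: "(?u * \<delta> powr (\<xi> / 2))\<^sup>2 = ?u\<^sup>2 * \<delta> powr \<xi>"
    using \<delta> by (simp add: power_mult_distrib power2_eq_square powr_add[symmetric])
  have c: "continuous_on UNIV (\<lambda>a. cos (\<phi> a))" "continuous_on UNIV (\<lambda>a. sin (\<phi> a))"
    by (intro continuous_intros continuous_\<phi>)+
  let ?M = "1 + (pi\<^sup>2 * ?a + 2 * ?u\<^sup>2) * \<delta> powr \<xi>"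
  have up: "kernel_form (p_ab f) v w \<le> pi * ?M" if "v \<in> borel_measurable borel" "w \<in> borel_measurable borel"
    "\<And>x. (v x)\<^sup>2 + (w x)\<^sup>2 \<le> 1" for v w
  proof (rule kernel_form_le_of_continuous[OF tri_adm_p _ that])
    fix v w :: "real \<Rightarrow> real"
    assume vw: "continuous_on UNIV v" "continuous_on UNIV w" "\<And>x. (v x)\<^sup>2 + (w x)\<^sup>2 \<le> (1::real)"
    have "kernel_form (p_ab f) v w \<le> pi + pi\<^sup>2 * (34 * \<beta> ^ 10 * pi * kap_const (\<xi> - 1) * \<delta> powr (1 + (\<xi> - 1)))
       + 2 * pi * (?u * \<delta> powr (\<xi> / 2))\<^sup>2"
      by (rule kernel_form_continuous_le[OF _ _ _ _ vw]) (use \<xi> in auto)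
    also have "\<dots> = pi * ?M" unfolding sq by (simp add: algebra_simps)
    finally show "kernel_form (p_ab f) v w \<le> pi * ?M" .
  qed
  have low: "pi * (1 - ?a * \<delta> powr \<xi>) \<le> kernel_form (p_ab f) (\<lambda>a. cos (\<phi> a)) (\<lambda>a. sin (\<phi> a))"
    using kernel_form_rotation_ge[of "\<xi> - 1"] \<xi> by (simp add: algebra_simps)
  note cb = comass_ir_bounds[OF p_ab_measurable[OF f] up borel_measurable_continuous_onI[OF c(1)]
     borel_measurable_continuous_onI[OF c(2)] _ low]
  have "1 - ?a * \<delta> powr \<xi> \<le> comass_ir f" "comass_ir f \<le> ?M" by (rule cb; simp)+
  moreover have "0 \<le> ?a * \<delta> powr \<xi>" "0 \<le> pi\<^sup>2 * ?a * \<delta> powr \<xi>" "0 \<le> 2 * ?u\<^sup>2 * \<delta> powr \<xi>"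
    using ge by (auto intro!: mult_nonneg_nonneg)
  ultimately show ?thesis unfolding distrib_right abs_le_iff by linarith
qed

end

section \<open>Distances in the injective hull\<close>

lemma cos_lipschitz: "\<bar>cos x - cos y\<bar> \<le> \<bar>x - y\<bar>" for x y :: real
proof -
  have "norm (cos x - cos y) \<le> 1 * norm (x - y)"
    by (rule field_differentiable_bound[of UNIV _ "\<lambda>x. - sin x"]) (auto intro!: derivative_eq_intros)
  then show ?thesis by simp
qed

lemma ES1_range:
  assumes "f \<in> ES1"
  shows "0 \<le> f a" "f a \<le> pi"
proof -
  have "\<bar>f (a + pi) - f a\<bar> \<le> \<bar>(a + pi) - a\<bar>" "f (a + pi) + f a = pi"
    using assms unfolding ES1_def by blast+
  then show "0 \<le> f a" "f a \<le> pi" by simp_all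
qed

lemma ES1_periodic:
  assumes f: "f \<in> ES1" and n: "n \<in> \<int>"
  shows "f (x + 2 * n * pi) = f x"
proof -
  have anti: "f (a + pi) = pi - f a" for a
  proof -
    have "f (a + pi) + f a = pi" using f by (simp add: ES1_def)
    then show ?thesis by linarith
  qed
  have step: "f (a + 2 * pi) = f a" for a
    using anti[of a] anti[of "a + pi"] by (simp add: add.assoc)
  have nat: "f (a + 2 * real m * pi) = f a" for a m
  proof (induction m)
    case (Suc m)
    have "a + 2 * real (Suc m) * pi = (a + 2 * real m * pi) + 2 * pi" by (simp add: algebra_simps)
    then show ?case using step[of "a + 2 * real m * pi"] Suc by metis
  qed simp
  obtain i where i: "n = of_int i" using n by (auto elim: Ints_cases)
  show ?thesis
  proof (cases "0 \<le> i")
    case True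
    then show ?thesis using nat[of x "nat i"] i by simp
  next
    case False
    then have "n = - real (nat (- i))" using i by simp
    then show ?thesis using nat[of "x + 2 * n * pi" "nat (- i)"] by simp
  qed
qed

text \<open>The value of \<open>f\<close> at \<open>t\<close> is an upper bound for the distance
  from \<open>f\<close> to the boundary point at angle \<open>t\<close>. By periodicity
  \<open>a\<close> may be taken as t + e or t - e with e in \<open>{0..pi}\<close>; the Lipschitz
  condition is then used against \<open>t\<close> and against its antipode on the same side.\<close>

lemma ES1_arccos_distance:
  assumes f: "f \<in> ES1"
  shows "\<bar>f a - arccos (cos (a - t))\<bar> \<le> f t"
proof -
  have lip: "\<bar>f x - f y\<bar> \<le> \<bar>x - y\<bar>" and anti: "f (x + pi) + f x = pi" for x y
    using f by (auto simp: ES1_def)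
  define e where "e = arccos (cos (a - t))"
  have e: "0 \<le> e" "e \<le> pi" by (auto simp: e_def intro!: arccos_lbound arccos_ubound)
  have "cos (a - t) = cos e" by (simp add: e_def)
  then obtain n where n: "n \<in> \<int>" "a - t = e + 2 * n * pi \<or> a - t = - e + 2 * n * pi"
    unfolding cos_eq by blast
  have "f a = f (t + e) \<or> f a = f (t - e)"
  proof -
    have "a = (t + e) + 2 * n * pi \<or> a = (t - e) + 2 * n * pi" using n(2) by linarith
    then show ?thesis using ES1_periodic[OF f n(1)] by metis
  qed
  moreover have "\<bar>f (t + e) - e\<bar> \<le> f t"
    using lip[of "t + e" t] lip[of "t + e" "t + pi"] anti[of t] e by linarith
  moreover have "\<bar>f (t - e) - e\<bar> \<le> f t"
    using lip[of "t - e" t] lip[of "t - e" "t - pi"] anti[of t] anti[of "t - pi"] e by simp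
  ultimately show ?thesis unfolding e_def[symmetric] by auto
qed

lemma abs_diff_bdd:
  assumes "\<And>a. 0 \<le> f a \<and> f a \<le> pi" "\<And>a. 0 \<le> g a \<and> g a \<le> pi"
  shows "bdd_above (range (\<lambda>a. \<bar>f a - g a\<bar>))"
proof (rule bdd_aboveI2[where M=pi])
  show "\<bar>f a - g a\<bar> \<le> pi" for a using assms(1)[of a] assms(2)[of a] by linarith
qed

lemma sup_dist_nonneg:
  assumes "\<And>a. 0 \<le> f a \<and> f a \<le> pi" "\<And>a. 0 \<le> g a \<and> g a \<le> pi"
  shows "0 \<le> sup_dist f g"
  unfolding sup_dist_def
  by (rule order_trans[OF abs_ge_zero cSUP_upper[OF UNIV_I abs_diff_bdd[OF assms]]])

lemma S1_range: "g \<in> S1 \<Longrightarrow> 0 \<le> g a \<and> g a \<le> pi"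
  unfolding S1_def by (auto intro!: arccos_lbound arccos_ubound)

lemma abs_cos_mult_cos: "\<bar>cos x * cos y\<bar> \<le> 1" for x y :: real
  using abs_mult_le[OF abs_cos_le_one abs_cos_le_one] by simp

lemma S2plus_range: "g \<in> S2plus \<Longrightarrow> 0 \<le> g a \<and> g a \<le> pi"
  unfolding S2plus_def
  by (auto intro!: arccos_lbound arccos_ubound) (use abs_cos_mult_cos abs_le_iff minus_le_iff in metis)+

lemma set_sup_dist_S1_le:
  assumes f: "f \<in> ES1"
  shows "set_sup_dist f S1 \<le> f t"
proof -
  let ?g = "\<lambda>a. arccos (cos (a - t))"
  have "?g \<in> S1" unfolding S1_def by blast
  moreover have "bdd_below ((\<lambda>g. sup_dist f g) ` S1)"
    using sup_dist_nonneg S1_range ES1_range[OF f] by (intro bdd_belowI2[where m=0]) blast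
  ultimately have "set_sup_dist f S1 \<le> sup_dist f ?g"
    unfolding set_sup_dist_def by (intro cINF_lower)
  also have "\<dots> \<le> f t"
    unfolding sup_dist_def by (rule cSUP_least) (auto intro: ES1_arccos_distance[OF f])
  finally show ?thesis .
qed

lemma S2plus_nonempty: "S2plus \<noteq> {}"
  unfolding S2plus_def using pi_ge_zero by (auto intro!: exI[of _ 0])

lemma set_sup_dist_S2plus_nonneg:
  assumes f: "f \<in> ES1"
  shows "0 \<le> set_sup_dist f S2plus"
  unfolding set_sup_dist_def
  by (rule cINF_greatest[OF S2plus_nonempty]) (use sup_dist_nonneg S2plus_range ES1_range[OF f] in blast)

text \<open>The strict inequality for \<open>\<delta>\<close> avoids the question whether the
  infimum over \<open>S2plus\<close> is attained.\<close>

lemma near_S2plus: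
  assumes f: "f \<in> ES1" and \<delta>: "set_sup_dist f S2plus < \<delta>"
  shows "\<exists>\<tau> d. 0 \<le> d \<and> d \<le> pi / 2 \<and> (\<forall>a. \<bar>f a - arccos (cos d * cos (a - \<tau>))\<bar> \<le> \<delta>)"
proof -
  obtain g where g: "g \<in> S2plus" "sup_dist f g < \<delta>"
    using cInf_lessD[OF _ \<delta>[unfolded set_sup_dist_def]] S2plus_nonempty by auto
  have "\<bar>f a - g a\<bar> \<le> \<delta>" for a
  proof -
    have "\<bar>f a - g a\<bar> \<le> sup_dist f g"
      unfolding sup_dist_def using ES1_range[OF f] S2plus_range[OF g(1)]
      by (intro cSUP_upper UNIV_I abs_diff_bdd) auto
    then show ?thesis using g(2) by linarith
  qed
  then show ?thesis using g(1) unfolding S2plus_def by blast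
qed

lemma sin_ge_sin:
  assumes "0 \<le> s" "s \<le> x" "x \<le> pi - s"
  shows "sin s \<le> sin x"
proof (cases "x \<le> pi / 2")
  case True
  then show ?thesis using assms by (intro sin_monotone_2pi_le) auto
next
  case False
  then have "sin s \<le> sin (pi - x)" using assms by (intro sin_monotone_2pi_le) auto
  then show ?thesis by simp
qed

text \<open>Covers the functions that are not close to the hemisphere, where no smallness is asked
  for. The kernel is bounded on a set of finite area, and the zero pair with m = 0 serves as the
  test pair.\<close>

lemma comass_crude:
  assumes f: "f \<in> ES1" and B: "\<And>a. 1 / B \<le> (sin (f a))\<^sup>2" "0 < B"
  shows "\<bar>comass_ir f - 1\<bar> \<le> 1 + pi * B\<^sup>2"
proof -
  note p = tri_adm_p_ab[OF f B]
  have "kernel_form (p_ab f) v w \<le> pi * (pi * B\<^sup>2)"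
    if vw: "v \<in> borel_measurable borel" "w \<in> borel_measurable borel" "\<And>x. (v x)\<^sup>2 + (w x)\<^sup>2 \<le> 1" for v w
  proof -
    have "\<bar>tri (\<lambda>a b. p_ab f a b * (v a * w b - v b * w a))\<bar> \<le> tri (\<lambda>a b. B\<^sup>2)"
    proof (rule tri_abs_le[OF tri_adm_bracket[OF p vw] tri_adm_const])
      fix a b :: real assume ab: "0 \<le> a" "a \<le> b" "b \<le> pi"
      have "\<bar>p_ab f a b * (v a * w b - v b * w a)\<bar> \<le> B\<^sup>2 * 1"
        by (intro abs_mult_le p_ab_bound f B ab bracket_le_1 vw)
      then show "\<bar>p_ab f a b * (v a * w b - v b * w a)\<bar> \<le> B\<^sup>2" by simp
    qed
    then show ?thesis
      using tri_const_le[of "B\<^sup>2"] by (simp add: kernel_form_tri[OF p vw] power2_eq_square mult_ac)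
  qed
  note cb = comass_ir_bounds(2,3)[OF p_ab_measurable[OF f] this borel_measurable_const[of 0] borel_measurable_const[of 0],
      where m=0]
  have "kernel_form (p_ab f) (\<lambda>_. 0) (\<lambda>_. 0) = 0" by (simp add: kernel_form_def)
  then have "0 \<le> comass_ir f" "comass_ir f \<le> pi * B\<^sup>2" by (intro cb; simp)+
  then show ?thesis by linarith
qed

text \<open>The order of quantifiers is the point: for fixed \<open>\<sigma>\<close> and
  \<open>\<xi>\<close>, one constant serves all hemisphere points, all functions and all
  errors.\<close>

lemma comass_near_uniform:
  assumes \<xi>: "1 < \<xi>" "\<xi> < 2"
  shows "\<exists>C. \<forall>A D \<tau> f \<delta>. near_hemi A D \<tau> f \<delta> \<sigma> \<longrightarrow> \<bar>comass_ir f - 1\<bar> \<le> C * \<delta> powr \<xi>"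
  using near_hemi.comass_near[OF _ \<xi>] by blast

theorem theorem1p2:
  fixes r \<xi> :: real
  assumes "r > 0" and "1 < \<xi>" and "\<xi> < 2"
  shows "\<exists>C>0. \<forall>f\<in>ES1. set_sup_dist f S1 \<ge> r \<longrightarrow>
           \<bar>comass_ir f - 1\<bar> \<le> C * (set_sup_dist f S2plus) powr \<xi>"
proof -
  \<comment> \<open>A hemisphere point within \<delta> < r/2 of \<open>f\<close> has d \<ge> r/2, so
    half of \<open>r\<close> serves for the height sin d as well as for sin f.\<close>
  define \<sigma> where "\<sigma> = sin (r / 2)"
  obtain C1 where C1: "\<And>A D \<tau> f \<delta>. near_hemi A D \<tau> f \<delta> \<sigma> \<Longrightarrow> \<bar>comass_ir f - 1\<bar> \<le> C1 * \<delta> powr \<xi>"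
    using comass_near_uniform[OF assms(2,3)] by blast
  \<comment> \<open>Scaled so that the crude bound is covered as soon as \<delta> is at least
    r/2.\<close>
  define C2 where "C2 = (1 + pi * (1 / \<sigma>\<^sup>2)\<^sup>2) / (r / 2) powr \<xi>"
  define C where "C = max 1 (max C1 C2)"
  have "\<bar>comass_ir f - 1\<bar> \<le> C * (set_sup_dist f S2plus) powr \<xi>"
    if f: "f \<in> ES1" and far: "set_sup_dist f S1 \<ge> r" for f
  proof -
    have fr: "r \<le> f a" "f a \<le> pi - r" for a
    proof -
      show "r \<le> f a" for a using set_sup_dist_S1_le[OF f, of a] far by linarith
      from this[of "a + pi"] have "r \<le> f (a + pi)" .
      moreover have "f (a + pi) + f a = pi" using f unfolding ES1_def by blast
      ultimately show "f a \<le> pi - r" by linarith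
    qed
    have r: "r \<le> pi / 2" using fr[of 0] by linarith
    \<comment> \<open>For large \<open>r\<close> the sine may be nonpositive; only the existence of
      an \<open>f\<close> this far from \<open>S1\<close> forces r \<le> pi/2 and hence
      positivity.\<close>
    have \<sigma>0: "0 < \<sigma>" unfolding \<sigma>_def using assms(1) r by (intro sin_gt_zero) auto
    have nd: "\<sigma>\<^sup>2 \<le> (sin (f a))\<^sup>2" for a
    proof (rule power_mono)
      show "\<sigma> \<le> sin (f a)" unfolding \<sigma>_def using fr[of a] assms(1) by (intro sin_ge_sin) auto
    qed (use \<sigma>0 in simp)
    have bound: "\<bar>comass_ir f - 1\<bar> \<le> C * \<delta> powr \<xi>" if \<delta>: "set_sup_dist f S2plus < \<delta>" for \<delta>
    proof (cases "r / 2 \<le> \<delta>")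
      case True
      have "\<bar>comass_ir f - 1\<bar> \<le> 1 + pi * (1 / \<sigma>\<^sup>2)\<^sup>2"
        by (rule comass_crude[OF f]) (use nd \<sigma>0 in auto)
      also have "\<dots> = C2 * (r / 2) powr \<xi>" unfolding C2_def using assms(1) by simp
      also have "\<dots> \<le> C * \<delta> powr \<xi>"
        unfolding C_def using True assms by (intro mult_mono powr_mono2) auto
      finally show ?thesis .
    next
      case False
      obtain \<tau> d where d: "0 \<le> d" "d \<le> pi / 2" and fd: "\<And>a. \<bar>f a - arccos (cos d * cos (a - \<tau>))\<bar> \<le> \<delta>"
        using near_S2plus[OF f \<delta>] by blast
      have "arccos (cos d) = d" using d by (intro arccos_cos) auto
      then have dr: "r / 2 \<le> d" using fd[of \<tau>] fr[of \<tau>] False by simp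
      have sd: "\<sigma> \<le> sin d" unfolding \<sigma>_def using dr d assms(1) by (intro sin_monotone_2pi_le) auto
      have "near_hemi (cos d) (sin d) \<tau> f \<delta> \<sigma>"
      proof
        show "(cos d)\<^sup>2 + (sin d)\<^sup>2 = 1" by simp
        show "0 < sin d" using sd \<sigma>0 by linarith
        then interpret hemi "cos d" "sin d" \<tau> by unfold_locales simp_all
        show "\<bar>cos (f a) - hemi.x0 (cos d) \<tau> a\<bar> \<le> \<delta>" for a
        proof -
          have "cos (arccos (cos d * cos (a - \<tau>))) = cos d * cos (a - \<tau>)"
            using abs_cos_mult_cos[of d "a - \<tau>"] by (intro cos_arccos_abs)
          then show ?thesis
            using cos_lipschitz[of "f a" "arccos (cos d * cos (a - \<tau>))"] fd[of a] by (simp add: x0_def)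
        qed
        show "0 < \<delta>" using set_sup_dist_S2plus_nonneg[OF f] \<delta> by linarith
      qed (use f \<sigma>0 sd nd in auto)
      from C1[OF this] have "\<bar>comass_ir f - 1\<bar> \<le> C1 * \<delta> powr \<xi>" .
      also have "\<dots> \<le> C * \<delta> powr \<xi>" by (intro mult_right_mono) (auto simp: C_def)
      finally show ?thesis .
    qed
    \<comment> \<open>The bound is known for every \<delta> strictly above the distance, where
      \<delta> is positive, and passes to the limit from the right. This includes distance 0, since
      \<open>powr\<close> with a positive exponent is continuous there from the right.\<close>
    let ?d0 = "set_sup_dist f S2plus"
    show ?thesis
    proof (rule tendsto_lowerbound)
      have "eventually (\<lambda>\<delta>. 0 \<le> \<delta>) (at_right ?d0)"
        using eventually_at_right_less[of ?d0]
        by eventually_elim (use set_sup_dist_S2plus_nonneg[OF f] in linarith)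
      then show "((\<lambda>\<delta>. C * \<delta> powr \<xi>) \<longlongrightarrow> C * ?d0 powr \<xi>) (at_right ?d0)"
        using assms(2) by (intro tendsto_intros tendsto_powr') auto
      show "eventually (\<lambda>\<delta>. \<bar>comass_ir f - 1\<bar> \<le> C * \<delta> powr \<xi>) (at_right ?d0)"
        using eventually_at_right_less[of ?d0] by eventually_elim (rule bound)
    qed simp
  qed
  moreover have "0 < C" by (simp add: C_def)
  ultimately show ?thesis by blast
qed

end
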